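(* Let $n\ge 1$ and $r\geq 2$ be integers, let $p_1,\ldots,p_r>0$ with $\sum_{j=1}^r p_j=1$, put $p_*:=\min_{1\le j\le r}p_j$, and let $(U_1,\ldots,U_r)$ be the multinomial vector of observed counts of $n$ independent trials with classification probabilities $p_1,\ldots,p_r$. Let $\lambda>-1$ and let $T_\lambda$ be the power divergence statistic with index parameter $\lambda$. Suppose that $np_*\geq 2$. If $\lambda\geq 2$, suppose additionally that $np_*\geq 2(\lambda-2)^2$. Let $Y_{r-1}$ have the chi-square distribution with $r-1$ degrees of freedom. Then $\sup_{z>0}|\mathbb{P}(T_\lambda\leq z)-\mathbb{P}(Y_{r-1}\leq z)|$ is at most (i) if $r=2$: $$\frac{1}{(np_* )^{1/10}}\bigg\{8+\bigg(21+\frac{|\lambda-1|(4\lambda+7)r}{52(\lambda+1)}\bigg)\frac{1}{(np_* )^{1/5}}+\frac{72}{(np_* )^{2/5}}\bigg\};$$ (ii) if $r=3$: $$\frac{1}{(np_* )^{1/6}}\bigg\{19+\bigg(44+\frac{|\lambda-1|(4\lambda+7)r}{25(\lambda+1)}\bigg)\frac{1}{(np_* )^{1/6}}+\frac{72}{(np_* )^{1/3}}\bigg\};$$ (iii) if $r\geq 4$: $$\frac{1}{(r-3)^{1/3}(np_* )^{1/6}}\bigg\{13+\bigg(37+\frac{|\lambda-1|(4\lambda+7)r}{30(\lambda+1)}\bigg)\frac{(r-3)^{1/6}}{(np_* )^{1/6}}+\frac{72(r-3)^{1/3}}{(np_* )^{1/3}}\bigg\}.$$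
   Context: The power divergence statistic, for $\lambda>-1$, $\lambda\ne 0$, is $$T_\lambda=\frac{2}{\lambda(\lambda+1)}\sum_{j=1}^rU_j\bigg[\bigg(\frac{U_j}{np_j}\bigg)^\lambda-1\bigg],$$ where $U_j(U_j/(np_j))^\lambda$ means $U_j^{\lambda+1}/(np_j)^\lambda$ (so it equals $0$ when $U_j=0$). For $\lambda=0$ it is defined by passage to the limit: $$T_0=2\sum_{j=1}^rU_j\log\bigg(\frac{U_j}{np_j}\bigg),\qquad 0\log 0:=0.$$ *)

theory Defs
  imports "HOL-Probability.Probability"
begin

definition observed_count :: "nat \<Rightarrow> (nat \<Rightarrow> 'a \<Rightarrow> nat) \<Rightarrow> nat \<Rightarrow> 'a \<Rightarrow> nat" where
  "observed_count n X j \<omega> = card {i \<in> {1..n}. X i \<omega> = j}"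

(* A zero count contributes 0, as the conventions U_j^(lam+1) / (n p_j)^lam = 0 and
   0 log 0 = 0 require, because of the leading factor u j; this also holds for lam < 0,
   where 0 powr lam = 0 in HOL. Only lam > -1 is meaningful. *)
definition power_divergence ::
    "real \<Rightarrow> nat \<Rightarrow> nat \<Rightarrow> (nat \<Rightarrow> real) \<Rightarrow> (nat \<Rightarrow> nat) \<Rightarrow> real" where
  "power_divergence lam n r p u =
    (if lam = 0
     then 2 * (\<Sum>j=1..r. real (u j) * ln (real (u j) / (real n * p j)))
     else 2 / (lam * (lam + 1)) *
       (\<Sum>j=1..r. real (u j) * ((real (u j) / (real n * p j)) powr lam - 1)))"

definition chi_square_density :: "nat \<Rightarrow> real \<Rightarrow> real" where
  "chi_square_density k x =
    (if x > 0
     then x powr (real k / 2 - 1) * exp (- x / 2) / (2 powr (real k / 2) * Gamma (real k / 2))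
     else 0)"

end

theory Submission
  imports
    Defs
    "HOL-Real_Asymp.Real_Asymp"
begin

text \<open>Write \<open>m = r - 1\<close>, \<open>\<delta> = 1 / sqrt (n pstar)\<close>, let \<open>T\<close> be Pearson's statistic (\<open>lam = 1\<close>), and let
  \<open>Y\<close> be chi-square with \<open>m\<close> degrees of freedom. The three bounds exceed 1 unless \<open>\<delta> \<le> 1/72\<close>.

  Let \<open>g\<close> solve the Stein equation \<open>x g'(x) + (m - x) g(x) / 2 = h(x) - E h(Y)\<close>. For the count
  vectors \<open>U\<close>, \<open>U'\<close> of \<open>n\<close> and \<open>n - 1\<close> trials, size-biasing \<open>E U\<^sub>j \<phi>(U) = n p\<^sub>j E \<phi>(U' + e\<^sub>j)\<close> gives
  \<open>E T(U) g(T(U)) = E (\<Sum>j. (U'\<^sub>j + 1 - n p\<^sub>j) g(T(U' + e\<^sub>j)))\<close>, and a Taylor expansion around \<open>T(U')\<close>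
  reproduces the Stein operator up to an error of order \<open>\<delta>\<close>, provided \<open>g\<close>, \<open>m g'\<close> and \<open>m g''\<close>
  are bounded. That they are follows from the bounds of \<open>\<bar>(m - x) g(x)\<bar>\<close> and \<open>\<bar>x g'(x)\<bar>\<close> by
  \<open>2 sup \<bar>h - E h(Y)\<bar>\<close>, because \<open>g'\<close> solves the Stein equation with \<open>m + 2\<close> in place of \<open>m\<close> and
  right-hand side \<open>h' + g / 2\<close>, and \<open>(m + 2) g' = (m + 2 - x) g' + x g'\<close>.

  The statistic with parameter \<open>lam\<close> differs from \<open>T\<close> by at most a third-order remainder in each
  cell, which costs \<open>r \<delta> sup \<bar>h'\<bar>\<close> up to a constant. Finally \<open>h\<close> is taken to be a smoothed
  indicator of a half-line; the smoothing width \<open>\<epsilon>\<close> balances \<open>\<delta> / \<epsilon>\<^sup>2\<close> against the chi-square mass of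
  an interval of length \<open>\<epsilon>\<close>.\<close>

section \<open>The Stein equation of the chi-square distribution\<close>

text \<open>The last summand of each bound multiplies out to \<open>72 \<delta>\<close>; hence the
  threshold \<open>1/72\<close>. In the remaining range, powers of \<delta> beyond the first are
  absorbed into rounded constants.

  The exponents come from the final balance. An interval of length \<epsilon> has chi-square mass of
  order \<open>sqrt \<epsilon>\<close> for \<open>m = 1\<close>, where the density is unbounded at
  0, of order \<epsilon> for \<open>m = 2\<close>, and of order
  \<open>\<epsilon> / sqrt (m - 2)\<close> for larger \<open>m\<close>. Equating this with
  \<open>\<delta> / \<epsilon>^2\<close> gives \<epsilon> of order
  \<open>\<delta> powr (2/5)\<close>, \<open>\<delta> powr (1/3)\<close> and
  \<open>(r - 3) powr (1/6) * \<delta> powr (1/3)\<close>.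

  Two obstacles shape the proof. Size-biasing leaves one error term per cell, so the derivatives of
  \<open>g\<close> must decay like \<open>1 / m\<close> to keep the sum over \<open>r\<close> cells
  bounded. And the third derivative of a cell's contribution is unbounded near count 0 for
  \<open>lam < 2\<close>, while for large \<open>lam\<close> it outgrows every fixed moment; the
  first is met by comparison with the value at 0, the second by an exponential moment, whose
  parameter the condition on \<open>lam - 2\<close> keeps in range.\<close>

definition stein_weight :: "real \<Rightarrow> real \<Rightarrow> real" where
  "stein_weight a x = x powr a * exp (- x / 2)"

lemma stein_weight_pos: "x > 0 \<Longrightarrow> stein_weight a x > 0"
  by (simp add: stein_weight_def)

lemma stein_weight_add_one: "x > 0 \<Longrightarrow> stein_weight (a + 1) x = x * stein_weight a x"
  by (simp add: stein_weight_def powr_add)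

text \<open>This makes \<open>w = stein_weight a\<close> an integrating factor:
  \<open>(w y)' = w / x * (x y' + (a - x / 2) y)\<close>. For \<open>a = m / 2\<close> the function
  \<open>w / x\<close> is, up to a constant factor, the chi-square density with \<open>m\<close>
  degrees of freedom.\<close>

lemma has_real_derivative_stein_weight:
  assumes "x > 0"
  shows "(stein_weight a has_real_derivative stein_weight a x / x * (a - x / 2)) (at x)"
proof -
  have "((\<lambda>x. x powr a * exp (- x / 2)) has_real_derivative
          x powr a * exp (- x / 2) / x * (a - x / 2)) (at x)"
    using assms by (auto intro!: derivative_eq_intros simp: powr_diff field_simps)
  then show ?thesis
    by (simp add: stein_weight_def[abs_def])
qed

lemma stein_weight_tendsto_0: "a > 0 \<Longrightarrow> (stein_weight a \<longlongrightarrow> 0) (at_right 0)"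
  unfolding stein_weight_def[abs_def] by real_asymp

lemma stein_weight_tendsto_at_top: "a > 0 \<Longrightarrow> (stein_weight a \<longlongrightarrow> 0) at_top"
  unfolding stein_weight_def[abs_def] by real_asymp

text \<open>On either side of the mode \<open>2 a\<close> of the weight \<open>w\<close>, both functions \<open>w (K / c \<plusminus> y)\<close> with
  \<open>c = \<bar>a - x / 2\<bar>\<close> are monotone between \<open>x\<close> and the end of the half-line, where they vanish;
  hence they are nonnegative at \<open>x\<close>.\<close>

lemma stein_solution_bound:
  fixes y y' H :: "real \<Rightarrow> real" and a K :: real
  assumes deriv: "\<And>x. x > 0 \<Longrightarrow> (y has_real_derivative y' x) (at x)"
    and eq: "\<And>x. x > 0 \<Longrightarrow> x * y' x + (a - x / 2) * y x = H x"
    and H: "\<And>x. x > 0 \<Longrightarrow> \<bar>H x\<bar> \<le> K"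
    and lim0: "((\<lambda>x. stein_weight a x * y x) \<longlongrightarrow> 0) (at_right 0)"
    and limtop: "((\<lambda>x. stein_weight a x * y x) \<longlongrightarrow> 0) at_top"
    and a: "a > 0" and x: "x > 0"
  shows "\<bar>(a - x / 2) * y x\<bar> \<le> K" "\<bar>x * y' x\<bar> \<le> 2 * K"
proof -
  have K: "K \<ge> 0" using H[OF x] by linarith
  define f where "f s c t = stein_weight a t * (K / c - s * y t)" for s c t
  have df: "(f s c has_real_derivative stein_weight a t / t * (K / c * (a - t / 2) - s * H t)) (at t)"
    if "t > 0" for s c t
  proof -
    have "((\<lambda>t. stein_weight a t * (K / c - s * y t)) has_real_derivative
            stein_weight a t / t * (a - t / 2) * (K / c - s * y t) + stein_weight a t * (- s * y' t)) (at t)"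
      using that by (auto intro!: derivative_eq_intros has_real_derivative_stein_weight deriv)
    moreover have "stein_weight a t / t * (a - t / 2) * (k - s * y t) + stein_weight a t * (- s * y' t)
        = stein_weight a t / t * (k * (a - t / 2) - s * (t * y' t + (a - t / 2) * y t))" for k
      using that by (simp add: field_simps)
    ultimately show ?thesis
      unfolding f_def[abs_def] eq[OF that] by simp
  qed
  have f0: "(f s c \<longlongrightarrow> 0) (at_right 0)" for s c
  proof -
    have "((\<lambda>t. K / c * stein_weight a t - s * (stein_weight a t * y t)) \<longlongrightarrow> K / c * 0 - s * 0) (at_right 0)"
      by (intro tendsto_intros stein_weight_tendsto_0 lim0 a)
    then show ?thesis by (simp add: f_def[abs_def] algebra_simps)
  qed
  have ftop: "(f s c \<longlongrightarrow> 0) at_top" for s c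
  proof -
    have "((\<lambda>t. K / c * stein_weight a t - s * (stein_weight a t * y t)) \<longlongrightarrow> K / c * 0 - s * 0) at_top"
      by (intro tendsto_intros stein_weight_tendsto_at_top limtop a)
    then show ?thesis by (simp add: f_def[abs_def] algebra_simps)
  qed
  \<comment> \<open>The sign \<open>s\<close> covers the upper and the lower bound of
    \<open>y x\<close> at once. The constant \<open>c\<close> is frozen at the point
    \<open>x\<close>, so that \<open>f s c\<close> is a function of the running variable
    only.\<close>
  have main: "\<exists>c. c = \<bar>a - x / 2\<bar> \<and> c > 0 \<and> f s c x \<ge> 0" if s: "\<bar>s\<bar> = 1" and ne: "a \<noteq> x / 2" for s
  proof -
    have sH: "\<bar>s * H t\<bar> \<le> K" if "t > 0" for t
      using H[OF that] s by (simp add: abs_mult)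
    consider (lt) "x / 2 < a" | (gt) "a < x / 2" using ne by linarith
    then show ?thesis
    proof cases
      case lt
      define c where "c = a - x / 2"
      have c: "c > 0" using lt by (simp add: c_def)
      have mono: "f s c t \<le> f s c x" if t: "0 < t" "t < x" for t
      proof (rule DERIV_nonneg_imp_nondecreasing[where f = "f s c" and a = t and b = x])
        fix u assume u: "t \<le> u" "u \<le> x"
        then have u0: "u > 0" using t by simp
        \<comment> \<open>Going from \<open>x\<close> away from the mode only increases
          \<open>\<bar>a - u / 2\<bar>\<close> beyond \<open>c\<close>, so this term dominates
          \<open>\<bar>H u\<bar>\<close> and decides the sign of the derivative.\<close>
        have "K / c * (a - u / 2) \<ge> K / c * c"
          using K c u by (intro mult_left_mono) (auto simp: c_def)
        then have "K / c * (a - u / 2) - s * H u \<ge> 0"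
          using sH[OF u0] c by simp
        then have "0 \<le> stein_weight a u / u * (K / c * (a - u / 2) - s * H u)"
          using stein_weight_pos[OF u0, of a] u0 by simp
        then show "\<exists>d. (f s c has_real_derivative d) (at u) \<and> 0 \<le> d"
          using df[OF u0] by blast
      qed (use t in simp)
      have "0 \<le> f s c x"
      proof (rule tendsto_upperbound[OF f0])
        show "\<forall>\<^sub>F t in at_right 0. f s c t \<le> f s c x"
          using eventually_at_right_less eventually_at_right_real[OF x]
          by eventually_elim (auto intro: mono)
      qed simp
      then show ?thesis using c by (auto simp: c_def)
    next
      case gt
      define c where "c = x / 2 - a"
      have c: "c > 0" using gt by (simp add: c_def)
      have mono: "f s c t \<le> f s c x" if t: "x < t" for t
      proof (rule DERIV_nonpos_imp_nonincreasing[where f = "f s c" and a = x and b = t])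
        fix u assume u: "x \<le> u" "u \<le> t"
        then have u0: "u > 0" using x by simp
        have "K / c * (u / 2 - a) \<ge> K / c * c"
          using K c u by (intro mult_left_mono) (auto simp: c_def)
        then have "K / c * (a - u / 2) - s * H u \<le> 0"
          using sH[OF u0] c by (simp add: algebra_simps)
        then have "stein_weight a u / u * (K / c * (a - u / 2) - s * H u) \<le> 0"
          using stein_weight_pos[OF u0, of a] u0 by (intro mult_nonneg_nonpos) simp_all
        then show "\<exists>d. (f s c has_real_derivative d) (at u) \<and> d \<le> 0"
          using df[OF u0] by blast
      qed (use t in simp)
      have "0 \<le> f s c x"
      proof (rule tendsto_upperbound[OF ftop])
        show "\<forall>\<^sub>F t in at_top. f s c t \<le> f s c x"
          using eventually_gt_at_top[of x] by eventually_elim (auto intro: mono)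
      qed simp
      then show ?thesis using c by (auto simp: c_def)
    qed
  qed
  show 1: "\<bar>(a - x / 2) * y x\<bar> \<le> K"
  proof (cases "a = x / 2")
    case False
    define c where "c = \<bar>a - x / 2\<bar>"
    have "c > 0" "f 1 c x \<ge> 0" "f (-1) c x \<ge> 0"
      using main[of 1] main[of "-1"] False by (auto simp: c_def)
    then have "y x \<le> K / c" "- y x \<le> K / c" "c > 0"
      using stein_weight_pos[OF x, of a] by (auto simp: f_def zero_le_mult_iff)
    then have "\<bar>y x\<bar> \<le> K / c" by linarith
    then show ?thesis
      using \<open>c > 0\<close> by (simp only: abs_mult flip: c_def) (simp add: field_simps)
  qed (use K in auto)
  show "\<bar>x * y' x\<bar> \<le> 2 * K"
    using 1 eq[OF x] H[OF x] by linarith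
qed

lemma chi_square_density_eq:
  assumes "x > 0"
  shows "chi_square_density k x = stein_weight (k / 2) x / (x * (2 powr (k / 2) * Gamma (k / 2)))"
  using assms by (simp add: chi_square_density_def stein_weight_def powr_diff)

lemma chi_square_density_nonneg: "k \<ge> 1 \<Longrightarrow> chi_square_density k x \<ge> 0"
  by (simp add: chi_square_density_def Gamma_real_pos less_imp_le)

lemma borel_measurable_chi_square_density [measurable]: "chi_square_density k \<in> borel_measurable borel"
  unfolding chi_square_density_def[abs_def] by measurable

text \<open>The integrating factor turns the equation into
  \<open>(w g)' = C (h - c) * density\<close>, so \<open>w g\<close> is \<open>C\<close> times the
  integral \<open>F\<close> of \<open>(h - c) * density\<close> up to \<open>x\<close>.
  \<open>F\<close> vanishes at 0 because the density lives on the positive half-line, and at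
  infinity because \<open>c\<close> is the mean of \<open>h\<close>. These are the two boundary
  conditions that \<open>stein_solution_bound\<close> asks for.\<close>

lemma stein_solution_exists:
  fixes h :: "real \<Rightarrow> real" and m :: nat and B :: real
  assumes m: "m \<ge> 1"
    and dens: "integrable lborel (chi_square_density m)" "(\<integral>x. chi_square_density m x \<partial>lborel) = 1"
    and h: "continuous_on UNIV h" "\<And>x. \<bar>h x\<bar> \<le> B"
  defines "c \<equiv> (\<integral>x. h x * chi_square_density m x \<partial>lborel)"
  obtains g where
    "\<And>x. x > 0 \<Longrightarrow> (g has_real_derivative (h x - c - (m / 2 - x / 2) * g x) / x) (at x)"
    "((\<lambda>x. stein_weight (m / 2) x * g x) \<longlongrightarrow> 0) (at_right 0)"
    "((\<lambda>x. stein_weight (m / 2) x * g x) \<longlongrightarrow> 0) at_top"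
proof -
  define C where "C = 2 powr (real m / 2) * Gamma (real m / 2)"
  have C: "C > 0" using m by (simp add: C_def Gamma_real_pos)
  define f where "f x = (h x - c) * chi_square_density m x" for x
  define F where "F x = (LINT t:{..x}|lborel. f t)" for x
  have hm [measurable]: "h \<in> borel_measurable borel"
    using h(1) by (rule borel_measurable_continuous_onI)
  have inth: "integrable lborel (\<lambda>x. h x * chi_square_density m x)"
  proof (rule Bochner_Integration.integrable_bound)
    show "integrable lborel (\<lambda>x. B * chi_square_density m x)"
      using dens(1) by simp
    show "AE x in lborel. norm (h x * chi_square_density m x) \<le> norm (B * chi_square_density m x)"
      using h(2) order_trans[OF abs_ge_zero h(2)]
      by (auto simp: abs_mult intro!: mult_right_mono)
  qed simp
  have intf: "integrable lborel f"
    using inth dens(1) by (simp add: f_def[abs_def] left_diff_distrib)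
  have int0: "(\<integral>x. f x \<partial>lborel) = 0"
    using inth dens by (simp add: f_def[abs_def] left_diff_distrib c_def)
  \<comment> \<open>One dominated convergence argument serves both ends: \<open>k\<close> is the
    indicator of the nonpositive half-line for the limit at 0, and constantly 1 for the limit at
    infinity.\<close>
  have F_lim: "((\<lambda>x. F (X x)) \<longlonglongrightarrow> (\<integral>x. k x * f x \<partial>lborel))"
    if k: "\<And>x. (\<lambda>i. indicator {..X i} x) \<longlonglongrightarrow> k x" for X :: "nat \<Rightarrow> real" and k :: "real \<Rightarrow> real"
    unfolding F_def set_lebesgue_integral_def real_scaleR_def
  proof (rule integral_dominated_convergence)
    have [measurable]: "f \<in> borel_measurable borel" using intf by simp
    have "k \<in> borel_measurable borel"
      by (rule borel_measurable_LIMSEQ_real[OF k]) simp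
    then show "(\<lambda>x. k x * f x) \<in> borel_measurable lborel" by simp
    show "integrable lborel (\<lambda>x. norm (f x))" using intf by simp
    show "AE x in lborel. (\<lambda>i. indicator {..X i} x * f x) \<longlonglongrightarrow> k x * f x"
      by (intro AE_I2 tendsto_mult k tendsto_const)
    show "AE x in lborel. norm (indicator {..X i} x * f x) \<le> norm (f x)" for i
      by (auto simp: indicator_def)
    show "(\<lambda>x. indicator {..X i} x * f x) \<in> borel_measurable lborel" for i by simp
  qed
  have F0: "(F \<longlongrightarrow> 0) (at_right 0)"
  proof (rule tendsto_at_right_sequentially[where b = 1])
    fix S :: "nat \<Rightarrow> real"
    assume S: "\<And>n. 0 < S n" "S \<longlonglongrightarrow> 0"
    have lim: "(\<lambda>i. indicator {..S i} x :: real) \<longlonglongrightarrow> indicator {..0} x" for x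
    proof (cases "x \<le> 0")
      case True
      then have "indicator {..S i} x = (1::real)" for i using S(1)[of i] by simp
      then show ?thesis using True by simp
    next
      case False
      then have "eventually (\<lambda>i. S i < x) sequentially" using S(2) by (intro order_tendstoD) auto
      then have "eventually (\<lambda>i. indicator {..S i} x = (0::real)) sequentially"
        by eventually_elim simp
      then show ?thesis using False by (simp add: tendsto_eventually)
    qed
    have "indicator {..0} x * f x = 0" for x
      by (auto simp: f_def chi_square_density_def indicator_def)
    then have "(\<integral>x. indicator {..0} x * f x \<partial>lborel) = 0" by (simp only:) simp
    then show "(\<lambda>n. F (S n)) \<longlonglongrightarrow> 0" using F_lim[OF lim] by simp
  qed simp
  have Ftop: "(F \<longlongrightarrow> 0) at_top"
  proof (rule tendsto_at_topI_sequentially)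
    fix S :: "nat \<Rightarrow> real"
    assume S: "filterlim S at_top sequentially"
    have lim: "(\<lambda>i. indicator {..S i} x :: real) \<longlonglongrightarrow> 1" for x
    proof -
      have "eventually (\<lambda>i. x \<le> S i) sequentially"
        using S by (simp add: filterlim_at_top)
      then have "eventually (\<lambda>i. indicator {..S i} x = (1::real)) sequentially"
        by eventually_elim simp
      then show ?thesis by (simp add: tendsto_eventually)
    qed
    show "(\<lambda>n. F (S n)) \<longlonglongrightarrow> 0" using F_lim[OF lim] int0 by simp
  qed
  have contf: "continuous_on {a..b} f" if "a > 0" for a b
  proof -
    have "continuous_on {a..b} (\<lambda>x. (h x - c) * (x powr (m / 2 - 1) * exp (- x / 2) / C))"
      using that C by (intro continuous_intros continuous_on_subset[OF h(1)]) auto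
    also have "?this \<longleftrightarrow> ?thesis"
      using that by (intro continuous_on_cong) (auto simp: f_def chi_square_density_def C_def)
    finally show ?thesis .
  qed
  have dF: "(F has_real_derivative f x) (at x)" if x: "x > 0" for x
  proof -
    \<comment> \<open>Near 0 the density may be singular, so the integral is split at
      \<open>x / 2\<close>; to the right of it the integrand is continuous and the fundamental
      theorem applies.\<close>
    have F_eq: "F u = F (x/2) + integral {x/2..u} f" if "x / 2 < u" for u
    proof -
      have "set_integrable lborel A f" if "A \<in> sets lborel" for A
        using intf that by (auto simp: set_integrable_def intro!: integrable_real_mult_indicator simp: mult.commute[of "indicator _ _"])
      note int = this
      have "F u = F (x/2) + (LINT t:{x/2<..u}|lborel. f t)"
        unfolding F_def
        by (subst set_integral_Un[symmetric]) (use that int in \<open>auto intro!: arg_cong2[where f="\<lambda>A. set_lebesgue_integral lborel A"]\<close>)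
      also have "(LINT t:{x/2<..u}|lborel. f t) = (LINT t:{x/2..u}|lborel. f t)"
        unfolding set_lebesgue_integral_def
        by (intro integral_cong_AE) (use intf AE_lborel_singleton[of "x/2"] in \<open>auto elim!: eventually_mono simp: indicator_def\<close>)
      also have "\<dots> = integral {x/2..u} f"
        by (intro set_borel_integral_eq_integral int) simp
      finally show ?thesis .
    qed
    have "((\<lambda>u. integral {x/2..u} f) has_real_derivative f x) (at x within {x/2..x+1})"
      using x by (intro integral_has_real_derivative contf) auto
    then have "((\<lambda>u. F (x/2) + integral {x/2..u} f) has_real_derivative f x) (at x)"
      using x by (auto simp: at_within_Icc_at intro!: derivative_eq_intros)
    then show ?thesis
      by (rule has_field_derivative_transform_within_open[where S = "{x/2<..}"]) (use x F_eq in auto)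
  qed
  define g where "g x = C * F x / stein_weight (m / 2) x" for x
  have wg: "stein_weight (m / 2) x * g x = C * F x" if "x > 0" for x
    using stein_weight_pos[OF that, of "m/2"] by (simp add: g_def)
  show thesis
  proof
    show "(g has_real_derivative (h x - c - (m / 2 - x / 2) * g x) / x) (at x)" if x: "x > 0" for x
    proof -
      note w = stein_weight_pos[OF x, of "m/2"]
      have "f x = (h x - c) * stein_weight (m / 2) x / (x * C)"
        using x by (simp add: f_def chi_square_density_eq C_def)
      then have hc_eq: "h x - c = f x * (x * C) / stein_weight (m / 2) x"
        using x w C by simp
      have "(h x - c - (m / 2 - x / 2) * g x) / x =
          (C * f x * stein_weight (m / 2) x - C * F x * (stein_weight (m / 2) x / x * (m / 2 - x / 2)))
            / (stein_weight (m / 2) x * stein_weight (m / 2) x)"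
        unfolding g_def hc_eq using x w C by (simp add: field_simps)
      then show ?thesis
        unfolding g_def[abs_def] using w x
        by (auto intro!: derivative_eq_intros dF has_real_derivative_stein_weight)
    qed
    have "((\<lambda>x. C * F x) \<longlongrightarrow> 0) (at_right 0)" "((\<lambda>x. C * F x) \<longlongrightarrow> 0) at_top"
      using tendsto_mult[OF tendsto_const F0, of C] tendsto_mult[OF tendsto_const Ftop, of C] by simp_all
    moreover have "eventually (\<lambda>x. C * F x = stein_weight (m / 2) x * g x) (at_right 0)"
      using eventually_at_right_less[of "0::real"] by eventually_elim (simp add: wg)
    moreover have "eventually (\<lambda>x. C * F x = stein_weight (m / 2) x * g x) at_top"
      using eventually_gt_at_top[of "0::real"] by eventually_elim (simp add: wg)
    ultimately show "((\<lambda>x. stein_weight (m / 2) x * g x) \<longlongrightarrow> 0) (at_right 0)"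
      "((\<lambda>x. stein_weight (m / 2) x * g x) \<longlongrightarrow> 0) at_top"
      by (blast intro: Lim_transform_eventually)+
  qed
qed

text \<open>Three rounds of \<open>stein_solution_bound\<close>, with \<open>a\<close>,
  \<open>a + 1\<close>, \<open>a + 2\<close> and right-hand sides bounded by \<open>1\<close>,
  \<open>D1 + 4\<close> and \<open>D2 + (10 + 2 * D1) / 3\<close>. Twice the first conclusion of a
  round plus the second conclusion of the round before gives \<open>2 * (D1 + 4) + 2\<close> for
  \<open>g'\<close>, and for \<open>g''\<close> a sum rounded up to
  \<open>15 + 4 * D1 + 2 * D2\<close>. The factors \<open>m + 2\<close> and \<open>m + 4\<close>
  later offset a sum over \<open>r = m + 1\<close> cells.\<close>

lemma stein_factor_bounds:
  fixes h h' h'' :: "real \<Rightarrow> real" and m :: nat and D1 D2 :: real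
  assumes m: "m \<ge> 1"
    and dens: "integrable lborel (chi_square_density m)" "(\<integral>x. chi_square_density m x \<partial>lborel) = 1"
    and h01: "\<And>x. 0 \<le> h x \<and> h x \<le> 1"
    and h': "\<And>x. (h has_real_derivative h' x) (at x)" "\<And>x. \<bar>h' x\<bar> \<le> D1"
    and h'': "\<And>x. (h' has_real_derivative h'' x) (at x)" "\<And>x. \<bar>h'' x\<bar> \<le> D2"
  defines "c \<equiv> (\<integral>x. h x * chi_square_density m x \<partial>lborel)"
  obtains g g' g'' where
    "\<And>x. x > 0 \<Longrightarrow> (g has_real_derivative g' x) (at x)"
    "\<And>x. x > 0 \<Longrightarrow> (g' has_real_derivative g'' x) (at x)"
    "\<And>x. x > 0 \<Longrightarrow> x * g' x + (m / 2 - x / 2) * g x = h x - c"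
    "\<And>x. x > 0 \<Longrightarrow> \<bar>g x\<bar> \<le> 8"
    "\<And>x. x > 0 \<Longrightarrow> \<bar>x * g' x\<bar> \<le> 2"
    "\<And>x. x > 0 \<Longrightarrow> (real m + 2) * \<bar>g' x\<bar> \<le> 10 + 2 * D1"
    "\<And>x. x > 0 \<Longrightarrow> (real m + 4) * \<bar>g'' x\<bar> \<le> 15 + 4 * D1 + 2 * D2"
proof -
  have conth: "continuous_on UNIV h"
    using h'(1) by (meson DERIV_continuous continuous_at_imp_continuous_on)
  obtain g where g: "\<And>x. x > 0 \<Longrightarrow> (g has_real_derivative (h x - c - (m / 2 - x / 2) * g x) / x) (at x)"
    and lim: "((\<lambda>x. stein_weight (m / 2) x * g x) \<longlongrightarrow> 0) (at_right 0)"
      "((\<lambda>x. stein_weight (m / 2) x * g x) \<longlongrightarrow> 0) at_top"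
    using stein_solution_exists[OF m dens conth, of 1] h01 unfolding c_def
    by (smt (verit, best))
  have hm [measurable]: "h \<in> borel_measurable borel"
    using conth by (rule borel_measurable_continuous_onI)
  have c01: "0 \<le> c" "c \<le> 1"
  proof -
    show "0 \<le> c"
      unfolding c_def using h01 chi_square_density_nonneg[OF m] by (intro integral_nonneg_AE) auto
    have "c \<le> (\<integral>x. chi_square_density m x \<partial>lborel)"
      unfolding c_def
    proof (rule integral_mono)
      show "integrable lborel (\<lambda>x. h x * chi_square_density m x)"
        by (rule Bochner_Integration.integrable_bound[OF dens(1)])
          (use h01 chi_square_density_nonneg[OF m] in \<open>auto simp: abs_mult intro!: mult_left_le_one_le\<close>)
      show "h x * chi_square_density m x \<le> chi_square_density m x" for x
        using h01[of x] chi_square_density_nonneg[OF m, of x] by (intro mult_left_le_one_le) auto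
    qed (use dens in simp)
    then show "c \<le> 1" using dens by simp
  qed
  have hc: "\<bar>h x - c\<bar> \<le> 1" for x using h01[of x] c01 by linarith
  define a where "a = real m / 2"
  have a: "a \<ge> 1 / 2" using m by (simp add: a_def)
  define g' where "g' x = (h x - c - (a - x / 2) * g x) / x" for x
  have dg: "(g has_real_derivative g' x) (at x)" if "x > 0" for x
    using g[OF that] by (simp add: g'_def a_def)
  have eq: "x * g' x + (a - x / 2) * g x = h x - c" if "x > 0" for x
    using that by (simp add: g'_def)
  note b0 = stein_solution_bound[OF dg eq hc lim[folded a_def]]
  have b0: "\<bar>(a - x / 2) * g x\<bar> \<le> 1" "\<bar>x * g' x\<bar> \<le> 2" if "x > 0" for x
    using b0[of x] a that by auto
  have gbound: "\<bar>g x\<bar> \<le> 8" if x: "x > 0" for x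
  proof -
    have far: "\<bar>g y\<bar> \<le> 4" if "\<bar>a - y / 2\<bar> \<ge> 1/4" "y > 0" for y
    proof -
      have "1/4 * \<bar>g y\<bar> \<le> \<bar>a - y / 2\<bar> * \<bar>g y\<bar>"
        using that by (intro mult_right_mono) auto
      then show ?thesis using b0(1)[OF that(2)] by (simp add: abs_mult)
    qed
    show ?thesis
    proof (cases "\<bar>a - x / 2\<bar> \<ge> 1/4")
      case False
      \<comment> \<open>Near the mode \<open>2 a\<close> the bound on
        \<open>(a - x / 2) * g x\<close> says nothing about \<open>g x\<close>. The point
        \<open>y\<close> is the nearest one to the right with
        \<open>\<bar>a - y / 2\<bar> = 1/4\<close>; it is within distance 1, and since
        \<open>a \<ge> 1/2\<close> the segment stays above \<open>1/2\<close>, where the bound on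
        \<open>x * g' x\<close> yields \<open>\<bar>g'\<bar> \<le> 4\<close>.\<close>
      define y where "y = 2 * a + 1/2"
      have xy: "x < y" "y - x \<le> 1" "x \<ge> 1/2" using False a by (auto simp: y_def abs_if split: if_splits)
      obtain z where z: "x < z" "z < y" "g y - g x = (y - x) * g' z"
        using MVT2[of x y g g'] xy dg by (metis less_le_trans x)
      have "\<bar>g' z\<bar> \<le> 4"
      proof -
        have "1/2 * \<bar>g' z\<bar> \<le> \<bar>z\<bar> * \<bar>g' z\<bar>" using z xy by (intro mult_right_mono) auto
        then show ?thesis using b0(2)[of z] z x by (simp add: abs_mult)
      qed
      moreover have "\<bar>(y - x) * g' z\<bar> \<le> 1 * \<bar>g' z\<bar>"
        using xy by (subst abs_mult, intro mult_right_mono) auto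
      moreover have "\<bar>g y\<bar> \<le> 4" using far[of y] a by (simp add: y_def add_divide_distrib)
      ultimately show ?thesis using z(3) by linarith
    qed (use far[of x] x in linarith)
  qed
  define g'' where "g'' x = (h' x + g x / 2 - (a + 1 - x / 2) * g' x) / x" for x
  have dg': "(g' has_real_derivative g'' x) (at x)" if x: "x > 0" for x
  proof -
    have "((\<lambda>x. (h x - c - (a - x / 2) * g x) / x) has_real_derivative
        ((h' x - ((- 1 / 2) * g x + g' x * (a - x / 2))) * x - (h x - c - (a - x / 2) * g x) * 1) / (x * x)) (at x)"
      using x by (auto intro!: derivative_eq_intros h' dg)
    also have "((h' x - ((- 1 / 2) * g x + g' x * (a - x / 2))) * x - (h x - c - (a - x / 2) * g x) * 1) / (x * x) = g'' x"
      unfolding eq[OF x, symmetric] using x by (simp add: g''_def field_simps)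
    finally show ?thesis unfolding g'_def[abs_def] .
  qed
  have eq': "x * g'' x + (a + 1 - x / 2) * g' x = h' x + g x / 2" if "x > 0" for x
    using that by (simp add: g''_def)
  have hc': "\<bar>h' x + g x / 2\<bar> \<le> D1 + 4" if "x > 0" for x
    using h'(2)[of x] gbound[OF that] by linarith
  \<comment> \<open>Each round supplies the boundary conditions of the next: the weight with
    exponent \<open>b + 1\<close> times \<open>u\<close> equals the bounded \<open>x * u x\<close>
    times the weight with exponent \<open>b\<close>, which vanishes at both ends.\<close>
  have bdd: "((\<lambda>x. stein_weight (b + 1) x * u x) \<longlongrightarrow> 0) (at_right 0)"
      "((\<lambda>x. stein_weight (b + 1) x * u x) \<longlongrightarrow> 0) at_top"
    if b: "b > 0" and u: "\<And>x. x > 0 \<Longrightarrow> \<bar>x * u x\<bar> \<le> B" for b B :: real and u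
  proof -
    have le: "norm (stein_weight (b + 1) x * u x) \<le> B * stein_weight b x" if "x > 0" for x
    proof -
      have "norm (stein_weight (b + 1) x * u x) = \<bar>x * u x\<bar> * stein_weight b x"
        using stein_weight_pos[OF that, of b] that by (simp add: stein_weight_add_one abs_mult)
      then show ?thesis
        using u[OF that] stein_weight_pos[OF that, of b] by (simp add: mult_right_mono)
    qed
    have lim: "((\<lambda>x. B * stein_weight b x) \<longlongrightarrow> 0) (at_right 0)" "((\<lambda>x. B * stein_weight b x) \<longlongrightarrow> 0) at_top"
      using tendsto_mult[OF tendsto_const stein_weight_tendsto_0[OF b], of B]
        tendsto_mult[OF tendsto_const stein_weight_tendsto_at_top[OF b], of B] by simp_all
    show "((\<lambda>x. stein_weight (b + 1) x * u x) \<longlongrightarrow> 0) (at_right 0)"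
      by (rule Lim_null_comparison[OF eventually_mono[OF eventually_at_right_less le] lim(1)])
    show "((\<lambda>x. stein_weight (b + 1) x * u x) \<longlongrightarrow> 0) at_top"
      by (rule Lim_null_comparison[OF eventually_mono[OF eventually_gt_at_top le] lim(2)])
  qed
  have a0: "a > 0" "a + 1 > 0" "a + 1 + 1 > 0" using a by auto
  have b1: "\<bar>(a + 1 - x / 2) * g' x\<bar> \<le> D1 + 4" "\<bar>x * g'' x\<bar> \<le> 2 * (D1 + 4)" if "x > 0" for x
    using stein_solution_bound[OF dg' eq' hc' bdd(1)[OF a0(1) b0(2)] bdd(2)[OF a0(1) b0(2)] a0(2) that] by auto
  have b1': "(real m + 2) * \<bar>g' x\<bar> \<le> 10 + 2 * D1" if x: "x > 0" for x
  proof -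
    have "2 * ((a + 1 - x / 2) * g' x) + x * g' x = (real m + 2) * g' x"
      by (simp add: a_def algebra_simps)
    then have "(real m + 2) * \<bar>g' x\<bar> = \<bar>2 * ((a + 1 - x / 2) * g' x) + x * g' x\<bar>"
      by (simp add: abs_mult)
    then show ?thesis using b1(1)[OF x] b0(2)[OF x] by linarith
  qed
  define g3 where "g3 x = (h'' x + g' x - (a + 1 + 1 - x / 2) * g'' x) / x" for x
  have dg'': "(g'' has_real_derivative g3 x) (at x)" if x: "x > 0" for x
  proof -
    have "((\<lambda>x. (h' x + g x / 2 - (a + 1 - x / 2) * g' x) / x) has_real_derivative
        ((h'' x + g' x / 2 - ((- 1 / 2) * g' x + g'' x * (a + 1 - x / 2))) * x - (h' x + g x / 2 - (a + 1 - x / 2) * g' x) * 1) / (x * x)) (at x)"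
      using x by (auto intro!: derivative_eq_intros h'' dg dg')
    also have "((h'' x + g' x / 2 - ((- 1 / 2) * g' x + g'' x * (a + 1 - x / 2))) * x - (h' x + g x / 2 - (a + 1 - x / 2) * g' x) * 1) / (x * x) = g3 x"
      unfolding eq'[OF x, symmetric] using x by (simp add: g3_def field_simps)
    finally show ?thesis unfolding g''_def[abs_def] .
  qed
  \<comment> \<open>One half of \<open>g'\<close> on the right is the derivative of
    \<open>g / 2\<close>, the other half comes from differentiating \<open>- x / 2\<close>.\<close>
  have eq'': "x * g3 x + (a + 1 + 1 - x / 2) * g'' x = h'' x + g' x" if "x > 0" for x
    using that by (simp add: g3_def)
  have g'b: "\<bar>g' x\<bar> \<le> (10 + 2 * D1) / 3" if "x > 0" for x
  proof -
    have "3 * \<bar>g' x\<bar> \<le> (real m + 2) * \<bar>g' x\<bar>" using m by (intro mult_right_mono) auto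
    then show ?thesis using b1'[OF that] by simp
  qed
  have hc'': "\<bar>h'' x + g' x\<bar> \<le> D2 + (10 + 2 * D1) / 3" if "x > 0" for x
    using h''(2)[of x] g'b[OF that] by linarith
  have D1: "D1 \<ge> 0" using h'(2)[of 0] by linarith
  have b2': "(real m + 4) * \<bar>g'' x\<bar> \<le> 15 + 4 * D1 + 2 * D2" if x: "x > 0" for x
  proof -
    have 1: "\<bar>(a + 1 + 1 - x / 2) * g'' x\<bar> \<le> D2 + (10 + 2 * D1) / 3"
      using stein_solution_bound[OF dg'' eq'' hc'' bdd(1)[OF a0(2) b1(2)] bdd(2)[OF a0(2) b1(2)] a0(3) x] by auto
    have "(real m + 4) * g'' x = 2 * ((a + 1 + 1 - x / 2) * g'' x) + x * g'' x"
      by (simp add: a_def algebra_simps)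
    then have eq4: "(real m + 4) * \<bar>g'' x\<bar> = \<bar>2 * ((a + 1 + 1 - x / 2) * g'' x) + x * g'' x\<bar>"
      by (metis abs_mult abs_of_nonneg add_nonneg_nonneg of_nat_0_le_iff zero_le_numeral)
    have "\<bar>2 * A + B\<bar> \<le> 2 * E + F" if "\<bar>A\<bar> \<le> E" "\<bar>B\<bar> \<le> F" for A B E F :: real
      using that by linarith
    from this[OF 1 b1(2)[OF x]] show ?thesis
      unfolding eq4 add_divide_distrib using D1 by simp
  qed
  show thesis
    using that[OF dg dg' eq[unfolded a_def] gbound b0(2) b1' b2'] by simp
qed

section \<open>Expectations of functions of the multinomial counts\<close>

definition inc :: "nat \<Rightarrow> (nat \<Rightarrow> nat) \<Rightarrow> nat \<Rightarrow> nat" where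
  "inc j u = u(j := Suc (u j))"

lemma inc_apply: "inc j u i = u i + (if i = j then 1 else 0)"
  by (simp add: inc_def)

lemma inc_commute: "inc i (inc j u) = inc j (inc i u)"
  by (auto simp: fun_eq_iff inc_apply)

lemma Taylor_2_bound:
  fixes f f' f'' :: "real \<Rightarrow> real"
  assumes f: "\<And>x. x > 0 \<Longrightarrow> (f has_real_derivative f' x) (at x)"
    and f': "\<And>x. x > 0 \<Longrightarrow> (f' has_real_derivative f'' x) (at x)"
    and B: "\<And>x. x > 0 \<Longrightarrow> \<bar>f'' x\<bar> \<le> B"
    and xy: "x > 0" "y > 0"
  shows "\<bar>f y - f x - (y - x) * f' x\<bar> \<le> B * (y - x)\<^sup>2 / 2"
proof (cases "x = y")
  case False
  define diff where "diff i = (if i = 0 then f else if i = 1 then f' else f'')" for i :: nat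
  have "\<exists>t. (if y < x then y < t \<and> t < x else x < t \<and> t < y) \<and>
    f y = (\<Sum>m<2. diff m x / fact m * (y - x) ^ m) + diff 2 t / fact 2 * (y - x) ^ 2"
  proof (rule Taylor[of 2 diff f "min x y" "max x y"])
    show "\<forall>m t. m < 2 \<and> min x y \<le> t \<and> t \<le> max x y \<longrightarrow> DERIV (diff m) t :> diff (Suc m) t"
      using xy f f' by (auto simp: diff_def less_2_cases_iff)
  qed (use False in \<open>auto simp: diff_def\<close>)
  then obtain t where t': "if y < x then y < t \<and> t < x else x < t \<and> t < y"
    "f y = (\<Sum>m<2. diff m x / fact m * (y - x) ^ m) + diff 2 t / fact 2 * (y - x) ^ 2"
    by blast
  have t: "t > 0" "f y = f x + f' x * (y - x) + f'' t / 2 * (y - x)\<^sup>2"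
    using t' xy by (auto simp: diff_def eval_nat_numeral split: if_splits)
  have "\<bar>f'' t / 2 * (y - x)\<^sup>2\<bar> = \<bar>f'' t\<bar> * ((y - x)\<^sup>2 / 2)" by (simp add: abs_mult)
  also have "\<dots> \<le> B * ((y - x)\<^sup>2 / 2)" using B[OF t(1)] by (intro mult_right_mono) auto
  finally show ?thesis using t(2) by (simp add: algebra_simps)
qed simp

locale cell_probabilities =
  fixes r :: nat and p :: "nat \<Rightarrow> real"
  assumes p_pos: "\<And>j. j \<in> {1..r} \<Longrightarrow> p j > 0"
    and p_sum: "(\<Sum>j=1..r. p j) = 1"
begin

text \<open>The expectation of \<open>\<phi>(U)\<close> for the count vector \<open>U\<close> of \<open>k\<close> trials, computed by conditioning on
  one trial; see \<open>integral_observed_count\<close>.\<close>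

primrec mexp :: "nat \<Rightarrow> ((nat \<Rightarrow> nat) \<Rightarrow> real) \<Rightarrow> real" where
  "mexp 0 \<phi> = \<phi> (\<lambda>_. 0)"
| "mexp (Suc k) \<phi> = (\<Sum>j=1..r. p j * mexp k (\<lambda>u. \<phi> (inc j u)))"

lemmas p_sum' [simp] = p_sum[unfolded One_nat_def]

lemma p_le_1: "j \<in> {1..r} \<Longrightarrow> p j \<le> 1"
  using member_le_sum[of j "{1..r}" p] p_pos p_sum by (auto simp: less_imp_le)

lemma sum_inc: "j \<in> {1..r} \<Longrightarrow> (\<Sum>i=1..r. inc j u i) = Suc (\<Sum>i=1..r. u i)"
  by (simp add: inc_apply sum.distrib)

text \<open>The inequality is required only for vectors of total \<open>k\<close>. This gives later
  comparisons access to \<open>sum_deviation\<close>: deviations from \<open>n p\<close> sum to 0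
  after \<open>n\<close> trials and to -1 after \<open>n - 1\<close>.\<close>

lemma mexp_mono:
  assumes "\<And>u. (\<Sum>j=1..r. u j) = k \<Longrightarrow> \<phi> u \<le> \<psi> u"
  shows "mexp k \<phi> \<le> mexp k \<psi>"
  using assms
proof (induction k arbitrary: \<phi> \<psi>)
  case (Suc k)
  have "\<phi> (inc j u) \<le> \<psi> (inc j u)" if "j \<in> {1..r}" "(\<Sum>i=1..r. u i) = k" for j u
    using Suc.prems[of "inc j u"] that by (simp only: sum_inc)
  then show ?case
    by (simp only: mexp.simps) (intro sum_mono mult_left_mono Suc.IH, simp_all add: p_pos less_imp_le)
qed simp

lemma mexp_cong:
  assumes "\<And>u. (\<Sum>j=1..r. u j) = k \<Longrightarrow> \<phi> u = \<psi> u"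
  shows "mexp k \<phi> = mexp k \<psi>"
  using mexp_mono[of k \<phi> \<psi>] mexp_mono[of k \<psi> \<phi>] assms by (simp add: order_antisym)

lemma mexp_add: "mexp k (\<lambda>u. \<phi> u + \<psi> u) = mexp k \<phi> + mexp k \<psi>"
  by (induction k arbitrary: \<phi> \<psi>) (simp_all add: distrib_left sum.distrib)

lemma mexp_cmult: "mexp k (\<lambda>u. c * \<phi> u) = c * mexp k \<phi>"
  by (induction k arbitrary: \<phi>) (simp_all add: sum_distrib_left mult.left_commute)

lemma mexp_diff: "mexp k (\<lambda>u. \<phi> u - \<psi> u) = mexp k \<phi> - mexp k \<psi>"
  using mexp_add[of k \<phi> "\<lambda>u. -1 * \<psi> u"] by (simp only: mexp_cmult) simp

lemma mexp_const: "mexp k (\<lambda>u. c) = c"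
  by (induction k) (simp_all flip: sum_distrib_right)

lemma mexp_sum: "mexp k (\<lambda>u. \<Sum>i\<in>I. \<phi> i u) = (\<Sum>i\<in>I. mexp k (\<phi> i))"
  by (induction I rule: infinite_finite_induct) (simp_all add: mexp_const mexp_add)

lemma mexp_abs_le: "\<bar>mexp k \<phi>\<bar> \<le> mexp k (\<lambda>u. \<bar>\<phi> u\<bar>)"
  using mexp_mono[of k \<phi> "\<lambda>u. \<bar>\<phi> u\<bar>"] mexp_mono[of k "\<lambda>u. - 1 * \<phi> u" "\<lambda>u. \<bar>\<phi> u\<bar>"]
  by (simp only: mexp_cmult) (auto simp: abs_le_iff)

text \<open>In the step, the count of cell \<open>j\<close> splits into the trials before the last,
  where the induction hypothesis applies after the last result \<open>i\<close> is moved into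
  \<phi>, and the last trial itself, which contributes only when \<open>i = j\<close> and supplies
  one more summand \<open>p j\<close>.\<close>

lemma mexp_size_bias:
  assumes j: "j \<in> {1..r}"
  shows "mexp (Suc k) (\<lambda>u. real (u j) * \<phi> u) = real (Suc k) * p j * mexp k (\<lambda>u. \<phi> (inc j u))"
proof (induction k arbitrary: \<phi>)
  case 0
  have "p i * (real (inc i (\<lambda>_. 0) j) * \<phi> (inc i (\<lambda>_. 0)))
      = (if j = i then p j * \<phi> (inc j (\<lambda>_. 0)) else 0)" for i
    by (simp add: inc_apply)
  then show ?case using j by (simp del: One_nat_def)
next
  case (Suc k)
  have "mexp (Suc (Suc k)) (\<lambda>u. real (u j) * \<phi> u) =
      (\<Sum>i=1..r. p i * mexp (Suc k) (\<lambda>u. real (u j) * \<phi> (inc i u) + (if j = i then 1 else 0) * \<phi> (inc i u)))"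
    by (subst mexp.simps(2), intro sum.cong refl arg_cong2[where f = "(*)"] mexp_cong)
      (simp add: inc_apply distrib_right)
  also have "\<dots> = (\<Sum>i=1..r. p i * (real (Suc k) * p j * mexp k (\<lambda>u. \<phi> (inc i (inc j u))))
      + (if j = i then p j * mexp (Suc k) (\<lambda>u. \<phi> (inc j u)) else 0))"
    by (intro sum.cong refl) (simp only: mexp_add Suc.IH mexp_cmult, simp add: distrib_left)
  also have "\<dots> = real (Suc k) * p j * mexp (Suc k) (\<lambda>u. \<phi> (inc j u)) + p j * mexp (Suc k) (\<lambda>u. \<phi> (inc j u))"
    using j by (simp only: sum.distrib sum.delta[OF finite_atLeastAtMost])
      (simp add: sum_distrib_left inc_commute[of _ j] mult_ac)
  finally show ?case by (simp add: algebra_simps)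
qed

text \<open>A single count is binomial, since all other cells act as failures; this is the recursion
  of its law, from which the moments and the generating function below follow by induction.\<close>

lemma mexp_Suc_marginal:
  assumes j: "j \<in> {1..r}"
  shows "mexp (Suc k) (\<lambda>u. \<psi> (u j)) = mexp k (\<lambda>u. p j * \<psi> (u j + 1) + (1 - p j) * \<psi> (u j))"
proof -
  have "mexp (Suc k) (\<lambda>u. \<psi> (u j)) = (\<Sum>i=1..r. p i * mexp k (\<lambda>u. \<psi> (u j)) +
      (if j = i then p j * (mexp k (\<lambda>u. \<psi> (u j + 1)) - mexp k (\<lambda>u. \<psi> (u j))) else 0))"
    by (auto simp: inc_apply algebra_simps intro!: sum.cong)
  also have "\<dots> = mexp k (\<lambda>u. \<psi> (u j)) + p j * (mexp k (\<lambda>u. \<psi> (u j + 1)) - mexp k (\<lambda>u. \<psi> (u j)))"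
    using j by (simp add: sum.distrib sum.delta flip: sum_distrib_right)
  finally show ?thesis
    by (simp only: mexp_add mexp_cmult) (simp add: algebra_simps)
qed

lemma mexp_central_moments:
  assumes j: "j \<in> {1..r}"
  shows mexp_central_2: "mexp k (\<lambda>u. (real (u j) - k * p j)\<^sup>2) = k * (p j * (1 - p j))"
    and mexp_central_4: "mexp k (\<lambda>u. (real (u j) - k * p j) ^ 4)
      \<le> 3 * (k * (p j * (1 - p j)))\<^sup>2 + k * (p j * (1 - p j))"
proof -
  define s where "s = p j * (1 - p j)"
  have s: "s \<ge> 0" using p_pos[OF j] p_le_1[OF j] by (simp add: s_def)
  have 1: "mexp k (\<lambda>u. real (u j) - k * p j) = 0" for k
  proof (induction k)
    case (Suc k)
    have "mexp (Suc k) (\<lambda>u. real (u j) - Suc k * p j) = mexp k (\<lambda>u. real (u j) - k * p j)"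
      by (subst mexp_Suc_marginal[OF j, of k "\<lambda>x. real x - Suc k * p j"])
        (intro mexp_cong, simp add: algebra_simps)
    then show ?case using Suc by simp
  qed simp
  have 2: "mexp k (\<lambda>u. (real (u j) - k * p j)\<^sup>2) = k * s" for k
  proof (induction k)
    case (Suc k)
    have "mexp (Suc k) (\<lambda>u. (real (u j) - Suc k * p j)\<^sup>2) = mexp k (\<lambda>u. (real (u j) - k * p j)\<^sup>2 + s)"
      by (subst mexp_Suc_marginal[OF j, of k "\<lambda>x. (real x - Suc k * p j)\<^sup>2"])
        (intro mexp_cong, simp add: s_def power2_eq_square algebra_simps)
    then show ?case using Suc by (simp add: mexp_add mexp_const algebra_simps)
  qed simp
  have 4: "mexp k (\<lambda>u. (real (u j) - k * p j) ^ 4) \<le> 3 * (k * s)\<^sup>2 + k * s" for k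
  proof (induction k)
    case (Suc k)
    \<comment> \<open>A centred Bernoulli variable has moments \<open>0\<close>, \<open>s\<close>,
      \<open>s * (1 - 2 * p j)\<close> and \<open>s * (1 - 3 * s)\<close>. The term linear in
      \<open>D\<close> has mean zero.\<close>
    have *: "p j * (D + (1 - p j)) ^ 4 + (1 - p j) * (D - p j) ^ 4
        = D ^ 4 + 6 * s * D\<^sup>2 + 4 * (s * (1 - 2 * p j)) * D + s * (1 - 3 * s)" for D
      unfolding s_def by algebra
    have "mexp (Suc k) (\<lambda>u. (real (u j) - Suc k * p j) ^ 4) = mexp k (\<lambda>u. (real (u j) - k * p j) ^ 4
        + 6 * s * (real (u j) - k * p j)\<^sup>2 + 4 * (s * (1 - 2 * p j)) * (real (u j) - k * p j) + s * (1 - 3 * s))"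
      by (subst mexp_Suc_marginal[OF j, of k "\<lambda>x. (real x - Suc k * p j) ^ 4"])
        (intro mexp_cong, subst *[symmetric], simp add: algebra_simps)
    also have "\<dots> \<le> 3 * (k * s)\<^sup>2 + k * s + 6 * s * (k * s) + s * (1 - 3 * s)"
      using Suc by (simp add: mexp_add mexp_const mexp_cmult 1 2)
    also have "\<dots> \<le> 3 * (Suc k * s)\<^sup>2 + Suc k * s"
      by (simp add: power2_eq_square algebra_simps)
    finally show ?case .
  qed simp
  show "mexp k (\<lambda>u. (real (u j) - k * p j)\<^sup>2) = k * (p j * (1 - p j))"
    using 2 by (simp add: s_def)
  show "mexp k (\<lambda>u. (real (u j) - k * p j) ^ 4) \<le> 3 * (k * (p j * (1 - p j)))\<^sup>2 + k * (p j * (1 - p j))"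
    using 4 by (simp add: s_def)
qed

lemma mexp_exp:
  assumes j: "j \<in> {1..r}"
  shows "mexp k (\<lambda>u. exp (\<theta> * real (u j))) = (1 + p j * (exp \<theta> - 1)) ^ k"
proof (induction k)
  case (Suc k)
  have "mexp (Suc k) (\<lambda>u. exp (\<theta> * real (u j))) = mexp k (\<lambda>u. (1 + p j * (exp \<theta> - 1)) * exp (\<theta> * real (u j)))"
    by (subst mexp_Suc_marginal[OF j, of k "\<lambda>x. exp (\<theta> * real x)"])
      (intro mexp_cong, simp add: exp_add algebra_simps)
  then show ?case using Suc by (simp add: mexp_cmult)
qed simp

text \<open>By \<open>1 + x \<le> exp x\<close>, the binomial moment generating function is at most
  that of the Poisson law with the same mean.\<close>

lemma mexp_exp_centered_le:
  assumes j: "j \<in> {1..r}"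
  shows "mexp k (\<lambda>u. exp (\<theta> * (real (u j) - k * p j))) \<le> exp (k * p j * (exp \<theta> - 1 - \<theta>))"
proof -
  have "mexp k (\<lambda>u. exp (\<theta> * (real (u j) - k * p j)))
      = mexp k (\<lambda>u. exp (- (\<theta> * (k * p j))) * exp (\<theta> * real (u j)))"
    by (simp add: algebra_simps flip: exp_add)
  also have "\<dots> = exp (- (\<theta> * (k * p j))) * (1 + p j * (exp \<theta> - 1)) ^ k"
    by (simp only: mexp_cmult mexp_exp[OF j])
  also have "\<dots> \<le> exp (- (\<theta> * (k * p j))) * exp (p j * (exp \<theta> - 1)) ^ k"
  proof (intro mult_left_mono power_mono)
    show "1 + p j * (exp \<theta> - 1) \<le> exp (p j * (exp \<theta> - 1))" by simp
    have "0 \<le> (1 - p j) + p j * exp \<theta>" using p_pos[OF j] p_le_1[OF j] by simp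
    then show "0 \<le> 1 + p j * (exp \<theta> - 1)" by (simp add: algebra_simps)
  qed simp
  also have "\<dots> = exp (k * p j * (exp \<theta> - 1 - \<theta>))"
    by (simp add: algebra_simps flip: exp_add exp_of_nat_mult)
  finally show ?thesis .
qed

section \<open>Pearson's statistic and its size-biased form\<close>

definition cell_scale :: "nat \<Rightarrow> nat \<Rightarrow> real" where
  "cell_scale n j = 1 / sqrt (n * p j)"

definition std_count :: "nat \<Rightarrow> (nat \<Rightarrow> nat) \<Rightarrow> nat \<Rightarrow> real" where
  "std_count n u j = (real (u j) - n * p j) * cell_scale n j"

definition pearson :: "nat \<Rightarrow> (nat \<Rightarrow> nat) \<Rightarrow> real" where
  "pearson n u = (\<Sum>j=1..r. (std_count n u j)\<^sup>2)"

lemma cell_scale_pos: "n \<ge> 1 \<Longrightarrow> j \<in> {1..r} \<Longrightarrow> cell_scale n j > 0"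
  using p_pos by (simp add: cell_scale_def)

lemma cell_scale_sq: "n \<ge> 1 \<Longrightarrow> j \<in> {1..r} \<Longrightarrow> (cell_scale n j)\<^sup>2 * (n * p j) = 1"
  using p_pos[of j] by (simp add: cell_scale_def power_divide)

lemma std_count_div_scale:
  "n \<ge> 1 \<Longrightarrow> j \<in> {1..r} \<Longrightarrow> std_count n u j / cell_scale n j = real (u j) - n * p j"
  using cell_scale_pos[of n j] by (simp add: std_count_def)

text \<open>One additional observation moves a standardised count by \<open>cell_scale n j\<close>,
  which is therefore the small parameter of the Taylor expansion in cell \<open>j\<close>.\<close>

lemma std_count_inc:
  "std_count n (inc j u) i = std_count n u i + (if i = j then cell_scale n j else 0)"
  by (simp add: std_count_def inc_apply algebra_simps)

lemma pearson_inc: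
  assumes "j \<in> {1..r}"
  shows "pearson n (inc j u) = pearson n u + (2 * cell_scale n j * std_count n u j + (cell_scale n j)\<^sup>2)"
proof -
  have "pearson n (inc j u) = (\<Sum>i=1..r. (std_count n u i)\<^sup>2 +
      (if i = j then 2 * cell_scale n j * std_count n u j + (cell_scale n j)\<^sup>2 else 0))"
    unfolding pearson_def
    by (intro sum.cong refl) (simp add: std_count_inc power2_eq_square algebra_simps)
  then show ?thesis using assms by (simp add: sum.distrib pearson_def)
qed

lemma pearson_nonneg: "pearson n u \<ge> 0"
  unfolding pearson_def by (intro sum_nonneg) simp

lemma pearson_eq_0_imp: "pearson n u = 0 \<Longrightarrow> j \<in> {1..r} \<Longrightarrow> std_count n u j = 0"
  unfolding pearson_def by (subst (asm) sum_nonneg_eq_0_iff) auto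

lemma sum_deviation: "(\<Sum>j=1..r. real (u j) - n * p j) = real (\<Sum>j=1..r. u j) - n"
  using p_sum by (simp add: sum_subtractf flip: sum_distrib_left)

text \<open>As the deviations of \<open>n\<close> trials sum to 0, one factor of each square may be
  replaced by the count itself: \<open>T = (\<Sum>j. U\<^sub>j (U\<^sub>j - n p\<^sub>j) / (n
  p\<^sub>j))\<close>. Every summand now carries a factor \<open>U\<^sub>j\<close>, and size-biasing
  cancels its denominator.\<close>

lemma mexp_pearson_size_bias:
  "mexp (Suc k) (\<lambda>u. pearson (Suc k) u * g (pearson (Suc k) u))
    = mexp k (\<lambda>u. \<Sum>j=1..r. (std_count (Suc k) u j / cell_scale (Suc k) j + 1) * g (pearson (Suc k) (inc j u)))"
proof -
  define n where "n = Suc k"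
  have n: "n \<ge> 1" by (simp add: n_def)
  define \<phi> where "\<phi> j u = (real (u j) - n * p j) / (n * p j) * g (pearson n u)" for j u
  have "mexp n (\<lambda>u. pearson n u * g (pearson n u)) = mexp n (\<lambda>u. \<Sum>j=1..r. real (u j) * \<phi> j u)"
  proof (rule mexp_cong)
    fix u assume u: "(\<Sum>j=1..r. u j) = n"
    have *: "real (u j) * \<phi> j u = (std_count n u j)\<^sup>2 * g (pearson n u) + (real (u j) - n * p j) * g (pearson n u)"
      if j: "j \<in> {1..r}" for j
    proof -
      have sq: "(cell_scale n j)\<^sup>2 = 1 / (n * p j)" using cell_scale_sq[OF n j] p_pos[OF j] n by (simp add: field_simps)
      then show ?thesis
        using p_pos[OF j] n unfolding \<phi>_def std_count_def power_mult_distrib sq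
        by (simp add: power2_eq_square field_simps)
    qed
    have "(\<Sum>j=1..r. real (u j) * \<phi> j u) =
        pearson n u * g (pearson n u) + (\<Sum>j=1..r. real (u j) - n * p j) * g (pearson n u)"
      by (simp add: * sum.distrib pearson_def flip: sum_distrib_right)
    then show "pearson n u * g (pearson n u) = (\<Sum>j=1..r. real (u j) * \<phi> j u)"
      using u by (simp only: sum_deviation) simp
  qed
  also have "\<dots> = (\<Sum>j=1..r. real n * p j * mexp k (\<lambda>u. \<phi> j (inc j u)))"
    unfolding mexp_sum n_def by (intro sum.cong refl mexp_size_bias)
  also have "\<dots> = mexp k (\<lambda>u. \<Sum>j=1..r. real n * p j * \<phi> j (inc j u))"
    by (simp only: mexp_sum mexp_cmult)
  also have "\<dots> = mexp k (\<lambda>u. \<Sum>j=1..r. (std_count n u j / cell_scale n j + 1) * g (pearson n (inc j u)))"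
  proof (intro mexp_cong sum.cong refl)
    fix u j assume j: "j \<in> {1..r}"
    show "real n * p j * \<phi> j (inc j u) = (std_count n u j / cell_scale n j + 1) * g (pearson n (inc j u))"
      unfolding std_count_div_scale[OF n j] \<phi>_def using p_pos[OF j] n by (simp add: inc_apply)
  qed
  finally show ?thesis unfolding n_def .
qed

text \<open>The scale belongs to \<open>n\<close> trials but the count to \<open>k \<le> n\<close>:
  the Stein argument uses \<open>k = n - 1\<close>, the comparison of the statistics
  \<open>k = n\<close>. The odd moments are interpolated between even ones; \<open>3/2\<close> in
  the cubic case is a rational close to the optimal \<open>sqrt 3\<close>, and \<open>1/5184\<close>
  is the square of \<open>1/72\<close>.\<close>

lemma scaled_deviation_moments:
  assumes j: "j \<in> {1..r}" and n: "n \<ge> 1" and k: "k \<le> n" and a: "cell_scale n j \<le> 1/72"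
  defines "d \<equiv> \<lambda>u. cell_scale n j * \<bar>real (u j) - k * p j\<bar>"
  shows "mexp k d \<le> 1" "mexp k (\<lambda>u. (d u)\<^sup>2) \<le> 1" "mexp k (\<lambda>u. d u ^ 3) \<le> 1751/1000"
proof -
  define a where "a = cell_scale n j"
  have a0: "a > 0" "a \<le> 1/72" using cell_scale_pos[OF n j] assms by (auto simp: a_def)
  define s where "s = k * (p j * (1 - p j))"
  have pj: "0 < p j" "p j \<le> 1" using p_pos[OF j] p_le_1[OF j] by auto
  have s: "0 \<le> s" "s \<le> n * p j"
  proof -
    have "k * (p j * (1 - p j)) \<le> n * (p j * 1)"
      using k pj by (intro mult_mono) auto
    then show "s \<le> n * p j" by (simp add: s_def)
    show "0 \<le> s" using pj by (simp add: s_def)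
  qed
  have as: "a\<^sup>2 * s \<le> 1"
  proof -
    have "a\<^sup>2 * s \<le> a\<^sup>2 * (n * p j)" using s by (intro mult_left_mono) auto
    then show ?thesis using cell_scale_sq[OF n j] by (simp add: a_def)
  qed
  show 2: "mexp k (\<lambda>u. (d u)\<^sup>2) \<le> 1"
  proof -
    have "mexp k (\<lambda>u. (d u)\<^sup>2) = mexp k (\<lambda>u. a\<^sup>2 * (real (u j) - k * p j)\<^sup>2)"
      by (intro mexp_cong) (simp add: d_def a_def power_mult_distrib)
    also have "\<dots> = a\<^sup>2 * s" by (simp only: mexp_cmult mexp_central_2[OF j] s_def)
    finally show ?thesis using as by simp
  qed
  have 4: "mexp k (\<lambda>u. d u ^ 4) \<le> 3 + 1/5184"
  proof -
    have "mexp k (\<lambda>u. d u ^ 4) = mexp k (\<lambda>u. a ^ 4 * (real (u j) - k * p j) ^ 4)"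
      by (intro mexp_cong) (simp add: d_def a_def power_mult_distrib)
    also have "\<dots> = a ^ 4 * mexp k (\<lambda>u. (real (u j) - k * p j) ^ 4)" by (rule mexp_cmult)
    also have "\<dots> \<le> a ^ 4 * (3 * s\<^sup>2 + s)"
      using mexp_central_4[OF j, of k] by (intro mult_left_mono) (auto simp: s_def)
    also have "\<dots> = 3 * (a\<^sup>2 * s)\<^sup>2 + a\<^sup>2 * (a\<^sup>2 * s)" by (simp add: power2_eq_square power4_eq_xxxx algebra_simps)
    also have "\<dots> \<le> 3 * 1\<^sup>2 + (1/72)\<^sup>2 * 1"
      using as s a0 by (intro add_mono mult_mono power_mono) auto
    finally show ?thesis by (simp add: power2_eq_square)
  qed
  have d0: "d u \<ge> 0" for u using a0 by (simp add: d_def a_def)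
  have "mexp k d \<le> mexp k (\<lambda>u. 1/2 * (d u)\<^sup>2 + 1/2)"
  proof (rule mexp_mono)
    show "d u \<le> 1/2 * (d u)\<^sup>2 + 1/2" for u
      using zero_le_power2[of "d u - 1"] by (simp add: power2_eq_square algebra_simps)
  qed
  then show "mexp k d \<le> 1" using 2 by (simp only: mexp_add mexp_cmult mexp_const)
  have "mexp k (\<lambda>u. d u ^ 3) \<le> mexp k (\<lambda>u. 1/3 * d u ^ 4 + 3/4 * (d u)\<^sup>2)"
  proof (rule mexp_mono)
    fix u
    have "0 \<le> d u ^ 2 * (d u - 3/2)\<^sup>2" by simp
    then show "d u ^ 3 \<le> 1/3 * d u ^ 4 + 3/4 * (d u)\<^sup>2"
      by (simp add: power2_eq_square power3_eq_cube power4_eq_xxxx algebra_simps)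
  qed
  then show "mexp k (\<lambda>u. d u ^ 3) \<le> 1751/1000"
    using 2 4 by (simp only: mexp_add mexp_cmult)
qed

text \<open>Here \<open>g\<close> is only controlled on the open half-line. This suffices: \<open>T(U') > 0\<close> because the
  deviations of \<open>U'\<close> from \<open>n p\<close> sum to \<open>-1\<close>, and if \<open>T(U' + e\<^sub>j) = 0\<close> then the coefficient
  \<open>U'\<^sub>j + 1 - n p\<^sub>j\<close> of \<open>g(T(U' + e\<^sub>j))\<close> vanishes.\<close>

lemma pearson_stein_bound:
  fixes g g' g'' h h' :: "real \<Rightarrow> real" and c \<delta> G1 G2 D1 :: real
  assumes n_def: "n = Suc k"
    and dg: "\<And>x. x > 0 \<Longrightarrow> (g has_real_derivative g' x) (at x)"
    and dg': "\<And>x. x > 0 \<Longrightarrow> (g' has_real_derivative g'' x) (at x)"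
    and eq: "\<And>x. x > 0 \<Longrightarrow> x * g' x + (real (r - 1) / 2 - x / 2) * g x = h x - c"
    and g: "\<And>x. x > 0 \<Longrightarrow> \<bar>g x\<bar> \<le> 8"
    and xg': "\<And>x. x > 0 \<Longrightarrow> \<bar>x * g' x\<bar> \<le> 2"
    and g': "\<And>x. x > 0 \<Longrightarrow> \<bar>g' x\<bar> \<le> G1"
    and g'': "\<And>x. x > 0 \<Longrightarrow> \<bar>g'' x\<bar> \<le> G2"
    and h': "\<And>x. (h has_real_derivative h' x) (at x)" "\<And>x. \<bar>h' x\<bar> \<le> D1"
    and \<delta>: "\<And>j. j \<in> {1..r} \<Longrightarrow> cell_scale n j \<le> \<delta>" "\<delta> \<le> 1/72"
  shows "\<bar>mexp n (\<lambda>u. h (pearson n u)) - c\<bar>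
    \<le> \<delta> * (2.05 * (D1 + 5) + 1.53 * r * G1 + 1.9 * r * G2)"
proof -
  have r: "r \<ge> 1" using p_sum by (cases r) auto
  have n: "n \<ge> 1" by (simp add: n_def)
  have D1: "D1 \<ge> 0" using h'(2)[of 0] by linarith
  have G: "G1 \<ge> 0" "G2 \<ge> 0" using g'[of 1] g''[of 1] by auto
  define a where "a = cell_scale n"
  define w where "w u = std_count n u" for u
  define t where "t u = pearson n u" for u
  define \<Delta> where "\<Delta> u j = 2 * a j * w u j + (a j)\<^sup>2" for u j
  define b where "b u j = w u j / a j + 1" for u j
  have a: "0 < a j" "a j \<le> \<delta>" "a j \<le> 1/72" if "j \<in> {1..r}" for j
    using cell_scale_pos[OF n that] \<delta>(1)[OF that] \<delta>(2) by (auto simp: a_def)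
  have t_inc: "t (inc j u) = t u + \<Delta> u j" if "j \<in> {1..r}" for j u
    using pearson_inc[OF that] by (simp add: t_def \<Delta>_def a_def w_def)
  have \<Delta>_le: "\<bar>\<Delta> u j\<bar> \<le> 2 * a j * (\<bar>w u j\<bar> + a j)" "\<bar>\<Delta> u j\<bar> \<le> a j * (2 * \<bar>w u j\<bar> + a j)"
    if "j \<in> {1..r}" for u j
  proof -
    have "\<bar>\<Delta> u j\<bar> \<le> \<bar>2 * a j * w u j\<bar> + \<bar>(a j)\<^sup>2\<bar>" unfolding \<Delta>_def by (rule abs_triangle_ineq)
    then show "\<bar>\<Delta> u j\<bar> \<le> a j * (2 * \<bar>w u j\<bar> + a j)"
      using a[OF that] by (simp add: abs_mult power2_eq_square algebra_simps)
    also have "\<dots> \<le> 2 * a j * (\<bar>w u j\<bar> + a j)"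
      using a[OF that] by (simp add: algebra_simps)
    finally show "\<bar>\<Delta> u j\<bar> \<le> 2 * a j * (\<bar>w u j\<bar> + a j)" .
  qed
  \<comment> \<open>A mean-zero correction. Both sums have expectation \<open>E T g(T)\<close> over
    \<open>n\<close> trials, the first by size-biasing, the second by conditioning on the last
    trial. Subtracting \<open>A / 2\<close> leaves a quantity that is small pointwise and not just
    on average.\<close>
  define A where "A u = (\<Sum>j=1..r. b u j * g (t (inc j u))) - (\<Sum>j=1..r. p j * (t (inc j u) * g (t (inc j u))))" for u
  have A0: "mexp k A = 0"
  proof -
    have "mexp k (\<lambda>u. \<Sum>j=1..r. b u j * g (t (inc j u))) = mexp n (\<lambda>u. t u * g (t u))"
      using mexp_pearson_size_bias[of k g] unfolding n_def b_def w_def a_def t_def by simp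
    also have "\<dots> = mexp k (\<lambda>u. \<Sum>j=1..r. p j * (t (inc j u) * g (t (inc j u))))"
      unfolding n_def mexp_sum mexp_cmult by simp
    finally show ?thesis unfolding A_def mexp_diff by simp
  qed
  \<comment> \<open>Moments are known around the mean \<open>k * p j\<close> of \<open>n - 1\<close>
    trials, while \<open>w\<close> is centred at \<open>n * p j\<close>; the shift costs at most
    \<open>a j\<close>.\<close>
  define e where "e u j = a j * \<bar>real (u j) - k * p j\<bar> + a j" for u j
  \<comment> \<open>The error of cell \<open>j\<close>: the change of \<open>x g(x)\<close> and of
    \<open>h\<close> caused by one observation, with \<open>5\<close> being half of the Lipschitz
    constant 10 of \<open>x g(x)\<close>; the lower-order part of \<open>b * \<Delta>\<close>; and
    the Taylor remainder.\<close>
  define E where "E u j = (D1 + 5) * p j * (a j * (2 * e u j + a j))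
      + 1/2 * G1 * (a j * (3 * e u j + a j)) + G2 * (a j * (e u j + a j) ^ 3)" for u j
  have we: "\<bar>w u j\<bar> \<le> e u j" if j: "j \<in> {1..r}" for u j
  proof -
    have "w u j = a j * (real (u j) - k * p j) - a j * p j"
      by (simp add: w_def std_count_def a_def n_def algebra_simps)
    moreover have "a j * p j \<le> a j * 1" "a j * p j \<ge> 0"
      using a[OF j] p_le_1[OF j] p_pos[OF j] by (auto intro!: mult_left_mono)
    moreover have "\<bar>a j * (real (u j) - k * p j)\<bar> = a j * \<bar>real (u j) - k * p j\<bar>"
      using a[OF j] by (simp add: abs_mult)
    ultimately show ?thesis unfolding e_def by linarith
  qed
  have point: "\<bar>h (t u) - c - A u / 2\<bar> + (\<Sum>j=1..r. p j * \<bar>h (t (inc j u)) - h (t u)\<bar>) \<le> (\<Sum>j=1..r. E u j)"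
    if u: "(\<Sum>j=1..r. u j) = k" for u
  proof -
    define x where "x = t u"
    define y where "y j = t (inc j u)" for j
    have b: "b u j = real (u j) + 1 - n * p j" if "j \<in> {1..r}" for j
      using std_count_div_scale[OF n that, of u] by (simp add: b_def w_def a_def)
    have sum_dev: "(\<Sum>j=1..r. real (u j) - n * p j) = -1"
      using u by (simp only: sum_deviation) (simp add: n_def)
    have x0: "x > 0"
    proof (rule ccontr)
      assume "\<not> x > 0"
      then have "pearson n u = 0" using pearson_nonneg[of n u] by (simp add: x_def t_def)
      then have "real (u j) - n * p j = 0" if "j \<in> {1..r}" for j
        using pearson_eq_0_imp[OF _ that, of n u] std_count_div_scale[OF n that, of u] by simp
      then show False using sum_dev by simp
    qed
    have y: "y j = x + \<Delta> u j" "y j \<ge> 0" if "j \<in> {1..r}" for j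
      using t_inc[OF that] pearson_nonneg[of n "inc j u"] by (auto simp: x_def y_def t_def)
    have b_zero: "b u j = 0" if "j \<in> {1..r}" "y j = 0" for j
    proof -
      have "std_count n (inc j u) j = 0"
        using pearson_eq_0_imp[of n "inc j u" j] that by (simp add: y_def t_def)
      then show ?thesis using a[OF that(1)] by (simp add: std_count_inc b_def w_def a_def field_simps)
    qed
    have sum_b: "(\<Sum>j=1..r. b u j) = real (r - 1)"
    proof -
      have "(\<Sum>j=1..r. b u j) = (\<Sum>j=1..r. (real (u j) - n * p j) + 1)"
        by (intro sum.cong refl) (simp add: b)
      then show ?thesis using r sum_dev by (simp add: sum.distrib of_nat_diff)
    qed
    \<comment> \<open>The squares of \<open>w\<close> add up to Pearson's statistic itself; this is
      the source of the term \<open>2 x g'(x)\<close> in twice the Stein operator, as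
      \<open>sum_b\<close> is of \<open>(r - 1) g(x)\<close>.\<close>
    have sum_b\<Delta>: "(\<Sum>j=1..r. b u j * \<Delta> u j) = 2 * x + (\<Sum>j=1..r. a j * (3 * w u j + a j))"
    proof -
      have "b u j * \<Delta> u j = 2 * (w u j)\<^sup>2 + a j * (3 * w u j + a j)" if "j \<in> {1..r}" for j
        using a[OF that] by (simp add: b_def \<Delta>_def power2_eq_square field_simps)
      then show ?thesis by (simp add: sum.distrib x_def t_def pearson_def w_def sum_distrib_left)
    qed
    define \<rho> where "\<rho> j = g (y j) - g x - \<Delta> u j * g' x" for j
    \<comment> \<open>The coefficient is of order \<open>1 / a j\<close> and the remainder of order
      \<open>(a j)\<^sup>2\<close>, so one factor \<open>a j\<close> survives.\<close>
    have b\<rho>: "\<bar>b u j * \<rho> j\<bar> \<le> 2 * G2 * (a j * (\<bar>w u j\<bar> + a j) ^ 3)" if j: "j \<in> {1..r}" for j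
    proof (cases "y j = 0")
      case True
      then show ?thesis using b_zero[OF j] a[OF j] G by simp
    next
      case False
      then have y0: "y j > 0" using y(2)[OF j] by simp
      have \<rho>: "\<bar>\<rho> j\<bar> \<le> G2 * (\<Delta> u j)\<^sup>2 / 2"
        using Taylor_2_bound[OF dg dg' g'' x0 y0] y(1)[OF j] by (simp add: \<rho>_def)
      have bb: "\<bar>b u j\<bar> \<le> (\<bar>w u j\<bar> + a j) / a j"
      proof -
        have "\<bar>b u j\<bar> = \<bar>w u j + a j\<bar> / a j" using a[OF j] by (simp add: b_def field_simps abs_divide)
        also have "\<dots> \<le> (\<bar>w u j\<bar> + a j) / a j" using a[OF j] by (intro divide_right_mono) auto
        finally show ?thesis .
      qed
      have "\<bar>b u j * \<rho> j\<bar> \<le> (\<bar>w u j\<bar> + a j) / a j * (G2 * (2 * a j * (\<bar>w u j\<bar> + a j))\<^sup>2 / 2)"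
        unfolding abs_mult
      proof (intro mult_mono bb order_trans[OF \<rho>])
        have "(\<Delta> u j)\<^sup>2 \<le> (2 * a j * (\<bar>w u j\<bar> + a j))\<^sup>2"
          using \<Delta>_le(1)[OF j, of u] by (metis abs_ge_zero power2_abs power_mono)
        then show "G2 * (\<Delta> u j)\<^sup>2 / 2 \<le> G2 * (2 * a j * (\<bar>w u j\<bar> + a j))\<^sup>2 / 2"
          using G by (intro divide_right_mono mult_left_mono) auto
      qed (use a[OF j] in auto)
      also have "\<dots> = 2 * G2 * (a j * (\<bar>w u j\<bar> + a j) ^ 3)"
        using a[OF j] by (simp add: power2_eq_square power3_eq_cube)
      finally show ?thesis .
    qed
    \<comment> \<open>The derivative \<open>g + x g'\<close> of \<open>x g(x)\<close> is bounded by
      \<open>8 + 2\<close>. For \<open>y j = 0\<close> the product vanishes whatever the value of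
      \<open>g\<close> at 0.\<close>
    have yg: "\<bar>y j * g (y j) - x * g x\<bar> \<le> 10 * \<bar>\<Delta> u j\<bar>" if j: "j \<in> {1..r}" for j
    proof (cases "y j = 0")
      case True
      have "x * \<bar>g x\<bar> \<le> x * 10" using g[OF x0] x0 by (intro mult_left_mono) auto
      moreover have "\<Delta> u j = - x" using True y(1)[OF j] by simp
      ultimately show ?thesis using True x0 by (simp add: abs_mult)
    next
      case False
      then have y0: "y j > 0" using y(2)[OF j] by simp
      have "norm (y j * g (y j) - x * g x) \<le> 10 * norm (y j - x)"
      proof (rule field_differentiable_bound[where S = "{0<..}" and f' = "\<lambda>z. g z + z * g' z"])
        fix z :: real assume "z \<in> {0<..}"
        then have z: "z > 0" by simp
        show "((\<lambda>z. z * g z) has_field_derivative g z + z * g' z) (at z within {0<..})"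
          by (rule has_field_derivative_at_within) (auto intro!: derivative_eq_intros dg z)
        show "norm (g z + z * g' z) \<le> 10" using g[OF z] xg'[OF z] by auto
      qed (use x0 y0 in auto)
      then show ?thesis using y(1)[OF j] by simp
    qed
    have hh: "\<bar>h (y j) - h x\<bar> \<le> D1 * \<bar>\<Delta> u j\<bar>" if j: "j \<in> {1..r}" for j
    proof -
      have "norm (h (y j) - h x) \<le> D1 * norm (y j - x)"
        by (rule field_differentiable_bound[where S = UNIV and f' = h']) (use h' in auto)
      then show ?thesis using y(1)[OF j] by simp
    qed
    have sum_bg: "(\<Sum>j=1..r. b u j * g (y j)) = real (r - 1) * g x + g' x * (2 * x + (\<Sum>j=1..r. a j * (3 * w u j + a j)))
        + (\<Sum>j=1..r. b u j * \<rho> j)"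
    proof -
      have "(\<Sum>j=1..r. b u j * g (y j)) = (\<Sum>j=1..r. b u j * g x + g' x * (b u j * \<Delta> u j) + b u j * \<rho> j)"
        by (intro sum.cong refl) (simp add: \<rho>_def algebra_simps)
      also have "\<dots> = (\<Sum>j=1..r. b u j) * g x + g' x * (\<Sum>j=1..r. b u j * \<Delta> u j) + (\<Sum>j=1..r. b u j * \<rho> j)"
        by (simp only: sum.distrib sum_distrib_left sum_distrib_right)
      finally show ?thesis unfolding sum_b sum_b\<Delta> .
    qed
    have sum_pg: "(\<Sum>j=1..r. p j * (y j * g (y j))) = x * g x + (\<Sum>j=1..r. p j * (y j * g (y j) - x * g x))"
      using p_sum by (simp add: sum_subtractf right_diff_distrib flip: sum_distrib_right)
    have key: "2 * (h x - c) - A u = (\<Sum>j=1..r. p j * (y j * g (y j) - x * g x)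
        - g' x * (a j * (3 * w u j + a j)) - b u j * \<rho> j)"
    proof -
      define S1 where "S1 = (\<Sum>j=1..r. p j * (y j * g (y j) - x * g x))"
      define S2 where "S2 = (\<Sum>j=1..r. a j * (3 * w u j + a j))"
      define S3 where "S3 = (\<Sum>j=1..r. b u j * \<rho> j)"
      have "(\<Sum>j=1..r. p j * (y j * g (y j) - x * g x) - g' x * (a j * (3 * w u j + a j)) - b u j * \<rho> j)
          = S1 - g' x * S2 - S3"
        by (simp only: sum_subtractf sum_distrib_left S1_def S2_def S3_def)
      moreover have "A u = (\<Sum>j=1..r. b u j * g (y j)) - (\<Sum>j=1..r. p j * (y j * g (y j)))"
        by (simp add: A_def y_def)
      moreover have "2 * (h x - c) = 2 * (x * g' x) + real (r - 1) * g x - x * g x"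
        using eq[OF x0] by (simp add: algebra_simps)
      ultimately show ?thesis
        unfolding sum_bg sum_pg S1_def[symmetric] S2_def[symmetric] S3_def[symmetric]
        by (simp only:) (simp add: algebra_simps)
    qed
    have "\<bar>2 * (h x - c) - A u\<bar> \<le> (\<Sum>j=1..r. p j * (10 * (a j * (2 * e u j + a j)))
        + G1 * (a j * (3 * e u j + a j)) + 2 * G2 * (a j * (e u j + a j) ^ 3))"
      unfolding key
    proof (rule order_trans[OF sum_abs sum_mono])
      fix j assume j: "j \<in> {1..r}"
      have "\<bar>p j * (y j * g (y j) - x * g x)\<bar> \<le> p j * (10 * (a j * (2 * e u j + a j)))"
      proof -
        have "\<bar>y j * g (y j) - x * g x\<bar> \<le> 10 * (a j * (2 * \<bar>w u j\<bar> + a j))"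
          using yg[OF j] \<Delta>_le(2)[OF j, of u] by linarith
        also have "\<dots> \<le> 10 * (a j * (2 * e u j + a j))"
          using a[OF j] we[OF j] by (intro mult_left_mono) auto
        finally show ?thesis using p_pos[OF j] by (simp add: abs_mult)
      qed
      moreover have "\<bar>g' x * (a j * (3 * w u j + a j))\<bar> \<le> G1 * (a j * (3 * e u j + a j))"
      proof -
        have "\<bar>a j * (3 * w u j + a j)\<bar> \<le> a j * (3 * e u j + a j)"
          using a[OF j] we[OF j, of u] unfolding abs_mult by (intro mult_mono) auto
        then show ?thesis unfolding abs_mult[of "g' x"] using g'[OF x0] G by (intro mult_mono) auto
      qed
      moreover have "\<bar>b u j * \<rho> j\<bar> \<le> 2 * G2 * (a j * (e u j + a j) ^ 3)"
      proof (rule order_trans[OF b\<rho>[OF j]])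
        show "2 * G2 * (a j * (\<bar>w u j\<bar> + a j) ^ 3) \<le> 2 * G2 * (a j * (e u j + a j) ^ 3)"
          using a[OF j] we[OF j, of u] G by (intro mult_left_mono power_mono) auto
      qed
      ultimately show "\<bar>p j * (y j * g (y j) - x * g x) - g' x * (a j * (3 * w u j + a j)) - b u j * \<rho> j\<bar>
          \<le> p j * (10 * (a j * (2 * e u j + a j))) + G1 * (a j * (3 * e u j + a j)) + 2 * G2 * (a j * (e u j + a j) ^ 3)"
        by linarith
    qed
    moreover have "\<bar>h x - c - A u / 2\<bar> = \<bar>2 * (h x - c) - A u\<bar> / 2" by (simp add: abs_if)
    ultimately have 1: "\<bar>h x - c - A u / 2\<bar> \<le> (\<Sum>j=1..r. p j * (10 * (a j * (2 * e u j + a j)))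
        + G1 * (a j * (3 * e u j + a j)) + 2 * G2 * (a j * (e u j + a j) ^ 3)) / 2"
      by (simp only: divide_right_mono zero_le_numeral)
    have 2: "(\<Sum>j=1..r. p j * \<bar>h (y j) - h x\<bar>) \<le> (\<Sum>j=1..r. p j * (D1 * (a j * (2 * e u j + a j))))"
    proof (intro sum_mono mult_left_mono)
      fix j assume j: "j \<in> {1..r}"
      have "D1 * \<bar>\<Delta> u j\<bar> \<le> D1 * (a j * (2 * \<bar>w u j\<bar> + a j))"
        using \<Delta>_le(2)[OF j, of u] D1 by (intro mult_left_mono)
      also have "\<dots> \<le> D1 * (a j * (2 * e u j + a j))"
        using a[OF j] we[OF j] D1 by (intro mult_left_mono) auto
      finally show "\<bar>h (y j) - h x\<bar> \<le> D1 * (a j * (2 * e u j + a j))" using hh[OF j] by linarith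
      show "0 \<le> p j" using p_pos[OF j] by simp
    qed
    have "(\<Sum>j=1..r. E u j) = (\<Sum>j=1..r. p j * (10 * (a j * (2 * e u j + a j)))
        + G1 * (a j * (3 * e u j + a j)) + 2 * G2 * (a j * (e u j + a j) ^ 3)) / 2 + (\<Sum>j=1..r. p j * (D1 * (a j * (2 * e u j + a j))))"
      unfolding sum_divide_distrib sum.distrib[symmetric]
      by (intro sum.cong refl) (simp add: E_def field_simps)
    then show ?thesis using 1 2 by (simp add: x_def y_def)
  qed
  have "mexp n (\<lambda>u. h (t u)) = mexp k (\<lambda>u. \<Sum>j=1..r. p j * h (t (inc j u)))"
    unfolding n_def mexp_sum mexp_cmult by simp
  also have "\<dots> = mexp k (\<lambda>u. ((h (t u) - c - A u / 2) + (\<Sum>j=1..r. p j * (h (t (inc j u)) - h (t u)))) + (c + 1/2 * A u))"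
    using p_sum by (intro mexp_cong) (simp add: sum_subtractf right_diff_distrib flip: sum_distrib_right)
  also have "\<dots> = mexp k (\<lambda>u. (h (t u) - c - A u / 2) + (\<Sum>j=1..r. p j * (h (t (inc j u)) - h (t u)))) + c"
    by (simp only: mexp_add mexp_cmult mexp_const A0)
  finally have "\<bar>mexp n (\<lambda>u. h (t u)) - c\<bar>
      = \<bar>mexp k (\<lambda>u. (h (t u) - c - A u / 2) + (\<Sum>j=1..r. p j * (h (t (inc j u)) - h (t u))))\<bar>"
    by simp
  also have "\<dots> \<le> mexp k (\<lambda>u. \<Sum>j=1..r. E u j)"
  proof (rule order_trans[OF mexp_abs_le mexp_mono])
    fix u assume u: "(\<Sum>j=1..r. u j) = k"
    have "\<bar>\<Sum>j=1..r. p j * (h (t (inc j u)) - h (t u))\<bar> \<le> (\<Sum>j=1..r. p j * \<bar>h (t (inc j u)) - h (t u)\<bar>)"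
      by (rule order_trans[OF sum_abs]) (use p_pos in \<open>auto simp: abs_mult less_imp_le intro!: sum_mono\<close>)
    then show "\<bar>h (t u) - c - A u / 2 + (\<Sum>j=1..r. p j * (h (t (inc j u)) - h (t u)))\<bar> \<le> (\<Sum>j=1..r. E u j)"
      using point[OF u] by linarith
  qed
  also have "\<dots> = (\<Sum>j=1..r. mexp k (\<lambda>u. E u j))" by (rule mexp_sum)
  \<comment> \<open>With \<open>a j \<le> 1/72\<close>, the constants round up
    \<open>2 + 3 a\<close>, \<open>3/2 + 2 a\<close> and
    \<open>1.751 + 6 a + 12 a\<^sup>2 + 8 a\<^sup>3\<close>. The first part carries the weight
    \<open>p j\<close> and sums without a factor \<open>r\<close>; the other two rely on the decay
    of \<open>G1\<close> and \<open>G2\<close> in \<open>r\<close>.\<close>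
  also have "\<dots> \<le> (\<Sum>j=1..r. p j * (\<delta> * (2.05 * (D1 + 5))) + \<delta> * (1.53 * G1 + 1.9 * G2))"
  proof (rule sum_mono)
    fix j assume j: "j \<in> {1..r}"
    define d where "d u = a j * \<bar>real (u j) - k * p j\<bar>" for u
    have d: "mexp k d \<le> 1" "mexp k (\<lambda>u. (d u)\<^sup>2) \<le> 1" "mexp k (\<lambda>u. d u ^ 3) \<le> 1751/1000"
      using scaled_deviation_moments[OF j n, of k] a[OF j] unfolding d_def[abs_def] a_def n_def by auto
    have d0: "d u \<ge> 0" for u using a[OF j] by (simp add: d_def)
    have "mexp k (\<lambda>u. E u j) = mexp k (\<lambda>u. (D1 + 5) * p j * a j * 2 * d u + (D1 + 5) * p j * a j * (3 * a j)
        + (1/2 * G1 * a j * 3 * d u + 1/2 * G1 * a j * (4 * a j))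
        + (G2 * a j * (d u ^ 3) + (G2 * a j * (6 * a j) * (d u)\<^sup>2 + (G2 * a j * (12 * (a j)\<^sup>2) * d u + G2 * a j * (8 * a j ^ 3)))))"
      by (intro mexp_cong) (simp add: E_def e_def d_def[symmetric] power2_eq_square power3_eq_cube algebra_simps)
    also have "\<dots> \<le> (D1 + 5) * p j * a j * 2 * 1 + (D1 + 5) * p j * a j * (3 * a j)
        + (1/2 * G1 * a j * 3 * 1 + 1/2 * G1 * a j * (4 * a j))
        + (G2 * a j * (1751/1000) + (G2 * a j * (6 * a j) * 1 + (G2 * a j * (12 * (a j)\<^sup>2) * 1 + G2 * a j * (8 * a j ^ 3))))"
      unfolding mexp_add mexp_cmult mexp_const
      using d a[OF j] D1 G p_pos[OF j] by (intro add_mono mult_left_mono mult_nonneg_nonneg order_refl) auto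
    also have "\<dots> = p j * (a j * ((2 + 3 * a j) * (D1 + 5))) + a j * ((3/2 + 2 * a j) * G1
        + (1751/1000 + 6 * a j + 12 * (a j)\<^sup>2 + 8 * a j ^ 3) * G2)"
      by (simp add: algebra_simps)
    also have "\<dots> \<le> p j * (\<delta> * (2.05 * (D1 + 5))) + \<delta> * (1.53 * G1 + 1.9 * G2)"
    proof -
      have a2: "(a j)\<^sup>2 \<le> (1/72)\<^sup>2" "a j ^ 3 \<le> (1/72) ^ 3" using a[OF j] by (auto intro!: power_mono)
      then have "1751/1000 + 6 * a j + 12 * (a j)\<^sup>2 + 8 * a j ^ 3 \<le> 1.9"
        using a[OF j] by (simp add: power2_eq_square power3_eq_cube)
      then show ?thesis
        using a[OF j] D1 G p_pos[OF j]
        by (intro add_mono mult_mono mult_nonneg_nonneg add_nonneg_nonneg) auto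
    qed
    finally show "mexp k (\<lambda>u. E u j) \<le> p j * (\<delta> * (2.05 * (D1 + 5))) + \<delta> * (1.53 * G1 + 1.9 * G2)" .
  qed
  also have "\<dots> = \<delta> * (2.05 * (D1 + 5) + 1.53 * r * G1 + 1.9 * r * G2)"
    by (simp only: sum.distrib sum_distrib_right[symmetric] p_sum) (simp add: algebra_simps)
  finally show ?thesis by (simp add: t_def)
qed

end

section \<open>Power divergence against Pearson's statistic\<close>

text \<open>Threefold integration of a sign. Below, \<open>f\<close> is a majorant plus or minus the
  gap, so an estimate of the gap reduces to one of its explicit third derivative.\<close>

lemma third_order_nonneg:
  fixes f f1 f2 f3 :: "real \<Rightarrow> real"
  assumes "\<And>s. 0 \<le> s \<Longrightarrow> s \<le> t \<Longrightarrow> (f has_real_derivative f1 s) (at s)"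
    and "\<And>s. 0 \<le> s \<Longrightarrow> s \<le> t \<Longrightarrow> (f1 has_real_derivative f2 s) (at s)"
    and "\<And>s. 0 \<le> s \<Longrightarrow> s \<le> t \<Longrightarrow> (f2 has_real_derivative f3 s) (at s)"
    and "\<And>s. 0 \<le> s \<Longrightarrow> s \<le> t \<Longrightarrow> f3 s \<ge> 0"
    and "f 0 \<ge> 0" "f1 0 \<ge> 0" "f2 0 \<ge> 0" "t \<ge> 0"
  shows "f t \<ge> 0"
proof -
  have mono: "F s \<ge> 0"
    if "\<And>s. 0 \<le> s \<Longrightarrow> s \<le> t \<Longrightarrow> (F has_real_derivative F' s) (at s)"
      "\<And>s. 0 \<le> s \<Longrightarrow> s \<le> t \<Longrightarrow> F' s \<ge> 0" "F 0 \<ge> 0" "0 \<le> s" "s \<le> t" for F F' :: "real \<Rightarrow> real" and s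
  proof -
    have "F 0 \<le> F s"
    proof (rule DERIV_nonneg_imp_nondecreasing[OF \<open>0 \<le> s\<close>])
      fix x assume "0 \<le> x" "x \<le> s"
      then show "\<exists>y. (F has_real_derivative y) (at x) \<and> 0 \<le> y"
        using that(1,2)[of x] that(5) by auto
    qed
    then show ?thesis using that by simp
  qed
  have "f2 s \<ge> 0" if "0 \<le> s" "s \<le> t" for s
    using mono[of f2 f3 s] assms that by blast
  then have "f1 s \<ge> 0" if "0 \<le> s" "s \<le> t" for s
    using mono[of f1 f2 s] assms that by blast
  then show ?thesis
    using mono[of f f1 t] assms by blast
qed

text \<open>The contribution of a cell per unit of expected count, minus that of Pearson's statistic, as a
  function of the ratio of observed to expected count. A multiple of \<open>x - 1\<close>, whose weighted sum over
  the cells is 0, is added to make the gap vanish to third order at 1.\<close>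

definition divergence_gap :: "real \<Rightarrow> real \<Rightarrow> real" where
  "divergence_gap lam x =
    (if lam = 0 then 2 * (x * ln x - x + 1)
     else 2 / (lam * (lam + 1)) * (x powr (lam + 1) - 1 - (lam + 1) * (x - 1))) - (x - 1)\<^sup>2"

definition divergence_gap1 :: "real \<Rightarrow> real \<Rightarrow> real" where
  "divergence_gap1 lam x = (if lam = 0 then 2 * ln x else 2 / lam * (x powr lam - 1)) - 2 * (x - 1)"

text \<open>From the second derivative on, the logarithmic case \<open>lam = 0\<close> merges with
  the general formula, so the comparisons need no case distinction.\<close>

lemma divergence_gap_derivs:
  assumes "x > 0" "lam > -1"
  shows divergence_gap_deriv: "(divergence_gap lam has_real_derivative divergence_gap1 lam x) (at x)"
    and divergence_gap1_deriv: "(divergence_gap1 lam has_real_derivative 2 * x powr (lam - 1) - 2) (at x)"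
    and "((\<lambda>x. 2 * x powr (lam - 1) - 2) has_real_derivative 2 * (lam - 1) * x powr (lam - 2)) (at x)"
proof -
  show "(divergence_gap lam has_real_derivative divergence_gap1 lam x) (at x)"
  proof (cases "lam = 0")
    case True
    then show ?thesis using assms unfolding divergence_gap_def[abs_def] divergence_gap1_def
      by (auto intro!: derivative_eq_intros simp: field_simps)
  next
    case False
    define K where "K = 2 / (lam * (lam + 1))"
    have "lam + 1 \<noteq> 0" using assms by simp
    then have K: "K * (lam + 1) = 2 / lam" using False unfolding K_def by (simp add: divide_simps)
    have "((\<lambda>x. K * (x powr (lam + 1) - 1 - (lam + 1) * (x - 1)) - (x - 1)\<^sup>2) has_real_derivative
        K * ((lam + 1) * x powr lam - (lam + 1)) - 2 * (x - 1)) (at x)"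
      using assms by (auto intro!: derivative_eq_intros)
    also have "K * ((lam + 1) * x powr lam - (lam + 1)) = 2 / lam * (x powr lam - 1)"
      by (subst K[symmetric]) (simp add: algebra_simps)
    finally show ?thesis
      using False by (simp only: divergence_gap_def[abs_def] divergence_gap1_def K_def if_False)
  qed
  show "(divergence_gap1 lam has_real_derivative 2 * x powr (lam - 1) - 2) (at x)"
    using assms unfolding divergence_gap1_def[abs_def]
    by (cases "lam = 0") (auto intro!: derivative_eq_intros simp: powr_minus field_simps)
  show "((\<lambda>x. 2 * x powr (lam - 1) - 2) has_real_derivative 2 * (lam - 1) * x powr (lam - 2)) (at x)"
    using assms by (auto intro!: derivative_eq_intros)
qed

lemma divergence_gap_at_1 [simp]: "divergence_gap lam 1 = 0" "divergence_gap1 lam 1 = 0"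
  by (simp_all add: divergence_gap_def divergence_gap1_def)

lemma divergence_gap_at_0: "lam > -1 \<Longrightarrow> divergence_gap lam 0 = (1 - lam) / (lam + 1)"
  by (auto simp: divergence_gap_def divide_simps)

lemma divergence_gap_tendsto_0:
  assumes "lam > -1"
  shows "(divergence_gap lam \<longlongrightarrow> divergence_gap lam 0) (at_right 0)"
proof (cases "lam = 0")
  case True
  have "((\<lambda>x::real. 2 * (x * ln x - x + 1) - (x - 1)\<^sup>2) \<longlongrightarrow> 1) (at_right 0)"
    by real_asymp
  then show ?thesis using True by (simp add: divergence_gap_def[abs_def])
next
  case False
  have "((\<lambda>x. x powr (lam + 1)) \<longlongrightarrow> 0) (at_right 0)"
    using assms by real_asymp
  then have "((\<lambda>x. 2 / (lam * (lam + 1)) * (x powr (lam + 1) - 1 - (lam + 1) * (x - 1)) - (x - 1)\<^sup>2) \<longlongrightarrow>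
      2 / (lam * (lam + 1)) * (0 - 1 - (lam + 1) * (0 - 1)) - (0 - 1)\<^sup>2) (at_right 0)"
    by (intro tendsto_intros)
  then show ?thesis using False by (simp add: divergence_gap_def[abs_def])
qed

lemma has_real_derivative_compose_affine:
  fixes F :: "real \<Rightarrow> real"
  assumes "(F has_real_derivative d) (at (1 + c * s))"
  shows "((\<lambda>s. F (1 + c * s)) has_real_derivative c * d) (at s)"
proof -
  have "((\<lambda>s. 1 + c * s) has_real_derivative c) (at s)"
    by (auto intro!: derivative_eq_intros)
  from DERIV_chain2[OF assms this] show ?thesis by (simp add: mult.commute)
qed

text \<open>For \<open>lam \<le> 2\<close> the factor \<open>x powr (lam - 2)\<close> of the third
  derivative is at most 1 here, which gives the constant \<open>\<bar>lam - 1\<bar> / 3\<close>. It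
  is weakened to match the bound below 1, where the value at 0 forces
  \<open>\<bar>lam - 1\<bar> / (lam + 1)\<close>.\<close>

lemma divergence_gap_le_above:
  assumes lam: "-1 < lam" "lam \<le> 2" and x: "x \<ge> 1"
  shows "\<bar>divergence_gap lam x\<bar> \<le> \<bar>lam - 1\<bar> / (lam + 1) * \<bar>x - 1\<bar> ^ 3"
proof -
  have main: "0 \<le> \<bar>lam - 1\<bar> / 3 * (x - 1) ^ 3 + \<sigma> * divergence_gap lam (1 + 1 * (x - 1))"
    if \<sigma>: "\<bar>\<sigma>\<bar> = 1" for \<sigma> :: real
  proof (rule third_order_nonneg[where t = "x - 1" and
        f = "\<lambda>s. \<bar>lam - 1\<bar> / 3 * s ^ 3 + \<sigma> * divergence_gap lam (1 + 1 * s)" and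
        ?f1.0 = "\<lambda>s. \<bar>lam - 1\<bar> * s ^ 2 + \<sigma> * divergence_gap1 lam (1 + 1 * s)" and
        ?f2.0 = "\<lambda>s. 2 * \<bar>lam - 1\<bar> * s + \<sigma> * (2 * (1 + 1 * s) powr (lam - 1) - 2)" and
        ?f3.0 = "\<lambda>s. 2 * \<bar>lam - 1\<bar> + \<sigma> * (2 * (lam - 1) * (1 + 1 * s) powr (lam - 2))"])
    fix s :: real assume s: "0 \<le> s"
    then have s1: "1 + 1 * s > 0" by simp
    note d = has_real_derivative_compose_affine[OF divergence_gap_derivs(1)[OF s1 lam(1)]]
      has_real_derivative_compose_affine[OF divergence_gap_derivs(2)[OF s1 lam(1)]]
      has_real_derivative_compose_affine[OF divergence_gap_derivs(3)[OF s1 lam(1)]]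
    show "((\<lambda>s. \<bar>lam - 1\<bar> / 3 * s ^ 3 + \<sigma> * divergence_gap lam (1 + 1 * s)) has_real_derivative
        \<bar>lam - 1\<bar> * s ^ 2 + \<sigma> * divergence_gap1 lam (1 + 1 * s)) (at s)"
      by (rule derivative_eq_intros refl d | simp)+
    show "((\<lambda>s. \<bar>lam - 1\<bar> * s ^ 2 + \<sigma> * divergence_gap1 lam (1 + 1 * s)) has_real_derivative
        2 * \<bar>lam - 1\<bar> * s + \<sigma> * (2 * (1 + 1 * s) powr (lam - 1) - 2)) (at s)"
      by (rule derivative_eq_intros refl d | simp)+
    show "((\<lambda>s. 2 * \<bar>lam - 1\<bar> * s + \<sigma> * (2 * (1 + 1 * s) powr (lam - 1) - 2)) has_real_derivative
        2 * \<bar>lam - 1\<bar> + \<sigma> * (2 * (lam - 1) * (1 + 1 * s) powr (lam - 2))) (at s)"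
      by (rule derivative_eq_intros refl d | simp)+
    have "(1 + 1 * s) powr (lam - 2) \<le> (1 + 1 * s) powr 0"
      using lam s by (intro powr_mono) auto
    then have "2 * \<bar>lam - 1\<bar> * (1 + 1 * s) powr (lam - 2) \<le> 2 * \<bar>lam - 1\<bar> * 1"
      using s by (intro mult_left_mono) auto
    moreover have "\<bar>\<sigma> * (2 * (lam - 1) * (1 + 1 * s) powr (lam - 2))\<bar> = 2 * \<bar>lam - 1\<bar> * (1 + 1 * s) powr (lam - 2)"
      using \<sigma> unfolding abs_mult by simp
    ultimately have "\<bar>\<sigma> * (2 * (lam - 1) * (1 + 1 * s) powr (lam - 2))\<bar> \<le> 2 * \<bar>lam - 1\<bar>"
      by linarith
    then show "0 \<le> 2 * \<bar>lam - 1\<bar> + \<sigma> * (2 * (lam - 1) * (1 + 1 * s) powr (lam - 2))" by linarith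
  qed (use x in auto)
  have "\<bar>divergence_gap lam x\<bar> \<le> \<bar>lam - 1\<bar> / 3 * (x - 1) ^ 3"
    using main[of 1] main[of "-1"] by simp
  also have "\<dots> \<le> \<bar>lam - 1\<bar> / (lam + 1) * (x - 1) ^ 3"
    using lam x by (intro mult_right_mono divide_left_mono) auto
  finally show ?thesis using x by simp
qed

text \<open>Below 1 the third derivative is unbounded, so the gap at \<open>1 - \<xi>\<close> is compared, along the
  segment from 1, with \<open>\<xi>\<^sup>3\<close> times the gap at 0.\<close>

lemma divergence_gap_le_below:
  assumes lam: "-1 < lam" "lam \<le> 2" and x: "0 \<le> x" "x < 1"
  shows "\<bar>divergence_gap lam x\<bar> \<le> \<bar>lam - 1\<bar> / (lam + 1) * \<bar>x - 1\<bar> ^ 3"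
proof (cases "x = 0")
  case True
  then show ?thesis using lam by (simp add: divergence_gap_at_0 abs_minus_commute)
next
  case False
  define \<xi> where "\<xi> = 1 - x"
  have \<xi>: "0 < \<xi>" "\<xi> < 1" using x False by (auto simp: \<xi>_def)
  \<comment> \<open>The sign that makes the gap at 0 equal to
    \<open>\<bar>lam - 1\<bar> / (lam + 1)\<close> and the third derivative of the majorant along
    the segment nonnegative.\<close>
  define \<tau> :: real where "\<tau> = (if lam \<ge> 1 then -1 else 1)"
  have \<tau>: "\<tau> * (lam - 1) = - \<bar>lam - 1\<bar>" by (simp add: \<tau>_def)
  have main: "0 \<le> \<xi> ^ 3 * (\<tau> * divergence_gap lam (1 + (-1) * t)) + \<sigma> * divergence_gap lam (1 + (-\<xi>) * t)"
    if \<sigma>: "\<bar>\<sigma>\<bar> = 1" and t: "0 \<le> t" "t < 1" for \<sigma> t :: real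
  proof (rule third_order_nonneg[where t = t and
        f = "\<lambda>s. \<xi> ^ 3 * (\<tau> * divergence_gap lam (1 + (-1) * s)) + \<sigma> * divergence_gap lam (1 + (-\<xi>) * s)" and
        ?f1.0 = "\<lambda>s. - (\<xi> ^ 3 * (\<tau> * divergence_gap1 lam (1 + (-1) * s)) + \<xi> * \<sigma> * divergence_gap1 lam (1 + (-\<xi>) * s))" and
        ?f2.0 = "\<lambda>s. \<xi> ^ 3 * (\<tau> * (2 * (1 + (-1) * s) powr (lam - 1) - 2)) + \<xi>^2 * \<sigma> * (2 * (1 + (-\<xi>) * s) powr (lam - 1) - 2)" and
        ?f3.0 = "\<lambda>s. - (\<xi> ^ 3 * (\<tau> * (2 * (lam - 1) * (1 + (-1) * s) powr (lam - 2))) + \<xi>^3 * \<sigma> * (2 * (lam - 1) * (1 + (-\<xi>) * s) powr (lam - 2)))"])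
    fix s :: real assume s: "0 \<le> s" "s \<le> t"
    have "\<xi> * s \<le> 1 * s" using \<xi> s by (intro mult_right_mono) auto
    then have s1: "1 + (-1) * s > 0" "1 + (-\<xi>) * s > 0" and le: "1 + (-1) * s \<le> 1 + (-\<xi>) * s"
      using s t by auto
    note d = has_real_derivative_compose_affine[OF divergence_gap_derivs(1)[OF s1(1) lam(1)]]
      has_real_derivative_compose_affine[OF divergence_gap_derivs(2)[OF s1(1) lam(1)]]
      has_real_derivative_compose_affine[OF divergence_gap_derivs(3)[OF s1(1) lam(1)]]
      has_real_derivative_compose_affine[OF divergence_gap_derivs(1)[OF s1(2) lam(1)]]
      has_real_derivative_compose_affine[OF divergence_gap_derivs(2)[OF s1(2) lam(1)]]
      has_real_derivative_compose_affine[OF divergence_gap_derivs(3)[OF s1(2) lam(1)]]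
    show "((\<lambda>s. \<xi> ^ 3 * (\<tau> * divergence_gap lam (1 + (-1) * s)) + \<sigma> * divergence_gap lam (1 + (-\<xi>) * s)) has_real_derivative
        - (\<xi> ^ 3 * (\<tau> * divergence_gap1 lam (1 + (-1) * s)) + \<xi> * \<sigma> * divergence_gap1 lam (1 + (-\<xi>) * s))) (at s)"
      by (rule DERIV_cong, rule DERIV_add[OF DERIV_cmult[OF DERIV_cmult[OF d(1)]] DERIV_cmult[OF d(4)]])
        (simp add: algebra_simps)
    show "((\<lambda>s. - (\<xi> ^ 3 * (\<tau> * divergence_gap1 lam (1 + (-1) * s)) + \<xi> * \<sigma> * divergence_gap1 lam (1 + (-\<xi>) * s))) has_real_derivative
        \<xi> ^ 3 * (\<tau> * (2 * (1 + (-1) * s) powr (lam - 1) - 2)) + \<xi>^2 * \<sigma> * (2 * (1 + (-\<xi>) * s) powr (lam - 1) - 2)) (at s)"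
      by (rule DERIV_cong, rule DERIV_minus[OF DERIV_add[OF DERIV_cmult[OF DERIV_cmult[OF d(2)]] DERIV_cmult[OF d(5)]]])
        (simp add: algebra_simps power2_eq_square)
    show "((\<lambda>s. \<xi> ^ 3 * (\<tau> * (2 * (1 + (-1) * s) powr (lam - 1) - 2)) + \<xi>^2 * \<sigma> * (2 * (1 + (-\<xi>) * s) powr (lam - 1) - 2)) has_real_derivative
        - (\<xi> ^ 3 * (\<tau> * (2 * (lam - 1) * (1 + (-1) * s) powr (lam - 2))) + \<xi>^3 * \<sigma> * (2 * (lam - 1) * (1 + (-\<xi>) * s) powr (lam - 2)))) (at s)"
      by (rule DERIV_cong, rule DERIV_add[OF DERIV_cmult[OF DERIV_cmult[OF d(3)]] DERIV_cmult[OF d(6)]])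
        (simp add: algebra_simps power2_eq_square power3_eq_cube)
    \<comment> \<open>Here \<open>lam \<le> 2\<close> enters: the power is decreasing, and the point
      on the shorter segment towards \<open>x\<close> lies to the right of that on the segment
      towards 0.\<close>
    have "(1 + (-\<xi>) * s) powr (lam - 2) \<le> (1 + (-1) * s) powr (lam - 2)"
      using lam le s1 by (intro powr_mono2') auto
    then have "\<bar>\<sigma> * (2 * (lam - 1) * (1 + (-\<xi>) * s) powr (lam - 2))\<bar> \<le> 2 * \<bar>lam - 1\<bar> * (1 + (-1) * s) powr (lam - 2)"
      using \<sigma> unfolding abs_mult by (simp add: mult_left_mono)
    moreover have "\<tau> * (2 * (lam - 1) * (1 + (-1) * s) powr (lam - 2)) = - (2 * \<bar>lam - 1\<bar> * (1 + (-1) * s) powr (lam - 2))"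
      by (simp add: \<tau>_def algebra_simps)
    ultimately have "\<tau> * (2 * (lam - 1) * (1 + (-1) * s) powr (lam - 2)) + \<sigma> * (2 * (lam - 1) * (1 + (-\<xi>) * s) powr (lam - 2)) \<le> 0"
      by linarith
    then have "\<xi> ^ 3 * (\<tau> * (2 * (lam - 1) * (1 + (-1) * s) powr (lam - 2)) + \<sigma> * (2 * (lam - 1) * (1 + (-\<xi>) * s) powr (lam - 2))) \<le> 0"
      using \<xi> by (intro mult_nonneg_nonpos) auto
    then show "0 \<le> - (\<xi> ^ 3 * (\<tau> * (2 * (lam - 1) * (1 + (-1) * s) powr (lam - 2))) + \<xi>^3 * \<sigma> * (2 * (lam - 1) * (1 + (-\<xi>) * s) powr (lam - 2)))"
      by (simp add: algebra_simps)
  qed (use t in auto)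
  have bound: "\<bar>divergence_gap lam (1 - \<xi> * (1 - v))\<bar> \<le> \<xi> ^ 3 * (\<tau> * divergence_gap lam v)"
    if "0 < v" "v \<le> 1" for v
    using main[of 1 "1 - v"] main[of "-1" "1 - v"] that by (simp add: abs_le_iff)
  \<comment> \<open>The derivatives are only available on the open half-line, so the segment reaches
    0 by a limit; the gap is continuous there because \<open>lam > -1\<close>.\<close>
  have "\<bar>divergence_gap lam x\<bar> \<le> \<xi> ^ 3 * (\<tau> * divergence_gap lam 0)"
  proof (rule tendsto_le[OF trivial_limit_at_right_real])
    show "((\<lambda>v. \<xi> ^ 3 * (\<tau> * divergence_gap lam v)) \<longlongrightarrow> \<xi> ^ 3 * (\<tau> * divergence_gap lam 0)) (at_right 0)"
      by (intro tendsto_intros divergence_gap_tendsto_0 lam)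
    have "x > 0" using x False by simp
    then have "isCont (divergence_gap lam) (1 - \<xi> * (1 - 0))"
      using DERIV_isCont[OF divergence_gap_derivs(1)[OF _ lam(1)]] by (simp add: \<xi>_def)
    moreover have "((\<lambda>v. 1 - \<xi> * (1 - v)) \<longlongrightarrow> 1 - \<xi> * (1 - 0)) (at_right 0)"
      by (intro tendsto_intros)
    ultimately have "((\<lambda>v. divergence_gap lam (1 - \<xi> * (1 - v))) \<longlongrightarrow> divergence_gap lam (1 - \<xi> * (1 - 0))) (at_right 0)"
      by (rule isCont_tendsto_compose)
    then show "((\<lambda>v. \<bar>divergence_gap lam (1 - \<xi> * (1 - v))\<bar>) \<longlongrightarrow> \<bar>divergence_gap lam x\<bar>) (at_right 0)"
      by (intro tendsto_rabs) (simp add: \<xi>_def)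
    have "\<forall>\<^sub>F v in at_right (0::real). v \<in> {0<..<1}" by (rule eventually_at_right_real) simp
    then show "\<forall>\<^sub>F v in at_right 0. \<bar>divergence_gap lam (1 - \<xi> * (1 - v))\<bar> \<le> \<xi> ^ 3 * (\<tau> * divergence_gap lam v)"
      by eventually_elim (auto intro: bound)
  qed
  also have "\<tau> * divergence_gap lam 0 = \<bar>lam - 1\<bar> / (lam + 1)"
    using lam by (simp add: divergence_gap_at_0 \<tau>_def)
  finally show ?thesis using x by (simp add: \<xi>_def mult.commute)
qed

text \<open>Below 1 the factor \<open>x powr (lam - 2)\<close> is at most 1 and the bound is cubic.
  Above 1, with \<open>s = x - 1\<close>, it is at most \<open>exp ((lam - 2) * s)\<close>, hence at
  most \<open>exp (2 * b * s)\<close>, and integrating three times produces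
  \<open>1 / (4 * b ^ 3)\<close>. Taking \<open>2 * b\<close> instead of \<open>b\<close> as the
  rate makes this factor eight times smaller at the price of a larger exponential moment.\<close>

lemma divergence_gap_le_gt_2:
  assumes lam: "lam > 2" and b: "lam - 2 \<le> b" and x: "x \<ge> 0"
  shows "\<bar>divergence_gap lam x\<bar> \<le> (lam - 1) * (\<bar>x - 1\<bar> ^ 3 / 3 + exp (2 * b * (x - 1)) / (4 * b ^ 3))"
proof -
  have lam1: "lam > -1" and b0: "b > 0" using lam b by auto
  show ?thesis
  proof (cases "x \<ge> 1")
    case True
    define E where "E s = (lam - 1) * (exp (2 * b * s) / (4 * b ^ 3))" for s
    \<comment> \<open>The choice \<open>\<kappa> = 1\<close>, \<open>\<sigma> = -1\<close> is the
      upper bound; \<open>\<kappa> = 0\<close>, \<open>\<sigma> = 1\<close> says that the gap is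
      nonnegative above 1.\<close>
    have main: "0 \<le> \<kappa> * E (x - 1) + \<sigma> * divergence_gap lam (1 + 1 * (x - 1))"
      if \<kappa>: "\<kappa> = 1 \<and> \<sigma> = -1 \<or> \<kappa> = 0 \<and> \<sigma> = 1" for \<kappa> \<sigma> :: real
    proof (rule third_order_nonneg[where t = "x - 1" and
          f = "\<lambda>s. \<kappa> * E s + \<sigma> * divergence_gap lam (1 + 1 * s)" and
          ?f1.0 = "\<lambda>s. \<kappa> * (2 * b * E s) + \<sigma> * divergence_gap1 lam (1 + 1 * s)" and
          ?f2.0 = "\<lambda>s. \<kappa> * (2 * b * (2 * b * E s)) + \<sigma> * (2 * (1 + 1 * s) powr (lam - 1) - 2)" and
          ?f3.0 = "\<lambda>s. \<kappa> * (2 * b * (2 * b * (2 * b * E s))) + \<sigma> * (2 * (lam - 1) * (1 + 1 * s) powr (lam - 2))"])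
      fix s :: real assume s: "0 \<le> s"
      then have s1: "1 + 1 * s > 0" by simp
      note d = has_real_derivative_compose_affine[OF divergence_gap_derivs(1)[OF s1 lam1]]
        has_real_derivative_compose_affine[OF divergence_gap_derivs(2)[OF s1 lam1]]
        has_real_derivative_compose_affine[OF divergence_gap_derivs(3)[OF s1 lam1]]
      have dE: "(E has_real_derivative 2 * b * E s) (at s)"
        unfolding E_def[abs_def] using b0 by (auto intro!: derivative_eq_intros simp: field_simps)
      show "((\<lambda>s. \<kappa> * E s + \<sigma> * divergence_gap lam (1 + 1 * s)) has_real_derivative
          \<kappa> * (2 * b * E s) + \<sigma> * divergence_gap1 lam (1 + 1 * s)) (at s)"
        by (rule DERIV_cong, rule DERIV_add[OF DERIV_cmult[OF dE] DERIV_cmult[OF d(1)]]) simp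
      show "((\<lambda>s. \<kappa> * (2 * b * E s) + \<sigma> * divergence_gap1 lam (1 + 1 * s)) has_real_derivative
          \<kappa> * (2 * b * (2 * b * E s)) + \<sigma> * (2 * (1 + 1 * s) powr (lam - 1) - 2)) (at s)"
        by (rule DERIV_cong, rule DERIV_add[OF DERIV_cmult[OF DERIV_cmult[OF dE]] DERIV_cmult[OF d(2)]]) simp
      show "((\<lambda>s. \<kappa> * (2 * b * (2 * b * E s)) + \<sigma> * (2 * (1 + 1 * s) powr (lam - 1) - 2)) has_real_derivative
          \<kappa> * (2 * b * (2 * b * (2 * b * E s))) + \<sigma> * (2 * (lam - 1) * (1 + 1 * s) powr (lam - 2))) (at s)"
        by (rule DERIV_cong, rule DERIV_add[OF DERIV_cmult[OF DERIV_cmult[OF DERIV_cmult[OF dE]]] DERIV_cmult[OF d(3)]]) simp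
      have "(1 + 1 * s) powr (lam - 2) = exp ((lam - 2) * ln (1 + s))"
        using s by (simp add: powr_def)
      also have "\<dots> \<le> exp ((2 * b) * s)"
        using lam b b0 s ln_add_one_self_le_self[OF s] by (simp only: exp_le_cancel_iff) (intro mult_mono, auto)
      finally have "2 * (lam - 1) * (1 + 1 * s) powr (lam - 2) \<le> 2 * (lam - 1) * exp ((2 * b) * s)"
        using lam by (intro mult_left_mono) auto
      also have "\<dots> = 2 * b * (2 * b * (2 * b * E s))"
        using b0 by (simp add: E_def power3_eq_cube)
      finally show "0 \<le> \<kappa> * (2 * b * (2 * b * (2 * b * E s))) + \<sigma> * (2 * (lam - 1) * (1 + 1 * s) powr (lam - 2))"
        using \<kappa> lam by auto
    next
      have "E 0 \<ge> 0" using lam b0 by (simp add: E_def)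
      then show "0 \<le> \<kappa> * E 0 + \<sigma> * divergence_gap lam (1 + 1 * 0)"
        "0 \<le> \<kappa> * (2 * b * E 0) + \<sigma> * divergence_gap1 lam (1 + 1 * 0)"
        "0 \<le> \<kappa> * (2 * b * (2 * b * E 0)) + \<sigma> * (2 * (1 + 1 * 0) powr (lam - 1) - 2)"
        using \<kappa> b0 by auto
    qed (use True in auto)
    have "\<bar>divergence_gap lam x\<bar> \<le> (lam - 1) * (exp (2 * b * (x - 1)) / (4 * b ^ 3))"
      using main[of 1 "-1"] main[of 0 1] by (simp add: E_def)
    also have "\<dots> \<le> (lam - 1) * (\<bar>x - 1\<bar> ^ 3 / 3 + exp (2 * b * (x - 1)) / (4 * b ^ 3))"
      using lam by (intro mult_left_mono) auto
    finally show ?thesis .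
  next
    case False
    have "\<bar>divergence_gap lam x\<bar> \<le> (lam - 1) * ((1 - x) ^ 3 / 3)"
    proof (cases "x = 0")
      case True
      have "\<bar>(1 - lam) / (lam + 1)\<bar> = (lam - 1) / (lam + 1)" using lam by simp
      also have "\<dots> \<le> (lam - 1) / 3" using lam by (intro divide_left_mono) auto
      finally have "\<bar>(1 - lam) / (lam + 1)\<bar> \<le> (lam - 1) / 3" .
      then show ?thesis using lam True by (simp add: divergence_gap_at_0)
    next
      case x0: False
      have main: "0 \<le> (lam - 1) * ((1 - x) ^ 3 / 3) + \<sigma> * divergence_gap lam (1 + (-1) * (1 - x))"
        if \<sigma>: "\<bar>\<sigma>\<bar> = 1" for \<sigma> :: real
      proof (rule third_order_nonneg[where t = "1 - x" and
            f = "\<lambda>s. (lam - 1) * (s ^ 3 / 3) + \<sigma> * divergence_gap lam (1 + (-1) * s)" and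
            ?f1.0 = "\<lambda>s. (lam - 1) * s ^ 2 - \<sigma> * divergence_gap1 lam (1 + (-1) * s)" and
            ?f2.0 = "\<lambda>s. 2 * (lam - 1) * s + \<sigma> * (2 * (1 + (-1) * s) powr (lam - 1) - 2)" and
            ?f3.0 = "\<lambda>s. 2 * (lam - 1) - \<sigma> * (2 * (lam - 1) * (1 + (-1) * s) powr (lam - 2))"])
        fix s :: real assume s: "0 \<le> s" "s \<le> 1 - x"
        then have s1: "1 + (-1) * s > 0" using x x0 by simp
        note d = has_real_derivative_compose_affine[OF divergence_gap_derivs(1)[OF s1 lam1]]
          has_real_derivative_compose_affine[OF divergence_gap_derivs(2)[OF s1 lam1]]
          has_real_derivative_compose_affine[OF divergence_gap_derivs(3)[OF s1 lam1]]
        have p: "((\<lambda>s::real. s ^ 3 / 3) has_real_derivative s ^ 2) (at s)"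
          "((\<lambda>s::real. s ^ 2) has_real_derivative 2 * s) (at s)"
          by (auto intro!: derivative_eq_intros)
        show "((\<lambda>s. (lam - 1) * (s ^ 3 / 3) + \<sigma> * divergence_gap lam (1 + (-1) * s)) has_real_derivative
            (lam - 1) * s ^ 2 - \<sigma> * divergence_gap1 lam (1 + (-1) * s)) (at s)"
          by (rule DERIV_cong, rule DERIV_add[OF DERIV_cmult[OF p(1)] DERIV_cmult[OF d(1)]]) simp
        show "((\<lambda>s. (lam - 1) * s ^ 2 - \<sigma> * divergence_gap1 lam (1 + (-1) * s)) has_real_derivative
            2 * (lam - 1) * s + \<sigma> * (2 * (1 + (-1) * s) powr (lam - 1) - 2)) (at s)"
          by (rule DERIV_cong, rule DERIV_diff[OF DERIV_cmult[OF p(2)] DERIV_cmult[OF d(2)]]) (simp add: algebra_simps)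
        show "((\<lambda>s. 2 * (lam - 1) * s + \<sigma> * (2 * (1 + (-1) * s) powr (lam - 1) - 2)) has_real_derivative
            2 * (lam - 1) - \<sigma> * (2 * (lam - 1) * (1 + (-1) * s) powr (lam - 2))) (at s)"
          by (rule DERIV_cong, rule DERIV_add[OF DERIV_cmult_Id DERIV_cmult[OF d(3)]]) simp
        have "(1 + (-1) * s) powr (lam - 2) \<le> 1"
          using lam s s1 by (intro powr_le1) auto
        then have "\<bar>\<sigma> * (2 * (lam - 1) * (1 + (-1) * s) powr (lam - 2))\<bar> \<le> 1 * (2 * (lam - 1) * 1)"
          using \<sigma> lam unfolding abs_mult by (intro mult_mono) auto
        then show "0 \<le> 2 * (lam - 1) - \<sigma> * (2 * (lam - 1) * (1 + (-1) * s) powr (lam - 2))"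
          by linarith
      qed (use False in auto)
      show ?thesis using main[of 1] main[of "-1"] by simp
    qed
    also have "\<dots> \<le> (lam - 1) * (\<bar>x - 1\<bar> ^ 3 / 3 + exp (2 * b * (x - 1)) / (4 * b ^ 3))"
      using lam b0 False by (intro mult_left_mono) (auto simp: abs_minus_commute)
    finally show ?thesis .
  qed
qed

text \<open>On this range \<open>exp\<close> is at most \<open>1.04\<close>; integrating twice gives
  half of that as coefficient.\<close>

lemma exp_minus_linear_le:
  fixes t :: real
  assumes t: "0 \<le> t" "t \<le> 1/50"
  shows "exp t - 1 - t \<le> 0.52 * t\<^sup>2"
proof -
  have e: "exp s \<le> 1.04" if s: "0 \<le> s" "s \<le> t" for s :: real
  proof -
    have "exp s \<le> 1 + s + s\<^sup>2" using exp_bound[of s] s t by simp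
    moreover have "s\<^sup>2 \<le> (1/50)\<^sup>2" using s t by (intro power_mono) auto
    ultimately show ?thesis using s t by (simp add: power2_eq_square)
  qed
  have 1: "exp s \<le> 1 + 1.04 * s" if s: "0 \<le> s" "s \<le> t" for s
  proof -
    have "(\<lambda>s. 1 + 1.04 * s - exp s) 0 \<le> (\<lambda>s. 1 + 1.04 * s - exp s) s"
    proof (rule DERIV_nonneg_imp_nondecreasing[OF s(1)])
      fix x :: real assume "0 \<le> x" "x \<le> s"
      then show "\<exists>y. ((\<lambda>s. 1 + 1.04 * s - exp s) has_real_derivative y) (at x) \<and> 0 \<le> y"
        using e[of x] s by (intro exI[of _ "1.04 - exp x"]) (auto intro!: derivative_eq_intros)
    qed
    then show ?thesis by simp
  qed
  have "(\<lambda>s. 0.52 * s\<^sup>2 + 1 + s - exp s) 0 \<le> (\<lambda>s. 0.52 * s\<^sup>2 + 1 + s - exp s) t"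
  proof (rule DERIV_nonneg_imp_nondecreasing[OF t(1)])
    fix x :: real assume "0 \<le> x" "x \<le> t"
    then show "\<exists>y. ((\<lambda>s. 0.52 * s\<^sup>2 + 1 + s - exp s) has_real_derivative y) (at x) \<and> 0 \<le> y"
      using 1[of x] by (intro exI[of _ "1.04 * x + 1 - exp x"]) (auto intro!: derivative_eq_intros)
  qed
  then show ?thesis by simp
qed

section \<open>Mean distance between the two statistics\<close>

context cell_probabilities
begin

lemma power_divergence_eq_pearson_add:
  assumes n: "n \<ge> 1" and lam: "lam > -1" and u: "(\<Sum>j=1..r. u j) = n"
  shows "power_divergence lam n r p u
    = pearson n u + (\<Sum>j=1..r. n * p j * divergence_gap lam (real (u j) / (n * p j)))"
proof -
  define x where "x j = real (u j) / (n * p j)" for j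
  have np: "real n * p j > 0" if "j \<in> {1..r}" for j using p_pos[OF that] n by simp
  have ux: "real (u j) = n * p j * x j" if "j \<in> {1..r}" for j using n p_pos[OF that] by (simp add: x_def)
  have x0: "x j \<ge> 0" if "j \<in> {1..r}" for j using np[OF that] by (simp add: x_def)
  have sum0: "(\<Sum>j=1..r. n * p j * (x j - 1)) = 0"
  proof -
    have "(\<Sum>j=1..r. n * p j * (x j - 1)) = (\<Sum>j=1..r. real (u j) - n * p j)"
      using ux by (intro sum.cong refl) (simp add: right_diff_distrib)
    then show ?thesis using u by (simp only: sum_deviation diff_self)
  qed
  have pearson: "pearson n u = (\<Sum>j=1..r. n * p j * (x j - 1)\<^sup>2)"
    unfolding pearson_def
  proof (intro sum.cong refl)
    fix j assume j: "j \<in> {1..r}"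
    have sq: "(cell_scale n j)\<^sup>2 = 1 / (n * p j)" using cell_scale_sq[OF n j] p_pos[OF j] n by (simp add: field_simps)
    show "(std_count n u j)\<^sup>2 = n * p j * (x j - 1)\<^sup>2"
      using n p_pos[OF j] unfolding std_count_def power_mult_distrib sq ux[OF j]
      by (simp add: power2_eq_square field_simps)
  qed
  show ?thesis
  proof (cases "lam = 0")
    case True
    have "power_divergence lam n r p u = 2 * (\<Sum>j=1..r. real (u j) * ln (x j))"
      using True by (simp add: power_divergence_def x_def)
    also have "\<dots> = (\<Sum>j=1..r. n * p j * (2 * (x j * ln (x j))))"
      unfolding sum_distrib_left by (intro sum.cong refl) (simp add: ux)
    also have "\<dots> = (\<Sum>j=1..r. n * p j * (x j - 1)\<^sup>2 + n * p j * divergence_gap lam (x j) + 2 * (n * p j * (x j - 1)))"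
      using True by (intro sum.cong refl) (simp add: divergence_gap_def algebra_simps)
    also have "\<dots> = pearson n u + (\<Sum>j=1..r. n * p j * divergence_gap lam (x j))"
      unfolding sum.distrib sum_distrib_left[symmetric] sum0 pearson by simp
    finally show ?thesis by (simp add: x_def)
  next
    case False
    define K where "K = 2 / (lam * (lam + 1))"
    have gap: "divergence_gap lam y = K * (y powr (lam + 1) - 1 - (lam + 1) * (y - 1)) - (y - 1)\<^sup>2" for y
      using False by (simp only: divergence_gap_def K_def if_False)
    have "power_divergence lam n r p u = K * (\<Sum>j=1..r. real (u j) * (x j powr lam - 1))"
      using False by (simp add: power_divergence_def K_def x_def)
    also have "\<dots> = K * (\<Sum>j=1..r. n * p j * (x j powr (lam + 1) - x j))"
    proof -
      have "real (u j) * (x j powr lam - 1) = n * p j * (x j powr (lam + 1) - x j)" if "j \<in> {1..r}" for j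
        using x0[OF that] unfolding ux[OF that] by (cases "x j = 0") (auto simp: powr_add algebra_simps)
      then show ?thesis by simp
    qed
    also have "\<dots> = (\<Sum>j=1..r. K * (n * p j * (x j powr (lam + 1) - x j)))"
      by (rule sum_distrib_left)
    also have "\<dots> = (\<Sum>j=1..r. n * p j * (x j - 1)\<^sup>2 + n * p j * divergence_gap lam (x j) + K * lam * (n * p j * (x j - 1)))"
      unfolding gap by (intro sum.cong refl) (simp add: algebra_simps)
    also have "\<dots> = pearson n u + (\<Sum>j=1..r. n * p j * divergence_gap lam (x j))"
      unfolding sum.distrib sum_distrib_left[symmetric] sum0 pearson by simp
    finally show ?thesis by (simp add: x_def)
  qed
qed

text \<open>With \<open>a = cell_scale n j\<close>, a cubic bound of the gap becomes
  \<open>a * d u ^ 3\<close> after multiplication by the expected count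
  \<open>1 / a\<^sup>2\<close>, so each cell costs \<open>O(\<delta>)\<close>. The factor
  \<open>2/3 * (4 * lam + 7)\<close> covers both regimes: it exceeds the \<open>2\<close> needed for
  \<open>lam \<le> 2\<close>, and divided by \<open>lam + 1\<close> it exceeds the
  \<open>8/3\<close> needed for \<open>lam > 2\<close>.\<close>

lemma mexp_power_divergence_diff:
  fixes \<delta> :: real
  assumes n: "n \<ge> 1" and lam: "lam > -1"
    and \<delta>: "\<And>j. j \<in> {1..r} \<Longrightarrow> cell_scale n j \<le> \<delta>" "\<delta> \<le> 1/72"
    and large: "\<And>j. lam \<ge> 2 \<Longrightarrow> j \<in> {1..r} \<Longrightarrow> n * p j \<ge> 2 * (lam - 2)\<^sup>2"
  shows "mexp n (\<lambda>u. \<bar>power_divergence lam n r p u - pearson n u\<bar>)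
    \<le> r * \<delta> * (2/3 * (\<bar>lam - 1\<bar> * (4 * lam + 7) / (lam + 1)))"
proof -
  define \<kappa> where "\<kappa> = 2/3 * (\<bar>lam - 1\<bar> * (4 * lam + 7) / (lam + 1))"
  have \<kappa>: "\<kappa> \<ge> 0" using lam by (simp add: \<kappa>_def)
  have cell: "mexp n (\<lambda>u. n * p j * \<bar>divergence_gap lam (real (u j) / (n * p j))\<bar>) \<le> \<delta> * \<kappa>"
    if j: "j \<in> {1..r}" for j
  proof -
    define a where "a = cell_scale n j"
    have a: "a > 0" "a \<le> \<delta>" "a \<le> 1/72" using cell_scale_pos[OF n j] \<delta>(1)[OF j] \<delta>(2) by (auto simp: a_def)
    have np: "real n * p j > 0" using p_pos[OF j] n by simp
    have a2: "n * p j = 1 / a\<^sup>2" using cell_scale_sq[OF n j] a by (simp add: a_def field_simps)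
    define d where "d u = a * \<bar>real (u j) - n * p j\<bar>" for u
    have d: "mexp n (\<lambda>u. d u ^ 3) \<le> 1751/1000"
      using scaled_deviation_moments(3)[OF j n, of n] a unfolding d_def[abs_def] a_def by auto
    have x1: "real (u j) / (n * p j) - 1 = a * (a * (real (u j) - n * p j))" for u
    proof -
      have "real (u j) / (n * p j) - 1 = (real (u j) - n * p j) / (n * p j)"
        using n p_pos[OF j] by (simp add: diff_divide_distrib)
      also have "\<dots> = a\<^sup>2 * (real (u j) - n * p j)" unfolding a2 by simp
      finally show ?thesis by (simp add: power2_eq_square)
    qed
    have x1_abs: "\<bar>real (u j) / (n * p j) - 1\<bar> = a * d u" for u
      unfolding x1 d_def using a by (simp add: abs_mult)
    have x_nonneg: "0 \<le> real (u j) / (n * p j)" for u using np by simp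
    have npd: "n * p j * (a * d u) ^ 3 = a * d u ^ 3" for u
      unfolding a2 using a by (simp add: power2_eq_square power3_eq_cube)
    show ?thesis
    proof (cases "lam \<le> 2")
      case True
      define K where "K = \<bar>lam - 1\<bar> / (lam + 1)"
      have K: "K \<ge> 0" using lam by (simp add: K_def)
      have "mexp n (\<lambda>u. n * p j * \<bar>divergence_gap lam (real (u j) / (n * p j))\<bar>) \<le> mexp n (\<lambda>u. K * a * d u ^ 3)"
      proof (rule mexp_mono)
        fix u
        have "\<bar>divergence_gap lam (real (u j) / (n * p j))\<bar> \<le> K * (a * d u) ^ 3"
          using divergence_gap_le_above[OF lam True] divergence_gap_le_below[OF lam True x_nonneg]
          unfolding K_def x1_abs[symmetric] by (cases "real (u j) / (n * p j) \<ge> 1") auto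
        then have "n * p j * \<bar>divergence_gap lam (real (u j) / (n * p j))\<bar> \<le> n * p j * (K * (a * d u) ^ 3)"
          using np by (intro mult_left_mono) auto
        also have "\<dots> = K * (n * p j * (a * d u) ^ 3)" by simp
        finally show "n * p j * \<bar>divergence_gap lam (real (u j) / (n * p j))\<bar> \<le> K * a * d u ^ 3"
          unfolding npd by simp
      qed
      also have "\<dots> = a * (K * mexp n (\<lambda>u. d u ^ 3))" by (simp only: mexp_cmult) simp
      also have "\<dots> \<le> \<delta> * (K * 2)"
        using a d K by (intro mult_mono mult_left_mono mult_nonneg_nonneg) (auto intro: order_trans mexp_mono[of n "\<lambda>_. 0", unfolded mexp_const] simp: d_def)
      also have "\<dots> \<le> \<delta> * \<kappa>"
      proof (rule mult_left_mono)
        have "K * 2 \<le> K * (2/3 * (4 * lam + 7))" using K lam by (intro mult_left_mono) auto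
        also have "\<dots> = \<kappa>" using lam unfolding K_def \<kappa>_def by (simp add: field_simps)
        finally show "K * 2 \<le> \<kappa>" .
      qed (use a in auto)
      finally show ?thesis .
    next
      case False
      then have lam2: "lam > 2" by simp
      \<comment> \<open>Since \<open>b\<^sup>2 = n * p j / 2\<close>, the hypothesis
        \<open>large\<close> is precisely \<open>lam - 2 \<le> b\<close>. The exponent
        \<open>2 * b * (x - 1)\<close> of the gap bound then equals \<theta> times the deviation of
        the count.\<close>
      define b where "b = 1 / (sqrt 2 * a)"
      have b0: "b > 0" using a by (simp add: b_def)
      have b: "lam - 2 \<le> b"
      proof (rule power2_le_imp_le)
        have "2 * (lam - 2)\<^sup>2 \<le> n * p j" using large[OF _ j] lam2 by simp
        then show "(lam - 2)\<^sup>2 \<le> b\<^sup>2" unfolding a2 b_def by (simp add: power_divide power_mult_distrib)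
      qed (use b0 in simp)
      define \<theta> where "\<theta> = sqrt 2 * a"
      have s2: "sqrt 2 \<le> 1.4143" by (rule real_le_lsqrt) (auto simp: power2_eq_square)
      have \<theta>: "0 \<le> \<theta>" "\<theta> \<le> 1/50"
      proof -
        have "sqrt 2 * a \<le> 1.4143 * (1/72)" using a s2 by (intro mult_mono) auto
        then show "\<theta> \<le> 1/50" by (simp add: \<theta>_def)
      qed (use a in \<open>simp add: \<theta>_def\<close>)
      have mgf: "mexp n (\<lambda>u. exp (\<theta> * (real (u j) - n * p j))) \<le> 2.92"
      proof -
        have "mexp n (\<lambda>u. exp (\<theta> * (real (u j) - n * p j))) \<le> exp (n * p j * (exp \<theta> - 1 - \<theta>))"
          by (rule mexp_exp_centered_le[OF j])
        also have "\<dots> \<le> exp (n * p j * (0.52 * \<theta>\<^sup>2))"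
          using exp_minus_linear_le[OF \<theta>] np by (simp only: exp_le_cancel_iff) (intro mult_left_mono, auto)
        \<comment> \<open>The scale cancels and leaves the absolute exponent \<open>1.04\<close>. It
          is cut into 16 pieces because \<open>exp x \<le> 1 + x + x\<^sup>2\<close> is sharp enough
          only for small \<open>x\<close>.\<close>
        also have "n * p j * (0.52 * \<theta>\<^sup>2) = 16 * 0.065"
          unfolding a2 \<theta>_def using a by (simp add: power_mult_distrib)
        also have "exp (16 * 0.065 :: real) = exp 0.065 ^ 16"
          using exp_of_nat_mult[of 16 "0.065::real"] by simp
        also have "\<dots> \<le> (1 + 0.065 + 0.065\<^sup>2) ^ 16"
          by (intro power_mono exp_bound) auto
        also have "\<dots> \<le> 2.92" by (simp add: power2_eq_square eval_nat_numeral)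
        finally show ?thesis .
      qed
      have "mexp n (\<lambda>u. n * p j * \<bar>divergence_gap lam (real (u j) / (n * p j))\<bar>)
          \<le> mexp n (\<lambda>u. (lam - 1) * a * (1/3 * d u ^ 3 + sqrt 2 / 2 * exp (\<theta> * (real (u j) - n * p j))))"
      proof (rule mexp_mono)
        fix u
        have e: "2 * b * (real (u j) / (n * p j) - 1) = \<theta> * (real (u j) - n * p j)"
          unfolding x1 b_def \<theta>_def using a by (simp add: field_simps)
        have q: "n * p j / (4 * b ^ 3) = a * (sqrt 2 / 2)"
          unfolding a2 b_def using a by (simp add: power2_eq_square power3_eq_cube)
        have "\<bar>divergence_gap lam (real (u j) / (n * p j))\<bar> \<le> (lam - 1) * ((a * d u) ^ 3 / 3 + exp (\<theta> * (real (u j) - n * p j)) / (4 * b ^ 3))"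
          using divergence_gap_le_gt_2[OF lam2 b x_nonneg[of u]] unfolding x1_abs e .
        then have "n * p j * \<bar>divergence_gap lam (real (u j) / (n * p j))\<bar> \<le>
            n * p j * ((lam - 1) * ((a * d u) ^ 3 / 3 + exp (\<theta> * (real (u j) - n * p j)) / (4 * b ^ 3)))"
          using np by (intro mult_left_mono) auto
        also have "\<dots> = (lam - 1) * (n * p j * (a * d u) ^ 3 / 3 + n * p j / (4 * b ^ 3) * exp (\<theta> * (real (u j) - n * p j)))"
          by (simp add: algebra_simps)
        also have "\<dots> = (lam - 1) * a * (1/3 * d u ^ 3 + sqrt 2 / 2 * exp (\<theta> * (real (u j) - n * p j)))"
          unfolding npd q by (simp add: algebra_simps)
        finally show "n * p j * \<bar>divergence_gap lam (real (u j) / (n * p j))\<bar> \<le>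
            (lam - 1) * a * (1/3 * d u ^ 3 + sqrt 2 / 2 * exp (\<theta> * (real (u j) - n * p j)))" .
      qed
      also have "\<dots> \<le> (lam - 1) * a * (8/3)"
        unfolding mexp_cmult mexp_add
      proof (intro mult_left_mono)
        have "sqrt 2 / 2 * mexp n (\<lambda>u. exp (\<theta> * (real (u j) - n * p j))) \<le> 0.70715 * 2.92"
          using mgf s2 mexp_mono[of n "\<lambda>_. 0" "\<lambda>u. exp (\<theta> * (real (u j) - n * p j))"]
          by (intro mult_mono) (auto simp: mexp_const)
        then show "1/3 * mexp n (\<lambda>u. d u ^ 3) + sqrt 2 / 2 * mexp n (\<lambda>u. exp (\<theta> * (real (u j) - n * p j))) \<le> 8/3"
          using d by simp
      qed (use lam2 a in auto)
      also have "\<dots> = a * ((lam - 1) * (8/3))" by simp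
      also have "\<dots> \<le> \<delta> * \<kappa>"
      proof (rule mult_mono)
        have "(lam - 1) * (8/3) = 2/3 * ((lam - 1) * (4 * (lam + 1)) / (lam + 1))" using lam2 by (simp add: field_simps)
        also have "\<dots> \<le> \<kappa>"
          unfolding \<kappa>_def using lam2 by (intro mult_left_mono divide_right_mono mult_mono) auto
        finally show "(lam - 1) * (8/3) \<le> \<kappa>" .
      qed (use a lam2 in auto)
      finally show ?thesis .
    qed
  qed
  have "mexp n (\<lambda>u. \<bar>power_divergence lam n r p u - pearson n u\<bar>)
      \<le> mexp n (\<lambda>u. \<Sum>j=1..r. n * p j * \<bar>divergence_gap lam (real (u j) / (n * p j))\<bar>)"
  proof (rule mexp_mono)
    fix u assume u: "(\<Sum>j=1..r. u j) = n"
    show "\<bar>power_divergence lam n r p u - pearson n u\<bar>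
        \<le> (\<Sum>j=1..r. n * p j * \<bar>divergence_gap lam (real (u j) / (n * p j))\<bar>)"
      unfolding power_divergence_eq_pearson_add[OF n lam u]
      using p_pos by (auto simp: abs_mult less_imp_le intro!: order_trans[OF sum_abs] sum_mono)
  qed
  also have "\<dots> = (\<Sum>j=1..r. mexp n (\<lambda>u. n * p j * \<bar>divergence_gap lam (real (u j) / (n * p j))\<bar>))"
    by (rule mexp_sum)
  also have "\<dots> \<le> (\<Sum>j=1..r. \<delta> * \<kappa>)"
    by (intro sum_mono cell)
  finally show ?thesis by (simp add: \<kappa>_def)
qed

text \<open>The link between the probability space and \<open>mexp\<close>. Every function of the
  counts factors through a vector with finitely many values, hence is measurable and bounded. The
  recursion conditions on the value of trial \<open>Suc k\<close>, which is independent of the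
  restriction of \<open>X\<close> to \<open>{1..k}\<close>.\<close>

lemma integral_observed_count:
  fixes M :: "'a measure" and X :: "nat \<Rightarrow> 'a \<Rightarrow> nat" and \<phi> :: "(nat \<Rightarrow> nat) \<Rightarrow> real"
  assumes M: "prob_space M"
    and indep: "prob_space.indep_vars M (\<lambda>_. count_space {1..r}) X {1..n}"
    and dist: "\<And>i j. i \<in> {1..n} \<Longrightarrow> j \<in> {1..r} \<Longrightarrow> measure M {\<omega> \<in> space M. X i \<omega> = j} = p j"
    and k: "k \<le> n"
  shows "(\<lambda>\<omega>. \<phi> (\<lambda>j. observed_count k X j \<omega>)) \<in> borel_measurable M"
    and "integrable M (\<lambda>\<omega>. \<phi> (\<lambda>j. observed_count k X j \<omega>))"
    and "(\<integral>\<omega>. \<phi> (\<lambda>j. observed_count k X j \<omega>) \<partial>M) = mexp k \<phi>"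
proof -
  interpret prob_space M by (rule M)
  have X_range: "X i \<omega> \<in> {1..r}" if "i \<in> {1..n}" "\<omega> \<in> space M" for i \<omega>
    using indep that unfolding indep_vars_def by (auto dest!: bspec measurable_space)
  define cnt where "cnt k v j = card {i \<in> {1..k}. v i = j}" for k :: nat and v :: "nat \<Rightarrow> nat" and j
  have cnt_eq: "(\<lambda>j. observed_count k X j \<omega>) = cnt k (\<lambda>i\<in>{1..k}. X i \<omega>)" for k \<omega>
    by (auto simp: cnt_def observed_count_def fun_eq_iff intro!: arg_cong[where f = card])
  have rest: "(\<lambda>\<omega>. \<lambda>i\<in>{1..k}. X i \<omega>) \<in> measurable M (PiM {1..k} (\<lambda>_. count_space {1..r}))" if "k \<le> n" for k
    using indep that unfolding indep_vars_def by (intro measurable_restrict) auto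
  have PiM_eq: "PiM {1..k} (\<lambda>_. count_space {1..r}) = count_space ({1..k} \<rightarrow>\<^sub>E {1..r})" for k :: nat
    by (rule count_space_PiM_finite) auto
  have meas: "(\<lambda>\<omega>. \<psi> (\<lambda>j. observed_count k X j \<omega>)) \<in> borel_measurable M" if "k \<le> n"
    for k and \<psi> :: "(nat \<Rightarrow> nat) \<Rightarrow> real"
    unfolding cnt_eq
    by (rule measurable_compose[OF rest[OF that], of "\<lambda>v. \<psi> (cnt k v)"]) (subst PiM_eq, simp)
  have int: "integrable M (\<lambda>\<omega>. \<psi> (\<lambda>j. observed_count k X j \<omega>))" if "k \<le> n"
    for k and \<psi> :: "(nat \<Rightarrow> nat) \<Rightarrow> real"
  proof -
    have fin: "finite ({1..k} \<rightarrow>\<^sub>E {1..r})" by (intro finite_PiE) auto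
    show ?thesis
    proof (rule integrable_const_bound)
      show "AE \<omega> in M. norm (\<psi> (\<lambda>j. observed_count k X j \<omega>)) \<le> Max ((\<lambda>v. \<bar>\<psi> (cnt k v)\<bar>) ` ({1..k} \<rightarrow>\<^sub>E {1..r}))"
      proof (rule AE_I2)
        fix \<omega> assume \<omega>: "\<omega> \<in> space M"
        have "(\<lambda>i\<in>{1..k}. X i \<omega>) \<in> {1..k} \<rightarrow>\<^sub>E {1..r}"
          using X_range[OF _ \<omega>] that by auto
        then show "norm (\<psi> (\<lambda>j. observed_count k X j \<omega>)) \<le> Max ((\<lambda>v. \<bar>\<psi> (cnt k v)\<bar>) ` ({1..k} \<rightarrow>\<^sub>E {1..r}))"
          unfolding cnt_eq using fin by (auto intro!: Max_ge)
      qed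
    qed (rule meas[OF that])
  qed
  show "(\<lambda>\<omega>. \<phi> (\<lambda>j. observed_count k X j \<omega>)) \<in> borel_measurable M"
    "integrable M (\<lambda>\<omega>. \<phi> (\<lambda>j. observed_count k X j \<omega>))"
    using meas[OF k] int[OF k] by blast+
  show "(\<integral>\<omega>. \<phi> (\<lambda>j. observed_count k X j \<omega>) \<partial>M) = mexp k \<phi>"
    using k
  proof (induction k arbitrary: \<phi>)
    case 0
    have "(\<lambda>j. observed_count 0 X j \<omega>) = (\<lambda>_. 0)" for \<omega> by (simp add: observed_count_def fun_eq_iff)
    then show ?case by (simp add: prob_space)
  next
    case (Suc k)
    then have k: "k \<le> n" and Sk: "Suc k \<in> {1..n}" by auto
    have step: "(\<lambda>j. observed_count (Suc k) X j \<omega>) = inc (X (Suc k) \<omega>) (\<lambda>j. observed_count k X j \<omega>)" for \<omega>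
    proof
      fix j
      have "{i \<in> {1..Suc k}. X i \<omega> = j} = {i \<in> {1..k}. X i \<omega> = j} \<union> (if X (Suc k) \<omega> = j then {Suc k} else {})"
        by (auto simp: le_Suc_eq)
      then show "observed_count (Suc k) X j \<omega> = inc (X (Suc k) \<omega>) (\<lambda>j. observed_count k X j \<omega>) j"
        by (simp add: observed_count_def inc_apply)
    qed
    have ind: "indep_var borel (\<lambda>\<omega>. indicator {j} (X (Suc k) \<omega>) :: real)
        borel (\<lambda>\<omega>. \<phi> (inc j (\<lambda>i. observed_count k X i \<omega>)))" for j
    proof -
      have "indep_var (PiM {Suc k} (\<lambda>_. count_space {1..r})) (\<lambda>\<omega>. restrict (\<lambda>i. X i \<omega>) {Suc k})
          (PiM {1..k} (\<lambda>_. count_space {1..r})) (\<lambda>\<omega>. restrict (\<lambda>i. X i \<omega>) {1..k})"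
        using k Sk by (intro indep_var_restrict[OF indep]) auto
      then have "indep_var borel ((\<lambda>v. indicator {j} (v (Suc k)) :: real) \<circ> (\<lambda>\<omega>. restrict (\<lambda>i. X i \<omega>) {Suc k}))
          borel ((\<lambda>v. \<phi> (inc j (cnt k v))) \<circ> (\<lambda>\<omega>. restrict (\<lambda>i. X i \<omega>) {1..k}))"
      proof (rule indep_var_compose)
        show "(\<lambda>v. indicator {j} (v (Suc k)) :: real) \<in> borel_measurable (PiM {Suc k} (\<lambda>_. count_space {1..r}))"
          by (subst count_space_PiM_finite) auto
      qed (subst PiM_eq, simp)
      then show ?thesis by (simp add: o_def cnt_eq)
    qed
    have Xmeas: "X (Suc k) \<in> measurable M (count_space {1..r})"
      using indep Sk unfolding indep_vars_def by auto
    have set: "{\<omega> \<in> space M. X (Suc k) \<omega> = j} \<in> events" if "j \<in> {1..r}" for j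
    proof -
      have "X (Suc k) -` {j} \<inter> space M \<in> events" using Xmeas that by (intro measurable_sets) auto
      then show ?thesis by (simp add: vimage_def Int_def conj_commute)
    qed
    have indint: "integrable M (\<lambda>\<omega>. indicator {j} (X (Suc k) \<omega>) :: real)" for j
      by (rule integrable_const_bound[where B = 1]) (use Xmeas in \<open>auto intro!: measurable_compose[OF Xmeas]\<close>)
    have indval: "(\<integral>\<omega>. indicator {j} (X (Suc k) \<omega>) \<partial>M) = p j" if j: "j \<in> {1..r}" for j
    proof -
      have "(\<integral>\<omega>. indicator {j} (X (Suc k) \<omega>) \<partial>M) = (\<integral>\<omega>. indicator {\<omega> \<in> space M. X (Suc k) \<omega> = j} \<omega> \<partial>M :: real)"
        by (intro Bochner_Integration.integral_cong) (auto simp: indicator_def)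
      also have "\<dots> = p j" using dist[OF Sk j] set[OF j] by simp
      finally show ?thesis .
    qed
    have "(\<integral>\<omega>. \<phi> (\<lambda>j. observed_count (Suc k) X j \<omega>) \<partial>M) =
        (\<integral>\<omega>. (\<Sum>j=1..r. indicator {j} (X (Suc k) \<omega>) * \<phi> (inc j (\<lambda>i. observed_count k X i \<omega>))) \<partial>M)"
    proof (rule Bochner_Integration.integral_cong[OF refl])
      fix \<omega> assume "\<omega> \<in> space M"
      then have "X (Suc k) \<omega> \<in> {1..r}" using X_range[OF Sk] by blast
      then show "\<phi> (\<lambda>j. observed_count (Suc k) X j \<omega>) =
          (\<Sum>j=1..r. indicator {j} (X (Suc k) \<omega>) * \<phi> (inc j (\<lambda>i. observed_count k X i \<omega>)))"
        unfolding step by (subst sum.remove[of _ "X (Suc k) \<omega>"]) (auto simp: indicator_def intro!: sum.neutral)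
    qed
    also have "\<dots> = (\<Sum>j=1..r. \<integral>\<omega>. indicator {j} (X (Suc k) \<omega>) * \<phi> (inc j (\<lambda>i. observed_count k X i \<omega>)) \<partial>M)"
      by (intro Bochner_Integration.integral_sum indep_var_integrable ind indint int[OF k])
    also have "\<dots> = (\<Sum>j=1..r. p j * mexp k (\<lambda>u. \<phi> (inc j u)))"
    proof (rule sum.cong[OF refl])
      fix j assume j: "j \<in> {1..r}"
      show "(\<integral>\<omega>. indicator {j} (X (Suc k) \<omega>) * \<phi> (inc j (\<lambda>i. observed_count k X i \<omega>)) \<partial>M) = p j * mexp k (\<lambda>u. \<phi> (inc j u))"
        using indep_var_lebesgue_integral[OF ind indint int[OF k]] indval[OF j] Suc.IH[OF k, of "\<lambda>u. \<phi> (inc j u)"] by simp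
    qed
    finally show ?case by simp
  qed
qed

end

section \<open>Smoothed indicators and chi-square probabilities of short intervals\<close>

text \<open>At the seam, the left difference quotient is that of \<open>f\<close> and the right one
  that of \<open>g\<close>; both tend to the same \<open>d a\<close>.\<close>

lemma has_real_derivative_If_le:
  fixes f g d :: "real \<Rightarrow> real"
  assumes f: "x \<le> a \<Longrightarrow> (f has_real_derivative d x) (at x)"
    and g: "a \<le> x \<Longrightarrow> (g has_real_derivative d x) (at x)" and eq: "f a = g a"
  shows "((\<lambda>x. if x \<le> a then f x else g x) has_real_derivative d x) (at x)"
proof -
  consider "x < a" | "x > a" | "x = a" by linarith
  then show ?thesis
  proof cases
    case 1
    then show ?thesis
      by (intro has_field_derivative_transform_within_open[OF f, of "{..<a}"]) auto
  next
    case 2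
    then show ?thesis
      by (intro has_field_derivative_transform_within_open[OF g, of "{a<..}"]) auto
  next
    case 3
    have "((\<lambda>y. ((if y \<le> a then f y else g y) - f a) / (y - a)) \<longlongrightarrow> d a) (at_left a)"
    proof (rule Lim_transform_eventually)
      show "((\<lambda>y. (f y - f a) / (y - a)) \<longlongrightarrow> d a) (at_left a)"
        using f 3 by (auto simp: has_field_derivative_iff filterlim_at_split)
      show "\<forall>\<^sub>F y in at_left a. (f y - f a) / (y - a) = ((if y \<le> a then f y else g y) - f a) / (y - a)"
        by (auto simp: eventually_at_filter)
    qed
    moreover have "((\<lambda>y. ((if y \<le> a then f y else g y) - f a) / (y - a)) \<longlongrightarrow> d a) (at_right a)"
    proof (rule Lim_transform_eventually)
      show "((\<lambda>y. (g y - g a) / (y - a)) \<longlongrightarrow> d a) (at_right a)"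
        using g 3 by (auto simp: has_field_derivative_iff filterlim_at_split)
      show "\<forall>\<^sub>F y in at_right a. (g y - g a) / (y - a) = ((if y \<le> a then f y else g y) - f a) / (y - a)"
        using eq by (auto simp: eventually_at_filter)
    qed
    ultimately show ?thesis using 3 by (simp add: has_field_derivative_iff filterlim_at_split)
  qed
qed

text \<open>The quintic descending from 1 to 0 whose first two derivatives vanish at both ends, so
  that the glued function has the second derivative required by
  \<open>stein_factor_bounds\<close>.\<close>

definition smooth_step :: "real \<Rightarrow> real" where
  "smooth_step t = (if t \<le> 0 then 1 else if t \<le> 1 then 1 - 10 * t ^ 3 + 15 * t ^ 4 - 6 * t ^ 5 else 0)"

definition smooth_step1 :: "real \<Rightarrow> real" where
  "smooth_step1 t = (if t \<le> 0 then 0 else if t \<le> 1 then - 30 * (t * (1 - t))\<^sup>2 else 0)"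

definition smooth_step2 :: "real \<Rightarrow> real" where
  "smooth_step2 t = (if t \<le> 0 then 0 else if t \<le> 1 then - 60 * (t * (1 - t)) * (1 - 2 * t) else 0)"

lemma smooth_step_deriv: "(smooth_step has_real_derivative smooth_step1 t) (at t)"
proof -
  have P: "((\<lambda>t. 1 - 10 * t ^ 3 + 15 * t ^ 4 - 6 * t ^ 5) has_real_derivative - 30 * (t * (1 - t))\<^sup>2) (at t)" for t :: real
    by (auto intro!: derivative_eq_intros simp: algebra_simps eval_nat_numeral)
  show ?thesis
    unfolding smooth_step_def[abs_def]
  proof (rule has_real_derivative_If_le)
    show "((\<lambda>t. if t \<le> 1 then 1 - 10 * t ^ 3 + 15 * t ^ 4 - 6 * t ^ 5 else 0) has_real_derivative smooth_step1 t) (at t)"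
      if "0 \<le> t"
      by (rule has_real_derivative_If_le) (use that P[of t] in \<open>auto simp: smooth_step1_def split: if_splits\<close>)
  qed (auto simp: smooth_step1_def)
qed

lemma smooth_step1_deriv: "(smooth_step1 has_real_derivative smooth_step2 t) (at t)"
proof -
  have P: "((\<lambda>t. - 30 * (t * (1 - t))\<^sup>2) has_real_derivative - 60 * (t * (1 - t)) * (1 - 2 * t)) (at t)" for t :: real
    by (auto intro!: derivative_eq_intros simp: algebra_simps eval_nat_numeral)
  show ?thesis
    unfolding smooth_step1_def[abs_def]
  proof (rule has_real_derivative_If_le)
    show "((\<lambda>t. if t \<le> 1 then - 30 * (t * (1 - t))\<^sup>2 else 0) has_real_derivative smooth_step2 t) (at t)"
      if "0 \<le> t"
      by (rule has_real_derivative_If_le) (use that P[of t] in \<open>auto simp: smooth_step2_def split: if_splits\<close>)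
  qed (auto simp: smooth_step2_def)
qed

lemma smooth_step_bounds: "0 \<le> smooth_step t" "smooth_step t \<le> 1"
proof -
  have *: "0 \<le> 1 - 10 * t ^ 3 + 15 * t ^ 4 - 6 * t ^ 5" "1 - 10 * t ^ 3 + 15 * t ^ 4 - 6 * t ^ 5 \<le> 1"
    if "0 \<le> t" "t \<le> 1"
  proof -
    have "1 - 10 * t ^ 3 + 15 * t ^ 4 - 6 * t ^ 5 = (1 - t) ^ 3 * (1 + 3 * t + 6 * t\<^sup>2)"
      by (simp add: algebra_simps eval_nat_numeral)
    then show "0 \<le> 1 - 10 * t ^ 3 + 15 * t ^ 4 - 6 * t ^ 5" using that by simp
    have eq: "1 - (1 - 10 * t ^ 3 + 15 * t ^ 4 - 6 * t ^ 5) = t ^ 3 * (6 * (t - 5/4)\<^sup>2 + 5/8)"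
      by (simp add: algebra_simps eval_nat_numeral)
    have "0 \<le> 1 - (1 - 10 * t ^ 3 + 15 * t ^ 4 - 6 * t ^ 5)" unfolding eq using that by simp
    then show "1 - 10 * t ^ 3 + 15 * t ^ 4 - 6 * t ^ 5 \<le> 1" by (simp only: diff_ge_0_iff_ge)
  qed
  then show "0 \<le> smooth_step t" "smooth_step t \<le> 1" by (auto simp: smooth_step_def)
qed

lemma smooth_step_deriv_bounds: "\<bar>smooth_step1 t\<bar> \<le> 15/8" "\<bar>smooth_step2 t\<bar> \<le> 15"
proof -
  have *: "\<bar>30 * (t * (1 - t))\<^sup>2\<bar> \<le> 15/8" "\<bar>60 * (t * (1 - t)) * (1 - 2 * t)\<bar> \<le> 15"
    if "0 \<le> t" "t \<le> 1"
  proof -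
    define q where "q = t * (1 - t)"
    have q: "0 \<le> q" "q \<le> 1/4"
      using that zero_le_power2[of "t - 1/2"] by (simp_all add: q_def power2_eq_square algebra_simps mult_left_le)
    then have "q\<^sup>2 \<le> (1/4)\<^sup>2" by (intro power_mono)
    then show "\<bar>30 * (t * (1 - t))\<^sup>2\<bar> \<le> 15/8" unfolding q_def[symmetric] by (simp add: power2_eq_square)
    have "\<bar>q\<bar> * \<bar>1 - 2 * t\<bar> \<le> 1/4 * 1" using q that by (intro mult_mono) auto
    then show "\<bar>60 * (t * (1 - t)) * (1 - 2 * t)\<bar> \<le> 15" unfolding q_def[symmetric] by (simp add: abs_mult)
  qed
  then show "\<bar>smooth_step1 t\<bar> \<le> 15/8" "\<bar>smooth_step2 t\<bar> \<le> 15"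
    by (auto simp: smooth_step1_def smooth_step2_def)
qed

section \<open>Bounds of the chi-square densities\<close>

lemma chi_square_density_1_le:
  assumes "x > 0"
  shows "chi_square_density 1 x \<le> 1 / sqrt (2 * pi) * (1 / sqrt x)"
proof -
  have eq: "x powr - (1/2) = 1 / sqrt x"
    using assms by (simp add: powr_minus_divide powr_half_sqrt)
  have "1 / sqrt x * exp (- x / 2) \<le> 1 / sqrt x * 1"
    using assms by (intro mult_left_mono) auto
  then have "1 / sqrt x * exp (- x / 2) / (sqrt 2 * sqrt pi) \<le> 1 / sqrt x / (sqrt 2 * sqrt pi)"
    by (intro divide_right_mono) auto
  then show ?thesis
    using assms by (simp add: chi_square_density_def Gamma_one_half_real powr_half_sqrt real_sqrt_mult eq mult_ac)
qed

lemma chi_square_density_2_le: "chi_square_density 2 x \<le> 1/2"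
  by (simp add: chi_square_density_def)

text \<open>The density at its mode \<open>m - 2 = 2 k\<close> is \<open>stirling_ratio k / (2 sqrt k)\<close>. By Stirling's formula the
  ratio increases to \<open>1 / sqrt (2 pi)\<close>, about 0.399; a cruder bound is enough here.\<close>

definition stirling_ratio :: "real \<Rightarrow> real" where
  "stirling_ratio k = k powr (k + 1/2) * exp (- k) / Gamma (k + 1)"

lemma pos_notin_nonpos_Ints: "(x::real) > 0 \<Longrightarrow> x \<notin> \<int>\<^sub>\<le>\<^sub>0"
  by (auto elim!: nonpos_Ints_cases)

text \<open>The trapezoidal rule overestimates the integral of the convex \<open>1 / x\<close> over
  \<open>[k, k + 1]\<close>. Multiplied by \<open>k + 1/2\<close>, its value is
  \<open>1 + 1 / (4 k) - 1 / (4 (k + 1))\<close>; the excess over 1 telescopes, so the corrected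
  ratio decreases along steps of 1.\<close>

lemma stirling_ratio_step:
  assumes k: "k > 0"
  shows "stirling_ratio (k + 1) * exp (1 / (4 * (k + 1))) \<le> stirling_ratio k * exp (1 / (4 * k))"
proof -
  have G: "Gamma (k + 1) > 0" using k by (intro Gamma_real_pos) simp
  have "(k + 1/2) * (ln (k + 1) - ln k) \<le> (k + 1/2) * (1 * (inverse k + inverse (k + 1)) / 2)"
    using k ln_inverse_approx_le[of k 1] by (intro mult_left_mono) auto
  also have "\<dots> = 1 + 1 / (4 * k) - 1 / (4 * (k + 1))"
    using k by (simp add: divide_simps) (simp add: algebra_simps)
  finally have le: "(k + 1/2) * ln (k + 1) - (k + 1) + 1 / (4 * (k + 1)) \<le> (k + 1/2) * ln k - k + 1 / (4 * k)"
    by (simp add: algebra_simps)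
  have G2: "Gamma (k + 1 + 1) = (k + 1) * Gamma (k + 1)"
    using k by (intro Gamma_plus1 pos_notin_nonpos_Ints) simp
  have P: "(k + 1) powr (k + 1 + 1/2) = (k + 1) * (k + 1) powr (k + 1/2)"
    using k powr_add[of "k + 1" "k + 1/2" 1] by (simp add: add_ac mult.commute)
  have "stirling_ratio (k + 1) * exp (1 / (4 * (k + 1)))
      = (k + 1) powr (k + 1/2) * exp (- (k + 1)) * exp (1 / (4 * (k + 1))) / Gamma (k + 1)"
    unfolding stirling_ratio_def G2 P using k G by simp
  also have "\<dots> = exp ((k + 1/2) * ln (k + 1) - (k + 1) + 1 / (4 * (k + 1))) / Gamma (k + 1)"
    using k by (simp add: powr_def flip: exp_add)
  also have "\<dots> \<le> exp ((k + 1/2) * ln k - k + 1 / (4 * k)) / Gamma (k + 1)"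
    using le G by (intro divide_right_mono) auto
  also have "\<dots> = stirling_ratio k * exp (1 / (4 * k))"
  proof -
    have "exp ((k + 1/2) * ln k - k + 1 / (4 * k)) = exp ((k + 1/2) * ln k) * exp (- k) * exp (1 / (4 * k))"
      by (simp only: exp_add[symmetric]) simp
    then show ?thesis using k by (simp add: stirling_ratio_def powr_def)
  qed
  finally show ?thesis .
qed

lemma stirling_ratio_add_le:
  assumes k: "k > 0"
  shows "stirling_ratio (k + real i) \<le> stirling_ratio k * exp (1 / (4 * k))"
proof -
  have "stirling_ratio (k + real i) * exp (1 / (4 * (k + real i))) \<le> stirling_ratio k * exp (1 / (4 * k))"
  proof (induction i)
    case (Suc i)
    then show ?case using stirling_ratio_step[of "k + real i"] k by (simp add: add_ac)
  qed simp
  moreover have "stirling_ratio (k + real i) * 1 \<le> stirling_ratio (k + real i) * exp (1 / (4 * (k + real i)))"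
    using k by (intro mult_left_mono) (auto simp: stirling_ratio_def Gamma_real_pos less_imp_le)
  ultimately show ?thesis by simp
qed

text \<open>The arguments are half-integers and integers. At \<open>1/2\<close> and \<open>1\<close>
  the correction \<open>exp (1 / (4 * k))\<close> would push the value above \<open>0.47\<close>, so
  these are computed directly; \<open>3/2\<close> and \<open>2\<close> start the two decreasing
  sequences.\<close>

lemma stirling_ratio_le:
  assumes m: "m \<ge> 3"
  shows "stirling_ratio (real m / 2 - 1) \<le> 0.47"
proof -
  have sp: "sqrt pi \<ge> 1.73"
  proof (rule real_le_rsqrt)
    \<comment> \<open>The elementary bound \<open>pi \<ge> 3\<close>, from
      \<open>sin x \<le> x\<close> at 30 degrees.\<close>
    have "1/2 \<le> pi / 6" using sin_x_le_x[of "pi / 6"] by (simp add: sin_30)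
    then show "1.73\<^sup>2 \<le> pi" by (simp add: power2_eq_square)
  qed
  have G32: "Gamma (3/2 :: real) = sqrt pi / 2"
    using Gamma_plus1[OF pos_notin_nonpos_Ints, of "1/2"] by (simp add: Gamma_one_half_real)
  have G52: "Gamma (5/2 :: real) = 3/4 * sqrt pi"
    using Gamma_plus1[OF pos_notin_nonpos_Ints, of "3/2"] by (simp add: G32)
  have s1: "stirling_ratio (1/2) \<le> 0.47"
  proof -
    have "exp (1/2 :: real) \<ge> 1 + 1/2" by (rule exp_ge_add_one_self)
    then have "1.5 * 1.73 \<le> exp (1/2) * sqrt pi" using sp by (intro mult_mono) auto
    then have "1 / (exp (1/2) * sqrt pi) \<le> 1 / (1.5 * 1.73)" by (intro divide_left_mono) auto
    then show ?thesis by (simp add: stirling_ratio_def G32 exp_minus field_simps)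
  qed
  have s2: "stirling_ratio 1 \<le> 0.47"
  proof -
    have "exp (1 :: real) \<ge> 1 + 1 + 1\<^sup>2 / 2" by (rule exp_lower_Taylor_quadratic) simp
    then have "1 / exp (1::real) \<le> 1 / 2.5" by (intro divide_left_mono) auto
    moreover have "Gamma (2 :: real) = 1" using Gamma_plus1[OF pos_notin_nonpos_Ints, of 1] by simp
    ultimately show ?thesis by (simp add: stirling_ratio_def exp_minus field_simps)
  qed
  have s3: "stirling_ratio (3/2) * exp (1 / (4 * (3/2))) \<le> 0.47"
  proof -
    have "(1 + 1/3 + (1/3)\<^sup>2 / 2) ^ 4 \<le> exp (1/3 :: real) ^ 4"
      by (intro power_mono exp_lower_Taylor_quadratic) auto
    also have "\<dots> = exp (4/3)" using exp_of_nat_mult[of 4 "1/3 :: real"] by simp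
    finally have "3.72 \<le> exp (4/3 :: real)" by (simp add: power2_eq_square eval_nat_numeral)
    then have "3.72 * 1.73 \<le> exp (4/3) * sqrt pi" using sp by (intro mult_mono) auto
    then have "3 / (exp (4/3) * sqrt pi) \<le> 3 / (3.72 * 1.73)" by (intro divide_left_mono) auto
    moreover have "stirling_ratio (3/2) * exp (1 / (4 * (3/2))) = 3 / (exp (4/3) * sqrt pi)"
    proof -
      have "exp (- (3/2)) * exp (1 / (4 * (3/2))) = exp (- (4/3) :: real)" by (simp flip: exp_add)
      moreover have "(3/2::real) powr (3/2 + 1/2) = 9/4"
        by (simp add: power2_eq_square powr_numeral)
      ultimately show ?thesis
        by (simp add: stirling_ratio_def G52 exp_minus field_simps)
    qed
    ultimately show ?thesis by simp
  qed
  have s4: "stirling_ratio 2 * exp (1 / (4 * 2)) \<le> 0.47"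
  proof -
    have "(1 + 15/32 + (15/32)\<^sup>2 / 2) ^ 4 \<le> exp (15/32 :: real) ^ 4"
      by (intro power_mono exp_lower_Taylor_quadratic) auto
    also have "\<dots> = exp (15/8)" using exp_of_nat_mult[of 4 "15/32 :: real"] by simp
    finally have e: "6.2 \<le> exp (15/8 :: real)" by (simp add: power2_eq_square eval_nat_numeral)
    have s2: "sqrt 2 \<le> 1.4143" by (rule real_le_lsqrt) (auto simp: power2_eq_square)
    have "2 * sqrt 2 / exp (15/8) \<le> 2 * 1.4143 / 6.2" using e s2 by (intro frac_le mult_left_mono) auto
    moreover have "stirling_ratio 2 * exp (1 / (4 * 2)) = 2 * sqrt 2 / exp (15/8)"
    proof -
      have "exp (- 2) * exp (1 / (4 * 2)) = exp (- (15/8) :: real)" by (simp flip: exp_add)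
      moreover have "(2::real) powr (2 + 1/2) = 4 * sqrt 2"
        by (subst powr_add) (simp add: powr_half_sqrt)
      moreover have "Gamma (2 + 1 :: real) = 2"
        using Gamma_fact[of 2, where 'a = real] by (simp add: add_ac)
      ultimately show ?thesis
        by (simp add: stirling_ratio_def exp_minus field_simps)
    qed
    ultimately show ?thesis by simp
  qed
  consider "m = 3" | "m = 4" | i where "m = 5 + 2 * i" | i where "m = 6 + 2 * i"
  proof -
    have "m = 3 \<or> m = 4 \<or> m = 5 + 2 * ((m - 5) div 2) \<or> m = 6 + 2 * ((m - 6) div 2)" using m by presburger
    then show thesis using that by blast
  qed
  then show ?thesis
  proof cases
    case (3 i)
    have "stirling_ratio (3/2 + real i) \<le> stirling_ratio (3/2) * exp (1 / (4 * (3/2)))"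
      by (rule stirling_ratio_add_le) simp
    moreover have "real m / 2 - 1 = 3/2 + real i" using 3 by (simp add: add_divide_distrib)
    ultimately show ?thesis using s3 by (simp only:)
  next
    case (4 i)
    have "stirling_ratio (2 + real i) \<le> stirling_ratio 2 * exp (1 / (4 * 2))"
      by (rule stirling_ratio_add_le) simp
    moreover have "real m / 2 - 1 = 2 + real i" using 4 by (simp add: add_divide_distrib)
    ultimately show ?thesis using s4 by (simp only:)
  qed (use s1 s2 in simp_all)
qed

text \<open>Applying \<open>ln y \<le> y - 1\<close> to the ratio \<open>y\<close> of
  \<open>x\<close> to the mode \<open>2 k\<close> reduces everything to the value at the mode;
  \<open>0.335\<close> rounds up \<open>0.47 * sqrt 2 / 2\<close>.\<close>

lemma chi_square_density_le:
  assumes m: "m \<ge> 3"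
  shows "chi_square_density m x \<le> 0.335 / sqrt (real m - 2)"
proof (cases "x > 0")
  case True
  define k where "k = real m / 2 - 1"
  have k: "k > 0" using m by (simp add: k_def)
  have G: "Gamma (k + 1) > 0" using k by (intro Gamma_real_pos) simp
  have "k * ln x - x / 2 \<le> k * ln (2 * k) - k"
  proof -
    have "ln (x / (2 * k)) \<le> x / (2 * k) - 1" using True k by (intro ln_le_minus_one) simp
    then have "k * ln (x / (2 * k)) \<le> k * (x / (2 * k) - 1)" using k by (intro mult_left_mono) auto
    also have "\<dots> = x / 2 - k" using k by (simp add: field_simps)
    finally show ?thesis using True k by (simp add: ln_div algebra_simps)
  qed
  then have "x powr k * exp (- x / 2) \<le> (2 * k) powr k * exp (- k)"
    using True k by (simp add: powr_def flip: exp_add)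
  then have "x powr k * exp (- x / 2) / (2 powr (k + 1) * Gamma (k + 1))
      \<le> (2 * k) powr k * exp (- k) / (2 powr (k + 1) * Gamma (k + 1))"
    using G by (intro divide_right_mono) auto
  also have "\<dots> = stirling_ratio k / (2 * sqrt k)"
    using k G by (simp add: stirling_ratio_def powr_mult powr_add powr_half_sqrt)
  also have "\<dots> \<le> 0.47 / (2 * sqrt k)"
    using stirling_ratio_le[OF m] k by (intro divide_right_mono) (auto simp: k_def)
  also have "\<dots> = 0.47 * sqrt 2 / 2 / sqrt (real m - 2)"
  proof -
    have "sqrt (real m - 2) = sqrt 2 * sqrt k" by (simp add: k_def flip: real_sqrt_mult)
    then show ?thesis by (simp add: field_simps)
  qed
  also have "\<dots> \<le> 0.335 / sqrt (real m - 2)"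
  proof (rule divide_right_mono)
    have "sqrt 2 \<le> 1.42" by (rule real_le_lsqrt) (auto simp: power2_eq_square)
    then show "0.47 * sqrt 2 / 2 \<le> 0.335" by simp
  qed (use m in simp)
  finally show ?thesis using True by (simp add: chi_square_density_def k_def add_ac)
next
  case False
  then show ?thesis using m by (simp add: chi_square_density_def)
qed

definition chi_square_modulus :: "nat \<Rightarrow> real \<Rightarrow> real" where
  "chi_square_modulus m \<epsilon> = (if m = 1 then sqrt (2 * \<epsilon> / pi) else if m = 2 then \<epsilon> / 2
     else 0.335 * \<epsilon> / sqrt (real m - 2))"

lemma chi_square_interval_le:
  assumes N: "prob_space N" and Y: "distributed N lborel Y (chi_square_density m)"
    and m: "m \<ge> 1" and \<epsilon>: "\<epsilon> > 0"
  shows "measure N {\<omega> \<in> space N. a < Y \<omega> \<and> Y \<omega> \<le> a + \<epsilon>} \<le> chi_square_modulus m \<epsilon>"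
proof -
  interpret prob_space N by (rule N)
  have "emeasure N (Y -` {a<..a + \<epsilon>} \<inter> space N) = (\<integral>\<^sup>+x. ennreal (chi_square_density m x) * indicator {a<..a + \<epsilon>} x \<partial>lborel)"
    by (rule distributed_emeasure[OF Y]) simp
  also have "\<dots> \<le> ennreal (chi_square_modulus m \<epsilon>)"
  proof -
    have const: "(\<integral>\<^sup>+x. ennreal (chi_square_density m x) * indicator {a<..a + \<epsilon>} x \<partial>lborel) \<le> ennreal (B * \<epsilon>)"
      if B: "B \<ge> 0" "\<And>x. chi_square_density m x \<le> B" for B
    proof -
      have "(\<integral>\<^sup>+x. ennreal (chi_square_density m x) * indicator {a<..a + \<epsilon>} x \<partial>lborel)
          \<le> (\<integral>\<^sup>+x. ennreal B * indicator {a<..a + \<epsilon>} x \<partial>lborel)"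
        using B by (intro nn_integral_mono mult_right_mono) (auto intro: ennreal_leI)
      also have "\<dots> = ennreal (B * \<epsilon>)"
        using \<epsilon> B by (simp add: nn_integral_cmult_indicator ennreal_mult)
      finally show ?thesis .
    qed
    consider "m = 1" | "m = 2" | "m \<ge> 3" using m by linarith
    then show ?thesis
    proof cases
      case 1
      \<comment> \<open>The density vanishes off the positive half-line, so an interval reaching
        below 0 may be moved to start at 0.\<close>
      define s where "s = max a 0"
      define I where "I = 1 / sqrt (2 * pi) * (2 * sqrt (s + \<epsilon>) - 2 * sqrt s)"
      have s: "s \<ge> 0" "s \<ge> a" by (auto simp: s_def)
      have "((\<lambda>x. 1 / sqrt x) has_integral (2 * sqrt (s + \<epsilon>) - 2 * sqrt s)) {s..s + \<epsilon>}"
      proof (rule fundamental_theorem_of_calculus_interior)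
        show "continuous_on {s..s + \<epsilon>} (\<lambda>x. 2 * sqrt x)" by (intro continuous_intros)
        show "((\<lambda>x. 2 * sqrt x) has_vector_derivative 1 / sqrt x) (at x)" if "x \<in> {s<..<s + \<epsilon>}" for x
          using that s unfolding has_real_derivative_iff_has_vector_derivative[symmetric]
          by (auto intro!: derivative_eq_intros simp: field_simps)
      qed (use \<epsilon> in simp)
      then have int: "((\<lambda>x. 1 / sqrt (2 * pi) * (1 / sqrt x)) has_integral I) {s..s + \<epsilon>}"
        unfolding I_def by (rule has_integral_mult_right)
      \<comment> \<open>\<open>sqrt\<close> is negative at negative arguments; the absolute value
        keeps the majorant nonnegative on the whole line.\<close>
      have "(\<integral>\<^sup>+x. ennreal (chi_square_density m x) * indicator {a<..a + \<epsilon>} x \<partial>lborel)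
          \<le> (\<integral>\<^sup>+x. ennreal (indicator {s..s + \<epsilon>} x * (1 / sqrt (2 * pi) * (1 / \<bar>sqrt x\<bar>))) \<partial>lborel)"
      proof (rule nn_integral_mono)
        fix x :: real
        show "ennreal (chi_square_density m x) * indicator {a<..a + \<epsilon>} x
          \<le> ennreal (indicator {s..s + \<epsilon>} x * (1 / sqrt (2 * pi) * (1 / \<bar>sqrt x\<bar>)))"
        proof (cases "x > 0 \<and> a < x \<and> x \<le> a + \<epsilon>")
          case True
          then have "s \<le> x" "x \<le> s + \<epsilon>" using s by (auto simp: s_def)
          then have "indicator {a<..a + \<epsilon>} x = (1::ennreal)" "indicator {s..s + \<epsilon>} x = (1::real)"
            using True by simp_all
          moreover have "chi_square_density m x \<le> 1 / sqrt (2 * pi) * (1 / \<bar>sqrt x\<bar>)"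
            using True chi_square_density_1_le[of x] 1 by simp
          ultimately show ?thesis by (simp only: mult_1 mult_1_right ennreal_leI)
        next
          case False
          then have "ennreal (chi_square_density m x) * indicator {a<..a + \<epsilon>} x = 0"
            by (auto simp: chi_square_density_def indicator_def)
          then show ?thesis by (simp only: zero_le)
        qed
      qed
      also have "\<dots> = ennreal I"
      proof (rule nn_integral_has_integral_lborel)
        have "((\<lambda>x. 1 / sqrt (2 * pi) * (1 / \<bar>sqrt x\<bar>)) has_integral I) {s..s + \<epsilon>}"
          by (rule has_integral_eq[OF _ int]) (use s in auto)
        then have "((\<lambda>x. if x \<in> {s..s + \<epsilon>} then 1 / sqrt (2 * pi) * (1 / \<bar>sqrt x\<bar>) else 0) has_integral I) UNIV"
          by (simp only: has_integral_restrict_UNIV)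
        then show "((\<lambda>x. indicator {s..s + \<epsilon>} x * (1 / sqrt (2 * pi) * (1 / \<bar>sqrt x\<bar>))) has_integral I) UNIV"
          by (rule has_integral_eq[rotated]) (simp add: indicator_def)
      qed auto
      also have "I \<le> chi_square_modulus m \<epsilon>"
      proof -
        have "sqrt (s + \<epsilon>) \<le> sqrt s + sqrt \<epsilon>" using s \<epsilon> by (intro sqrt_add_le_add_sqrt) auto
        then have "I \<le> 1 / sqrt (2 * pi) * (2 * sqrt \<epsilon>)" unfolding I_def by (intro mult_left_mono) auto
        also have "\<dots> = sqrt (1 / (2 * pi)) * (sqrt 4 * sqrt \<epsilon>)" by (simp add: real_sqrt_divide)
        also have "\<dots> = sqrt (1 / (2 * pi) * (4 * \<epsilon>))" by (simp only: real_sqrt_mult)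
        also have "1 / (2 * pi) * (4 * \<epsilon>) = 2 * \<epsilon> / pi" by simp
        finally show ?thesis using 1 by (simp add: chi_square_modulus_def)
      qed
      finally show ?thesis by (simp add: ennreal_leI)
    next
      case 2
      then show ?thesis using const[of "1/2"] chi_square_density_2_le by (simp add: chi_square_modulus_def)
    next
      case 3
      then show ?thesis using const[of "0.335 / sqrt (real m - 2)"] chi_square_density_le[OF 3]
        by (simp add: chi_square_modulus_def)
    qed
  qed
  finally have "prob (Y -` {a<..a + \<epsilon>} \<inter> space N) \<le> chi_square_modulus m \<epsilon>"
    using \<epsilon> m by (subst (asm) emeasure_eq_measure, subst (asm) ennreal_le_iff)
      (auto simp: chi_square_modulus_def)
  also have "Y -` {a<..a + \<epsilon>} \<inter> space N = {\<omega> \<in> space N. a < Y \<omega> \<and> Y \<omega> \<le> a + \<epsilon>}" by auto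
  finally show ?thesis .
qed

section \<open>Kolmogorov distance\<close>

text \<open>That the density has total mass 1 is read off from the given \<open>Y\<close> and not
  from the Gamma integral.\<close>

lemma distributed_chi_square_density:
  assumes N: "prob_space N" and Y: "distributed N lborel Y (chi_square_density m)" and m: "m \<ge> 1"
  shows "integrable lborel (chi_square_density m)" "(\<integral>x. chi_square_density m x \<partial>lborel) = 1"
    and "h \<in> borel_measurable borel \<Longrightarrow>
      (\<integral>x. h x * chi_square_density m x \<partial>lborel) = (\<integral>\<omega>. h (Y \<omega>) \<partial>N)"
proof -
  interpret prob_space N by (rule N)
  note nonneg = chi_square_density_nonneg[OF m]
  have "(\<integral>\<^sup>+x. ennreal (chi_square_density m x) \<partial>lborel) = emeasure N (Y -` UNIV \<inter> space N)"
    using distributed_emeasure[OF Y, of UNIV] by simp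
  then have nn: "(\<integral>\<^sup>+x. ennreal (chi_square_density m x) \<partial>lborel) = ennreal 1"
    by (simp add: emeasure_space_1)
  show "integrable lborel (chi_square_density m)"
    by (rule integrableI_nn_integral_finite[OF _ _ nn]) (use nonneg in auto)
  show "(\<integral>x. chi_square_density m x \<partial>lborel) = 1"
    by (rule integral_eq_nn_integral[THEN trans]) (use nonneg nn in auto)
  assume "h \<in> borel_measurable borel"
  then show "(\<integral>x. h x * chi_square_density m x \<partial>lborel) = (\<integral>\<omega>. h (Y \<omega>) \<partial>N)"
    using distributed_integral[OF Y, of h] nonneg by (simp add: mult.commute)
qed

lemma smoothed_cdf_bounds:
  assumes M: "prob_space M" and T: "T \<in> borel_measurable M" and \<epsilon>: "\<epsilon> > 0"
  shows "measure M {\<omega> \<in> space M. T \<omega> \<le> z} \<le> (\<integral>\<omega>. smooth_step ((T \<omega> - z) / \<epsilon>) \<partial>M)"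
    and "(\<integral>\<omega>. smooth_step ((T \<omega> - z) / \<epsilon>) \<partial>M) \<le> measure M {\<omega> \<in> space M. T \<omega> \<le> z + \<epsilon>}"
proof -
  interpret prob_space M by (rule M)
  note T[measurable]
  have [measurable]: "smooth_step \<in> borel_measurable borel"
    by (intro borel_measurable_continuous_onI continuous_at_imp_continuous_on ballI DERIV_isCont[OF smooth_step_deriv])
  have int: "integrable M (\<lambda>\<omega>. smooth_step ((T \<omega> - z) / \<epsilon>))"
    by (rule integrable_const_bound[where B = 1]) (use smooth_step_bounds in auto)
  have ind: "integrable M (indicator {\<omega> \<in> space M. T \<omega> \<le> y} :: _ \<Rightarrow> real)"
    "(\<integral>\<omega>. indicator {\<omega> \<in> space M. T \<omega> \<le> y} \<omega> \<partial>M) = measure M {\<omega> \<in> space M. T \<omega> \<le> y}" for y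
    by (auto simp: emeasure_eq_measure)
  show "measure M {\<omega> \<in> space M. T \<omega> \<le> z} \<le> (\<integral>\<omega>. smooth_step ((T \<omega> - z) / \<epsilon>) \<partial>M)"
    unfolding ind(2)[symmetric]
  proof (rule integral_mono[OF ind(1) int])
    fix \<omega>
    show "indicator {\<omega> \<in> space M. T \<omega> \<le> z} \<omega> \<le> smooth_step ((T \<omega> - z) / \<epsilon>)"
    proof (cases "T \<omega> \<le> z")
      case True
      then have "(T \<omega> - z) / \<epsilon> \<le> 0" using \<epsilon> by (simp add: divide_le_0_iff)
      then show ?thesis by (simp add: smooth_step_def)
    qed (simp add: smooth_step_bounds)
  qed
  show "(\<integral>\<omega>. smooth_step ((T \<omega> - z) / \<epsilon>) \<partial>M) \<le> measure M {\<omega> \<in> space M. T \<omega> \<le> z + \<epsilon>}"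
    unfolding ind(2)[symmetric]
  proof (rule integral_mono[OF int ind(1)])
    fix \<omega> assume \<omega>: "\<omega> \<in> space M"
    show "smooth_step ((T \<omega> - z) / \<epsilon>) \<le> indicator {\<omega> \<in> space M. T \<omega> \<le> z + \<epsilon>} \<omega>"
    proof (cases "T \<omega> \<le> z + \<epsilon>")
      case False
      then have "(T \<omega> - z) / \<epsilon> > 1" using \<epsilon> by (simp add: field_simps)
      then show ?thesis by (simp add: smooth_step_def)
    qed (use \<omega> smooth_step_bounds(2) in simp)
  qed
qed

text \<open>The smoothed indicator lies between those of the half-lines ending at \<open>z\<close>
  and \<open>z + \<epsilon>\<close>. Starting it at \<open>z\<close> gives the upper bound, starting
  it at \<open>z - \<epsilon>\<close> the lower one; each time the sandwich costs one interval of
  length \<epsilon> under the law of \<open>Y\<close>.\<close>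

lemma cdf_difference_le:
  assumes M: "prob_space M" and T: "T \<in> borel_measurable M"
    and N: "prob_space N" and Y: "Y \<in> borel_measurable N" and \<epsilon>: "\<epsilon> > 0"
    and smooth: "\<And>z. \<bar>(\<integral>\<omega>. smooth_step ((T \<omega> - z) / \<epsilon>) \<partial>M) - (\<integral>\<omega>. smooth_step ((Y \<omega> - z) / \<epsilon>) \<partial>N)\<bar> \<le> \<Delta>"
    and conc: "\<And>a. measure N {\<omega> \<in> space N. a < Y \<omega> \<and> Y \<omega> \<le> a + \<epsilon>} \<le> K"
  shows "\<bar>measure M {\<omega> \<in> space M. T \<omega> \<le> z} - measure N {\<omega> \<in> space N. Y \<omega> \<le> z}\<bar> \<le> K + \<Delta>"
proof -
  interpret N: prob_space N by (rule N)
  note Y[measurable]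
  have split: "measure N {\<omega> \<in> space N. Y \<omega> \<le> a + \<epsilon>}
      = measure N {\<omega> \<in> space N. Y \<omega> \<le> a} + measure N {\<omega> \<in> space N. a < Y \<omega> \<and> Y \<omega> \<le> a + \<epsilon>}" for a
  proof -
    have "{\<omega> \<in> space N. Y \<omega> \<le> a + \<epsilon>} = {\<omega> \<in> space N. Y \<omega> \<le> a} \<union> {\<omega> \<in> space N. a < Y \<omega> \<and> Y \<omega> \<le> a + \<epsilon>}"
      using \<epsilon> by auto
    then have "measure N {\<omega> \<in> space N. Y \<omega> \<le> a + \<epsilon>}
        = measure N ({\<omega> \<in> space N. Y \<omega> \<le> a} \<union> {\<omega> \<in> space N. a < Y \<omega> \<and> Y \<omega> \<le> a + \<epsilon>})"
      by (rule arg_cong)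
    also have "\<dots> = measure N {\<omega> \<in> space N. Y \<omega> \<le> a} + measure N {\<omega> \<in> space N. a < Y \<omega> \<and> Y \<omega> \<le> a + \<epsilon>}"
      by (rule N.finite_measure_Union) auto
    finally show ?thesis .
  qed
  note b = smoothed_cdf_bounds[OF M T \<epsilon>] smoothed_cdf_bounds[OF N Y \<epsilon>]
  have "measure M {\<omega> \<in> space M. T \<omega> \<le> z} - measure N {\<omega> \<in> space N. Y \<omega> \<le> z} \<le> K + \<Delta>"
    using b(1)[of z] b(4)[of z] smooth[of z] split[of z] conc[of z] by linarith
  moreover have "measure N {\<omega> \<in> space N. Y \<omega> \<le> z} - measure M {\<omega> \<in> space M. T \<omega> \<le> z} \<le> K + \<Delta>"
    using b(3)[of "z - \<epsilon>"] b(2)[of "z - \<epsilon>"] smooth[of "z - \<epsilon>"] split[of "z - \<epsilon>"] conc[of "z - \<epsilon>"] by simp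
  ultimately show ?thesis by linarith
qed

section \<open>The bound with free smoothing width\<close>

context cell_probabilities
begin

text \<open>Since \<open>r / (r + 1)\<close> and \<open>r / (r + 3)\<close> are at most 1, the decay
  of the Stein derivatives removes the number of cells. The constants round up \<open>54.05\<close>,
  \<open>12.71\<close> and \<open>3.8\<close>.\<close>

lemma pearson_smooth_bound:
  fixes h h' h'' :: "real \<Rightarrow> real" and D1 D2 \<delta> :: real
  assumes r: "r \<ge> 2" and n: "n \<ge> 1"
    and dens: "integrable lborel (chi_square_density (r - 1))" "(\<integral>x. chi_square_density (r - 1) x \<partial>lborel) = 1"
    and h01: "\<And>x. 0 \<le> h x \<and> h x \<le> 1"
    and h': "\<And>x. (h has_real_derivative h' x) (at x)" "\<And>x. \<bar>h' x\<bar> \<le> D1"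
    and h'': "\<And>x. (h' has_real_derivative h'' x) (at x)" "\<And>x. \<bar>h'' x\<bar> \<le> D2"
    and \<delta>: "\<And>j. j \<in> {1..r} \<Longrightarrow> cell_scale n j \<le> \<delta>" "\<delta> \<le> 1/72"
  shows "\<bar>mexp n (\<lambda>u. h (pearson n u)) - (\<integral>x. h x * chi_square_density (r - 1) x \<partial>lborel)\<bar>
    \<le> \<delta> * (55 + 13 * D1 + 4 * D2)"
proof -
  have m: "r - 1 \<ge> 1" and m2: "real (r - 1) + 2 = r + 1" "real (r - 1) + 4 = r + 3" using r by (auto simp: of_nat_diff)
  have D: "D1 \<ge> 0" "D2 \<ge> 0" using h'(2)[of 0] h''(2)[of 0] by auto
  have \<delta>0: "\<delta> \<ge> 0" using \<delta>(1)[of 1] cell_scale_pos[OF n, of 1] r by simp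
  show ?thesis
  proof (rule stein_factor_bounds[OF m dens h01 h' h''])
    fix g g' g''
    assume g:
    "\<And>x. x > 0 \<Longrightarrow> (g has_real_derivative g' x) (at x)"
    "\<And>x. x > 0 \<Longrightarrow> (g' has_real_derivative g'' x) (at x)"
    "\<And>x. x > 0 \<Longrightarrow> x * g' x + (real (r - 1) / 2 - x / 2) * g x = h x - (\<integral>x. h x * chi_square_density (r - 1) x \<partial>lborel)"
    "\<And>x. x > 0 \<Longrightarrow> \<bar>g x\<bar> \<le> 8"
    "\<And>x. x > 0 \<Longrightarrow> \<bar>x * g' x\<bar> \<le> 2"
    "\<And>x. x > 0 \<Longrightarrow> (real (r - 1) + 2) * \<bar>g' x\<bar> \<le> 10 + 2 * D1"
    "\<And>x. x > 0 \<Longrightarrow> (real (r - 1) + 4) * \<bar>g'' x\<bar> \<le> 15 + 4 * D1 + 2 * D2"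
  define G1 where "G1 = (10 + 2 * D1) / (r + 1)"
  define G2 where "G2 = (15 + 4 * D1 + 2 * D2) / (r + 3)"
  have g1: "\<bar>g' x\<bar> \<le> G1" "\<bar>g'' x\<bar> \<le> G2" if "x > 0" for x
    using g(6,7)[OF that] unfolding m2 G1_def G2_def by (simp_all add: field_simps)
  have "real r / (r + 1) * (10 + 2 * D1) \<le> 1 * (10 + 2 * D1)"
    using D by (intro mult_right_mono) auto
  then have rG1: "r * G1 \<le> 10 + 2 * D1" by (simp add: G1_def)
  have "real r / (r + 3) * (15 + 4 * D1 + 2 * D2) \<le> 1 * (15 + 4 * D1 + 2 * D2)"
    using D by (intro mult_right_mono) auto
  then have rG2: "r * G2 \<le> 15 + 4 * D1 + 2 * D2" by (simp add: G2_def)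
  have "n = Suc (n - 1)" using n by simp
  from pearson_stein_bound[OF this g(1-5) g1 h' \<delta>]
  have "\<bar>mexp n (\<lambda>u. h (pearson n u)) - (\<integral>x. h x * chi_square_density (r - 1) x \<partial>lborel)\<bar>
      \<le> \<delta> * (2.05 * (D1 + 5) + 1.53 * r * G1 + 1.9 * r * G2)" .
  also have "\<dots> \<le> \<delta> * (55 + 13 * D1 + 4 * D2)"
  proof (rule mult_left_mono[OF _ \<delta>0])
    have le: "41/20 * D1 + 205/20 + 153/100 * a + 19/10 * b \<le> 55 + 13 * D1 + 4 * D2"
      if "a \<le> 10 + 2 * D1" "b \<le> 15 + 4 * D1 + 2 * D2" for a b :: real
      using that D by linarith
    have "2.05 * (D1 + 5) + 1.53 * r * G1 + 1.9 * r * G2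
        = 41/20 * D1 + 205/20 + 153/100 * (r * G1) + 19/10 * (r * G2)"
      by (simp add: field_simps)
    also have "\<dots> \<le> 55 + 13 * D1 + 4 * D2" by (rule le[OF rG1 rG2])
    finally show "2.05 * (D1 + 5) + 1.53 * r * G1 + 1.9 * r * G2 \<le> 55 + 13 * D1 + 4 * D2" .
  qed
  finally show ?thesis .
  qed
qed

text \<open>The scaled step has \<open>D1 = 15/8 / \<epsilon>\<close> and
  \<open>D2 = 15 / \<epsilon>^2\<close>, whence \<open>195/8 = 13 * 15/8\<close>,
  \<open>60 = 4 * 15\<close> and \<open>5/4 = 15/8 * 2/3\<close>, the last factor coming from
  \<open>mexp_power_divergence_diff\<close>.\<close>

lemma power_divergence_kolmogorov_bound:
  fixes M :: "'a measure" and X :: "nat \<Rightarrow> 'a \<Rightarrow> nat" and N :: "'b measure" and Y :: "'b \<Rightarrow> real"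
  assumes r: "r \<ge> 2" and n: "n \<ge> 1" and lam: "lam > -1"
    and M: "prob_space M"
    and indep: "prob_space.indep_vars M (\<lambda>_. count_space {1..r}) X {1..n}"
    and dist: "\<And>i j. i \<in> {1..n} \<Longrightarrow> j \<in> {1..r} \<Longrightarrow> measure M {\<omega> \<in> space M. X i \<omega> = j} = p j"
    and N: "prob_space N" and Y: "distributed N lborel Y (chi_square_density (r - 1))"
    and \<delta>: "\<And>j. j \<in> {1..r} \<Longrightarrow> cell_scale n j \<le> \<delta>" "\<delta> \<le> (1/72 :: real)"
    and large: "\<And>j. lam \<ge> 2 \<Longrightarrow> j \<in> {1..r} \<Longrightarrow> n * p j \<ge> 2 * (lam - 2)\<^sup>2"
    and \<epsilon>: "\<epsilon> > 0"
  defines "T \<equiv> \<lambda>\<omega>. power_divergence lam n r p (\<lambda>j. observed_count n X j \<omega>)"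
    and "\<kappa> \<equiv> \<bar>lam - 1\<bar> * (4 * lam + 7) / (lam + 1)"
  shows "\<bar>measure M {\<omega> \<in> space M. T \<omega> \<le> z} - measure N {\<omega> \<in> space N. Y \<omega> \<le> z}\<bar>
    \<le> chi_square_modulus (r - 1) \<epsilon> + \<delta> * (55 + (195/8 + 5/4 * r * \<kappa>) / \<epsilon> + 60 / \<epsilon>\<^sup>2)"
proof -
  have m: "r - 1 \<ge> 1" using r by simp
  note obs = integral_observed_count[OF M indep dist order_refl]
  have Tm: "T \<in> borel_measurable M" unfolding T_def by (rule obs(1))
  have Ym: "Y \<in> borel_measurable N" using distributed_measurable[OF Y] by simp
  define \<Delta> where "\<Delta> = \<delta> * (55 + (195/8 + 5/4 * r * \<kappa>) / \<epsilon> + 60 / \<epsilon>\<^sup>2)"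
  have "\<bar>(\<integral>\<omega>. smooth_step ((T \<omega> - z) / \<epsilon>) \<partial>M) - (\<integral>\<omega>. smooth_step ((Y \<omega> - z) / \<epsilon>) \<partial>N)\<bar> \<le> \<Delta>" for z
  proof -
    define h where "h x = smooth_step ((x - z) / \<epsilon>)" for x
    define h' where "h' x = smooth_step1 ((x - z) / \<epsilon>) / \<epsilon>" for x
    define h'' where "h'' x = smooth_step2 ((x - z) / \<epsilon>) / \<epsilon> / \<epsilon>" for x
    define D1 where "D1 = 15/8 / \<epsilon>"
    have lin: "((\<lambda>x. (x - z) / \<epsilon>) has_real_derivative 1 / \<epsilon>) (at x)" for x
      using \<epsilon> by (auto intro!: derivative_eq_intros)
    have dh: "(h has_real_derivative h' x) (at x)" for x
      unfolding h_def[abs_def] h'_def using DERIV_chain2[OF smooth_step_deriv lin] by simp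
    have dh': "(h' has_real_derivative h'' x) (at x)" for x
      unfolding h'_def[abs_def] h''_def
      using DERIV_cdivide[OF DERIV_chain2[OF smooth_step1_deriv lin]] by simp
    have bh: "\<bar>h' x\<bar> \<le> D1" for x
    proof -
      have "\<bar>h' x\<bar> = \<bar>smooth_step1 ((x - z) / \<epsilon>)\<bar> / \<epsilon>" using \<epsilon> by (simp add: h'_def)
      also have "\<dots> \<le> D1" unfolding D1_def using \<epsilon> by (intro divide_right_mono smooth_step_deriv_bounds) auto
      finally show ?thesis .
    qed
    have bh': "\<bar>h'' x\<bar> \<le> 15 / \<epsilon> / \<epsilon>" for x
    proof -
      have "\<bar>h'' x\<bar> = \<bar>smooth_step2 ((x - z) / \<epsilon>)\<bar> / \<epsilon> / \<epsilon>" using \<epsilon> by (simp add: h''_def)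
      also have "\<dots> \<le> 15 / \<epsilon> / \<epsilon>" using \<epsilon> by (intro divide_right_mono smooth_step_deriv_bounds) auto
      finally show ?thesis .
    qed
    have D1: "D1 \<ge> 0" using \<epsilon> by (simp add: D1_def)
    have hm: "h \<in> borel_measurable borel"
      by (intro borel_measurable_continuous_onI continuous_at_imp_continuous_on ballI DERIV_isCont[OF dh])
    have "\<bar>mexp n (\<lambda>u. h (power_divergence lam n r p u)) - mexp n (\<lambda>u. h (pearson n u))\<bar>
        \<le> mexp n (\<lambda>u. D1 * \<bar>power_divergence lam n r p u - pearson n u\<bar>)"
      unfolding mexp_diff[symmetric]
    proof (rule order_trans[OF mexp_abs_le mexp_mono])
      fix u
      show "\<bar>h (power_divergence lam n r p u) - h (pearson n u)\<bar> \<le> D1 * \<bar>power_divergence lam n r p u - pearson n u\<bar>"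
        using field_differentiable_bound[of UNIV h h' D1 "power_divergence lam n r p u" "pearson n u"] dh bh by auto
    qed
    also have "\<dots> \<le> D1 * (r * \<delta> * (2/3 * \<kappa>))"
      unfolding mexp_cmult \<kappa>_def using D1
      by (intro mult_left_mono mexp_power_divergence_diff[OF n lam \<delta> large])
    finally have 1: "\<bar>mexp n (\<lambda>u. h (power_divergence lam n r p u)) - mexp n (\<lambda>u. h (pearson n u))\<bar>
        \<le> D1 * (r * \<delta> * (2/3 * \<kappa>))" .
    note dens = distributed_chi_square_density[OF N Y m]
    have 2: "\<bar>mexp n (\<lambda>u. h (pearson n u)) - (\<integral>x. h x * chi_square_density (r - 1) x \<partial>lborel)\<bar>
        \<le> \<delta> * (55 + 13 * D1 + 4 * (15 / \<epsilon> / \<epsilon>))"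
      by (rule pearson_smooth_bound[OF r n dens(1,2) _ dh bh dh' bh' \<delta>])
        (simp add: h_def smooth_step_bounds)
    have 3: "(\<integral>\<omega>. h (T \<omega>) \<partial>M) = mexp n (\<lambda>u. h (power_divergence lam n r p u))"
      unfolding T_def by (rule obs(3))
    have "D1 * (r * \<delta> * (2/3 * \<kappa>)) + \<delta> * (55 + 13 * D1 + 4 * (15 / \<epsilon> / \<epsilon>)) = \<Delta>"
      using \<epsilon> by (simp add: \<Delta>_def D1_def power2_eq_square field_simps)
    then have "\<bar>(\<integral>\<omega>. h (T \<omega>) \<partial>M) - (\<integral>\<omega>. h (Y \<omega>) \<partial>N)\<bar> \<le> \<Delta>"
      using 1 2 3 dens(3)[OF hm] by linarith
    then show ?thesis unfolding h_def .
  qed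
  then show ?thesis
    unfolding \<Delta>_def[symmetric]
    by (rule cdf_difference_le[OF M Tm N Ym \<epsilon> _ chi_square_interval_le[OF N Y m \<epsilon>]])
qed

end

text \<open>The widths of smoothing are \<open>80 / y\<^sup>2\<close> with \<open>y = (n pstar)\<^bsup>1/10\<^esup>\<close> for \<open>r = 2\<close>, and \<open>36 / y\<close> respectively
  \<open>38 s / y\<close> with \<open>y = (n pstar)\<^bsup>1/6\<^esup>\<close>, \<open>s = (r - 3)\<^bsup>1/6\<^esup>\<close> for \<open>r = 3\<close> and \<open>r \<ge> 4\<close>.\<close>

lemma rate_two_cells:
  fixes y K :: real
  assumes y: "y > 0" and K: "K \<ge> 0"
  shows "sqrt (2 * (80 / y\<^sup>2) / pi) + 1 / y ^ 5 * (55 + (195/8 + 5/4 * K) / (80 / y\<^sup>2) + 60 / (80 / y\<^sup>2)\<^sup>2)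
    \<le> 1 / y * (8 + (21 + K / 52) * (1 / y\<^sup>2) + 72 / y ^ 4)"
proof -
  define i where "i = 1 / y"
  have i: "i > 0" and y_i: "y = 1 / i" using y by (auto simp: i_def)
  \<comment> \<open>In powers of \<open>1 / y\<close> the claim is a comparison of coefficients. The
    width 80 is large enough for \<open>5/4 / 80 \<le> 1/52\<close>, and small enough for the
    interval mass together with the \<open>60/6400\<close> share to stay below 8; 36 and 38 below
    play the same role.\<close>
  have le: "a + (55 * e + 195/640 * c + 1/64 * k + 60/6400 * b) \<le> 8 * b + 21 * c + 1/52 * k + 72 * e"
    if "a \<le> 15/2 * b" "0 \<le> b" "0 \<le> c" "0 \<le> e" "0 \<le> k" for a b c e k :: real
    using that by linarith
  have "sqrt (2 * (80 / y\<^sup>2) / pi) \<le> 15/2 * i"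
  proof (rule real_le_lsqrt)
    have "1/2 \<le> pi / 6" using sin_x_le_x[of "pi / 6"] by (simp add: sin_30)
    then have "160 / pi \<le> 160 / 3" by (intro divide_left_mono) auto
    then have "160 / pi * i\<^sup>2 \<le> (15/2)\<^sup>2 * i\<^sup>2"
      by (intro mult_right_mono) (auto simp: power2_eq_square)
    then show "2 * (80 / y\<^sup>2) / pi \<le> (15/2 * i)\<^sup>2"
      unfolding y_i by (simp add: power_mult_distrib power_divide)
  qed (use i in auto)
  moreover have "1 / y ^ 5 * (55 + (195/8 + 5/4 * K) / (80 / y\<^sup>2) + 60 / (80 / y\<^sup>2)\<^sup>2)
      = 55 * i ^ 5 + 195/640 * i ^ 3 + 1/64 * (K * i ^ 3) + 60/6400 * i"
    unfolding y_i using i by (simp add: field_simps eval_nat_numeral)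
  moreover have "1 / y * (8 + (21 + K / 52) * (1 / y\<^sup>2) + 72 / y ^ 4)
      = 8 * i + 21 * i ^ 3 + 1/52 * (K * i ^ 3) + 72 * i ^ 5"
    unfolding y_i using i by (simp add: field_simps eval_nat_numeral)
  ultimately show ?thesis
    using le[of _ i "i ^ 3" "i ^ 5" "K * i ^ 3"] i K by (simp only: mult_nonneg_nonneg zero_le_power less_imp_le)
qed

lemma rate_three_cells:
  fixes y K :: real
  assumes y: "y > 0" and K: "K \<ge> 0"
  shows "36 / y / 2 + 1 / y ^ 3 * (55 + (195/8 + 5/4 * K) / (36 / y) + 60 / (36 / y)\<^sup>2)
    \<le> 1 / y * (19 + (44 + K / 25) * (1 / y) + 72 / y\<^sup>2)"
proof -
  define i where "i = 1 / y"
  have i: "i > 0" and y_i: "y = 1 / i" using y by (auto simp: i_def)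
  have le: "18 * b + 55 * e + 195/288 * c + 5/144 * k + 60/1296 * b \<le> 19 * b + 44 * c + 1/25 * k + 72 * e"
    if "0 \<le> b" "0 \<le> c" "0 \<le> e" "0 \<le> k" for b c e k :: real
    using that by linarith
  have "36 / y / 2 + 1 / y ^ 3 * (55 + (195/8 + 5/4 * K) / (36 / y) + 60 / (36 / y)\<^sup>2)
      = 18 * i + 55 * i ^ 3 + 195/288 * i\<^sup>2 + 5/144 * (K * i\<^sup>2) + 60/1296 * i"
    unfolding y_i using i by (simp add: field_simps eval_nat_numeral)
  moreover have "1 / y * (19 + (44 + K / 25) * (1 / y) + 72 / y\<^sup>2)
      = 19 * i + 44 * i\<^sup>2 + 1/25 * (K * i\<^sup>2) + 72 * i ^ 3"
    unfolding y_i using i by (simp add: field_simps eval_nat_numeral)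
  ultimately show ?thesis
    using le[of i "i\<^sup>2" "i ^ 3" "K * i\<^sup>2"] i K by (simp only: mult_nonneg_nonneg zero_le_power less_imp_le)
qed

lemma rate_many_cells:
  fixes y s K :: real
  assumes y: "y > 0" and s: "s > 0" and K: "K \<ge> 0"
  shows "0.335 * (38 * s / y) / s ^ 3 + 1 / y ^ 3 * (55 + (195/8 + 5/4 * K) / (38 * s / y) + 60 / (38 * s / y)\<^sup>2)
    \<le> 1 / (s\<^sup>2 * y) * (13 + (37 + K / 30) * (s / y) + 72 * s\<^sup>2 / y\<^sup>2)"
proof -
  define i where "i = 1 / y"
  define j where "j = 1 / s"
  have i: "i > 0" and y_i: "y = 1 / i" using y by (auto simp: i_def)
  have j: "j > 0" and s_j: "s = 1 / j" using s by (auto simp: j_def)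
  have le: "1273/100 * b + 55 * e + 195/304 * c + 5/152 * k + 60/1444 * b \<le> 13 * b + 37 * c + 1/30 * k + 72 * e"
    if "0 \<le> b" "0 \<le> c" "0 \<le> e" "0 \<le> k" for b c e k :: real
    using that by linarith
  have "0.335 * (38 * s / y) / s ^ 3 + 1 / y ^ 3 * (55 + (195/8 + 5/4 * K) / (38 * s / y) + 60 / (38 * s / y)\<^sup>2)
      = 1273/100 * (i * j\<^sup>2) + 55 * i ^ 3 + 195/304 * (i\<^sup>2 * j) + 5/152 * (K * (i\<^sup>2 * j)) + 60/1444 * (i * j\<^sup>2)"
    unfolding y_i s_j using i j by (simp add: field_simps eval_nat_numeral)
  moreover have "1 / (s\<^sup>2 * y) * (13 + (37 + K / 30) * (s / y) + 72 * s\<^sup>2 / y\<^sup>2)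
      = 13 * (i * j\<^sup>2) + 37 * (i\<^sup>2 * j) + 1/30 * (K * (i\<^sup>2 * j)) + 72 * i ^ 3"
    unfolding y_i s_j using i j by (simp add: field_simps eval_nat_numeral)
  ultimately show ?thesis
    using le[of "i * j\<^sup>2" "i\<^sup>2 * j" "i ^ 3" "K * (i\<^sup>2 * j)"] i j K
    by (simp only: mult_nonneg_nonneg zero_le_power less_imp_le)
qed

theorem corollary2p4:
  fixes n r :: nat and p :: "nat \<Rightarrow> real" and pstar lam :: real
    and M :: "'a measure" and X :: "nat \<Rightarrow> 'a \<Rightarrow> nat"
    and N :: "'b measure" and Y :: "'b \<Rightarrow> real"
    and T :: "'a \<Rightarrow> real" and D :: real
  assumes "n \<ge> 1" and "r \<ge> 2"
    and "\<And>j. j \<in> {1..r} \<Longrightarrow> p j > 0"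
    and "(\<Sum>j=1..r. p j) = 1"
    and "pstar = Min (p ` {1..r})"
    and "prob_space M"
    and "prob_space.indep_vars M (\<lambda>_. count_space {1..r}) X {1..n}"
    and "\<And>i j. i \<in> {1..n} \<Longrightarrow> j \<in> {1..r} \<Longrightarrow>
           measure M {\<omega> \<in> space M. X i \<omega> = j} = p j"
    and "lam > -1"
    and "T = (\<lambda>\<omega>. power_divergence lam n r p (\<lambda>j. observed_count n X j \<omega>))"
    and "n * pstar \<ge> 2"
    and "lam \<ge> 2 \<Longrightarrow> n * pstar \<ge> 2 * (lam - 2)\<^sup>2"
    and "prob_space N"
    and "distributed N lborel Y (chi_square_density (r - 1))"
    and "D = (SUP z\<in>{0<..}. \<bar>measure M {\<omega> \<in> space M. T \<omega> \<le> z}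
                           - measure N {\<omega> \<in> space N. Y \<omega> \<le> z}\<bar>)"
  shows
    "(r = 2 \<longrightarrow>
        D \<le> 1 / (n * pstar) powr (1/10) *
              (8 + (21 + \<bar>lam - 1\<bar> * (4 * lam + 7) * r / (52 * (lam + 1)))
                     * (1 / (n * pstar) powr (1/5))
                 + 72 / (n * pstar) powr (2/5))) \<and>
     (r = 3 \<longrightarrow>
        D \<le> 1 / (n * pstar) powr (1/6) *
              (19 + (44 + \<bar>lam - 1\<bar> * (4 * lam + 7) * r / (25 * (lam + 1)))
                     * (1 / (n * pstar) powr (1/6))
                  + 72 / (n * pstar) powr (1/3))) \<and>
     (r \<ge> 4 \<longrightarrow>
        D \<le> 1 / ((real r - 3) powr (1/3) * (n * pstar) powr (1/6)) *
              (13 + (37 + \<bar>lam - 1\<bar> * (4 * lam + 7) * r / (30 * (lam + 1)))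
                     * ((real r - 3) powr (1/6) / (n * pstar) powr (1/6))
                  + 72 * (real r - 3) powr (1/3) / (n * pstar) powr (1/3)))"
proof -
  note n = assms(1) and r = assms(2) and lam = assms(9)
  interpret cell_probabilities r p
    using assms(3,4) by unfold_locales auto
  interpret M: prob_space M by (rule assms(6))
  interpret N: prob_space N by (rule assms(13))
  define \<nu> where "\<nu> = n * pstar"
  define \<kappa> where "\<kappa> = \<bar>lam - 1\<bar> * (4 * lam + 7) / (lam + 1)"
  have \<nu>: "\<nu> \<ge> 2" using assms(11) by (simp add: \<nu>_def)
  have \<kappa>: "\<kappa> \<ge> 0" using lam by (simp add: \<kappa>_def)
  then have K: "r * \<kappa> \<ge> 0" by simp
  have \<nu>_le: "\<nu> \<le> n * p j" if "j \<in> {1..r}" for j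
    unfolding \<nu>_def assms(5) using that by (intro mult_left_mono Min_le) auto
  have D_le: "D \<le> B"
    if "\<And>z. z > 0 \<Longrightarrow> \<bar>measure M {\<omega> \<in> space M. T \<omega> \<le> z} - measure N {\<omega> \<in> space N. Y \<omega> \<le> z}\<bar> \<le> B" for B
    unfolding assms(15) using that by (intro cSUP_least) auto
  \<comment> \<open>Settles the range \<open>\<nu> < 72\<^sup>2\<close>, where the last summand of
    each bound already exceeds 1.\<close>
  have D_1: "D \<le> 1"
  proof (rule D_le)
    fix z
    show "\<bar>measure M {\<omega> \<in> space M. T \<omega> \<le> z} - measure N {\<omega> \<in> space N. Y \<omega> \<le> z}\<bar> \<le> 1"
      using M.prob_le_1[of "{\<omega> \<in> space M. T \<omega> \<le> z}"] N.prob_le_1[of "{\<omega> \<in> space N. Y \<omega> \<le> z}"]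
        measure_nonneg[of M "{\<omega> \<in> space M. T \<omega> \<le> z}"] measure_nonneg[of N "{\<omega> \<in> space N. Y \<omega> \<le> z}"]
      by linarith
  qed
  have main: "D \<le> chi_square_modulus (r - 1) \<epsilon> + 1 / sqrt \<nu> * (55 + (195/8 + 5/4 * (r * \<kappa>)) / \<epsilon> + 60 / \<epsilon>\<^sup>2)"
    if large: "\<nu> \<ge> 72\<^sup>2" and \<epsilon>: "\<epsilon> > 0" for \<epsilon>
  proof (rule D_le)
    fix z
    have s72: "sqrt \<nu> \<ge> 72" using large by (intro real_le_rsqrt)
    have \<delta>: "1 / sqrt \<nu> \<le> 1/72" using s72 \<nu> by (intro divide_left_mono) auto
    have sc: "cell_scale n j \<le> 1 / sqrt \<nu>" if "j \<in> {1..r}" for j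
      unfolding cell_scale_def using \<nu>_le[OF that] \<nu> by (intro divide_left_mono) auto
    have lg: "n * p j \<ge> 2 * (lam - 2)\<^sup>2" if "lam \<ge> 2" "j \<in> {1..r}" for j
      using assms(12)[OF that(1)] \<nu>_le[OF that(2)] by (simp add: \<nu>_def)
    show "\<bar>measure M {\<omega> \<in> space M. T \<omega> \<le> z} - measure N {\<omega> \<in> space N. Y \<omega> \<le> z}\<bar>
        \<le> chi_square_modulus (r - 1) \<epsilon> + 1 / sqrt \<nu> * (55 + (195/8 + 5/4 * (r * \<kappa>)) / \<epsilon> + 60 / \<epsilon>\<^sup>2)"
      using power_divergence_kolmogorov_bound[OF r n lam assms(6,7,8,13,14) sc \<delta> lg \<epsilon>, of z]
      unfolding assms(10) \<kappa>_def by (simp only: mult.assoc)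
  qed
  have \<kappa>_eq: "\<bar>lam - 1\<bar> * (4 * lam + 7) * r / (c * (lam + 1)) = r * \<kappa> / c" for c :: real
    by (simp add: \<kappa>_def mult.commute)
  \<comment> \<open>Rewrites all real exponents as natural powers of one root \<open>y\<close>, the
    form in which the rate lemmas are stated.\<close>
  have pw: "(\<nu> powr a) ^ k = \<nu> powr b" if "real k * a = b" for a b k
    using \<nu> that by (simp add: powr_power)
  have two: "D \<le> 1 / \<nu> powr (1/10) * (8 + (21 + r * \<kappa> / 52) * (1 / \<nu> powr (1/5)) + 72 / \<nu> powr (2/5))"
    if r2: "r = 2"
  proof -
    define y where "y = \<nu> powr (1/10)"
    have y: "y > 0" using \<nu> by (simp add: y_def)
    have y2: "\<nu> powr (1/5) = y\<^sup>2" and y4: "\<nu> powr (2/5) = y ^ 4" and y5: "sqrt \<nu> = y ^ 5"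
      using pw[of 2 "1/10" "1/5"] pw[of 4 "1/10" "2/5"] pw[of 5 "1/10" "1/2"] \<nu> by (simp_all add: y_def powr_half_sqrt)
    show ?thesis
    proof (cases "\<nu> \<ge> 72\<^sup>2")
      case True
      have "D \<le> sqrt (2 * (80 / y\<^sup>2) / pi) + 1 / y ^ 5 * (55 + (195/8 + 5/4 * (r * \<kappa>)) / (80 / y\<^sup>2) + 60 / (80 / y\<^sup>2)\<^sup>2)"
        using main[OF True, of "80 / y\<^sup>2"] y r2 unfolding y5 by (simp add: chi_square_modulus_def)
      then show ?thesis
        using rate_two_cells[OF y K] unfolding y2 y4 y_def[symmetric] by linarith
    next
      case False
      then have "y ^ 5 < 72" unfolding y5[symmetric] by (intro real_less_lsqrt) auto
      then have "1 \<le> 72 / y ^ 5" using y by simp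
      also have "\<dots> = 1 / y * (72 / y ^ 4)" by (simp add: eval_nat_numeral)
      also have "\<dots> \<le> 1 / y * (8 + (21 + r * \<kappa> / 52) * (1 / y\<^sup>2) + 72 / y ^ 4)"
        using y K by (intro mult_left_mono) auto
      finally show ?thesis using D_1 unfolding y2 y4 y_def[symmetric] by linarith
    qed
  qed
  define y where "y = \<nu> powr (1/6)"
  have y: "y > 0" using \<nu> by (simp add: y_def)
  have y2: "\<nu> powr (1/3) = y\<^sup>2" and y3: "sqrt \<nu> = y ^ 3"
    using pw[of 2 "1/6" "1/3"] pw[of 3 "1/6" "1/2"] \<nu> by (simp_all add: y_def powr_half_sqrt)
  have small: "1 \<le> 72 / y ^ 3" if "\<not> \<nu> \<ge> 72\<^sup>2"
  proof -
    have "y ^ 3 < 72" unfolding y3[symmetric] using that by (intro real_less_lsqrt) auto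
    then show ?thesis using y by simp
  qed
  have three: "D \<le> 1 / y * (19 + (44 + r * \<kappa> / 25) * (1 / y) + 72 / y\<^sup>2)"
    if r3: "r = 3"
  proof (cases "\<nu> \<ge> 72\<^sup>2")
    case True
    have "D \<le> 36 / y / 2 + 1 / y ^ 3 * (55 + (195/8 + 5/4 * (r * \<kappa>)) / (36 / y) + 60 / (36 / y)\<^sup>2)"
      using main[OF True, of "36 / y"] y r3 unfolding y3 by (simp add: chi_square_modulus_def)
    then show ?thesis using rate_three_cells[OF y K] by linarith
  next
    case False
    note small[OF False]
    also have "72 / y ^ 3 = 1 / y * (72 / y\<^sup>2)" by (simp add: eval_nat_numeral)
    also have "\<dots> \<le> 1 / y * (19 + (44 + r * \<kappa> / 25) * (1 / y) + 72 / y\<^sup>2)"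
      using y K by (intro mult_left_mono) auto
    finally show ?thesis using D_1 by linarith
  qed
  have many: "D \<le> 1 / ((real r - 3) powr (1/3) * y) * (13 + (37 + r * \<kappa> / 30) * ((real r - 3) powr (1/6) / y)
      + 72 * (real r - 3) powr (1/3) / y\<^sup>2)"
    if r4: "r \<ge> 4"
  proof -
    define s where "s = (real r - 3) powr (1/6)"
    have s: "s > 0" using r4 by (simp add: s_def)
    have s2: "(real r - 3) powr (1/3) = s\<^sup>2" and s3: "sqrt (real r - 3) = s ^ 3"
      using r4 by (simp_all add: s_def powr_power powr_half_sqrt)
    show ?thesis
    proof (cases "\<nu> \<ge> 72\<^sup>2")
      case True
      have "real (r - 1) - 2 = real r - 3" "r - 1 \<noteq> 1" "r - 1 \<noteq> 2" using r4 by (auto simp: of_nat_diff)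
      then have modulus: "chi_square_modulus (r - 1) (38 * s / y) = 0.335 * (38 * s / y) / s ^ 3"
        by (simp only: chi_square_modulus_def s3 if_False)
      have pos: "38 * s / y > 0" using s y by simp
      have "D \<le> 0.335 * (38 * s / y) / s ^ 3
          + 1 / y ^ 3 * (55 + (195/8 + 5/4 * (r * \<kappa>)) / (38 * s / y) + 60 / (38 * s / y)\<^sup>2)"
        using main[OF True pos] unfolding y3 modulus .
      also note rate_many_cells[OF y s K]
      finally show ?thesis unfolding s2 s_def[symmetric] .
    next
      case False
      note small[OF False]
      also have "72 / y ^ 3 = 1 / (s\<^sup>2 * y) * (72 * s\<^sup>2 / y\<^sup>2)" using s by (simp add: eval_nat_numeral)
      also have "\<dots> \<le> 1 / (s\<^sup>2 * y) * (13 + (37 + r * \<kappa> / 30) * (s / y) + 72 * s\<^sup>2 / y\<^sup>2)"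
        using y s K by (intro mult_left_mono) auto
      finally show ?thesis unfolding s2 s_def[symmetric] using D_1 by (rule order_trans[rotated])
    qed
  qed
  show ?thesis
    unfolding \<nu>_def[symmetric] \<kappa>_eq unfolding y_def[symmetric] y2
    by (intro conjI impI two three many)
qed

end
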